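(* Let $-1\leq B<A\leq 1$, let $c>-1$, let $f\in\mathcal{A}$, and let $F$ be the function given by Bernardi's integral operator $$F(z)=\frac{c+1}{z^{c}}\int_{0}^{z}t^{c-1}f(t)\,dt .$$ For real $\beta,\gamma$ consider the conditions: (C1) $e^2\beta(1-B^2)+e\big(-B(-A\beta+B\gamma+B)-\beta+\gamma+1\big)+\gamma(AB-1)\geq 0$; (C2) $\Big(e\big((A+e-1)\beta-(e\beta+1)B+1\big)+\gamma\big(A+e(1-B)-1\big)\Big)\Big(e\big(-(A-e+1)\beta+B(e\beta+1)+1\big)+\gamma\big(-A+e(B+1)-1\big)\Big)\geq 0$; (C3) $e\big(\beta(1-AB)+B^2(\gamma-1)-\gamma+1\big)+e^2\gamma(1-AB)+\beta(B^2-1)\geq 0$; (C4) $\Big(e\big((A-1)\beta+(1-B)(\gamma-1)\big)+e^2(A-1)\gamma+\beta(1-B)\Big)\Big(-e\big((A+1)\beta+(B+1)(1-\gamma)\big)-e^2(A+1)\gamma+\beta(B+1)\Big)\geq 0$. (i) If $f\in\mathcal{S}^*[A,B]$ and (C1)–(C4) hold with $\beta=1$ and $\gamma=c$, then $F\in\mathcal{S}^*_e$. (ii) If $f\in\mathcal{R}[A,B]$ and (C1)–(C4) hold with $\beta=0$ and $\gamma=c+1$, then $F'(z)\prec e^{z}$.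
   Context: $\mathbb{D}=\{z\in\mathbb{C}:|z|<1\}$. $\mathcal{A}$ is the class of analytic functions $f$ on $\mathbb{D}$ with $f(0)=0$, $f'(0)=1$. For analytic $f,g$ on $\mathbb{D}$, $f\prec g$ means there is an analytic $w:\mathbb{D}\to\mathbb{D}$ with $w(0)=0$ and $f=g\circ w$. $\mathcal{S}^*[A,B]=\{f\in\mathcal{A}: zf'(z)/f(z)\prec(1+Az)/(1+Bz)\}$; $\mathcal{R}[A,B]=\{f\in\mathcal{A}: f'(z)\prec(1+Az)/(1+Bz)\}$; $\mathcal{S}^*_e=\{f\in\mathcal{A}: zf'(z)/f(z)\prec e^{z}\}$. The integral is interpreted as $F(z)=(c+1)\int_0^1 s^{c-1}f(sz)\,ds$. Here $e$ is the base of the natural logarithm. *)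

theory Defs
  imports "HOL-Complex_Analysis.Complex_Analysis"
begin

text \<open>
  Functions on the open unit disk are represented by total functions \<open>complex \<Rightarrow> complex\<close>;
  all notions below depend only on their values on \<^term>\<open>ball 0 1 :: complex set\<close>.
\<close>

abbreviation unit_disk :: "complex set" where
  "unit_disk \<equiv> ball 0 1"

definition class_A :: "(complex \<Rightarrow> complex) set" where
  "class_A = {f. f holomorphic_on unit_disk \<and> f 0 = 0 \<and> deriv f 0 = 1}"

definition subordinate :: "(complex \<Rightarrow> complex) \<Rightarrow> (complex \<Rightarrow> complex) \<Rightarrow> bool"
    (infix "\<prec>\<^sub>D" 50) where
  "f \<prec>\<^sub>D g \<longleftrightarrow>
     f holomorphic_on unit_disk \<and> g holomorphic_on unit_disk \<and>
     (\<exists>w. w holomorphic_on unit_disk \<and> w ` unit_disk \<subseteq> unit_disk \<and> w 0 = 0 \<and>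
          (\<forall>z\<in>unit_disk. f z = g (w z)))"

text \<open>
  The quotient \<open>z f'(z) / f(z)\<close> of a function in \<^const>\<open>class_A\<close>. It has a removable singularity
  at the origin with value \<open>1\<close>. Any other zero of \<open>f\<close> in the disk is a pole of the quotient, so
  there the quotient fails to be holomorphic (whatever value division by zero assigns to it) and
  the subordinations below exclude such \<open>f\<close>.
\<close>

definition starlike_quot :: "(complex \<Rightarrow> complex) \<Rightarrow> complex \<Rightarrow> complex" where
  "starlike_quot f z = (if z = 0 then 1 else z * deriv f z / f z)"

definition janowski :: "real \<Rightarrow> real \<Rightarrow> complex \<Rightarrow> complex" where
  "janowski A B z = (1 + of_real A * z) / (1 + of_real B * z)"

definition janowski_starlike :: "real \<Rightarrow> real \<Rightarrow> (complex \<Rightarrow> complex) set" where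
  "janowski_starlike A B = {f \<in> class_A. starlike_quot f \<prec>\<^sub>D janowski A B}"

definition janowski_R :: "real \<Rightarrow> real \<Rightarrow> (complex \<Rightarrow> complex) set" where
  "janowski_R A B = {f \<in> class_A. deriv f \<prec>\<^sub>D janowski A B}"

definition exp_starlike :: "(complex \<Rightarrow> complex) set" where
  "exp_starlike = {f \<in> class_A. starlike_quot f \<prec>\<^sub>D exp}"

text \<open>
  Bernardi's operator \<open>(c+1) z\<^sup>-\<^sup>c \<integral>\<^sub>0\<^sup>z t\<^sup>c\<^sup>-\<^sup>1 f(t) dt\<close> after the substitution \<open>t = s z\<close>, which
  avoids choosing a branch of the complex power. For \<open>c > -1\<close> and \<open>f\<close> in \<^const>\<open>class_A\<close> the
  integrand is \<open>O(s powr c)\<close> at \<open>0\<close>, hence absolutely integrable.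
\<close>

definition bernardi :: "real \<Rightarrow> (complex \<Rightarrow> complex) \<Rightarrow> complex \<Rightarrow> complex" where
  "bernardi c f z =
     of_real (c + 1) * integral {0..1} (\<lambda>s::real. of_real (s powr (c - 1)) * f (of_real s * z))"

definition cond_C1 :: "real \<Rightarrow> real \<Rightarrow> real \<Rightarrow> real \<Rightarrow> bool" where
  "cond_C1 A B \<beta> \<gamma> \<longleftrightarrow> (let e = exp 1 in
     e\<^sup>2 * \<beta> * (1 - B\<^sup>2) + e * (- B * (- A * \<beta> + B * \<gamma> + B) - \<beta> + \<gamma> + 1) + \<gamma> * (A * B - 1) \<ge> 0)"

definition cond_C2 :: "real \<Rightarrow> real \<Rightarrow> real \<Rightarrow> real \<Rightarrow> bool" where
  "cond_C2 A B \<beta> \<gamma> \<longleftrightarrow> (let e = exp 1 in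
     (e * ((A + e - 1) * \<beta> - (e * \<beta> + 1) * B + 1) + \<gamma> * (A + e * (1 - B) - 1)) *
     (e * (- (A - e + 1) * \<beta> + B * (e * \<beta> + 1) + 1) + \<gamma> * (- A + e * (B + 1) - 1)) \<ge> 0)"

definition cond_C3 :: "real \<Rightarrow> real \<Rightarrow> real \<Rightarrow> real \<Rightarrow> bool" where
  "cond_C3 A B \<beta> \<gamma> \<longleftrightarrow> (let e = exp 1 in
     e * (\<beta> * (1 - A * B) + B\<^sup>2 * (\<gamma> - 1) - \<gamma> + 1) + e\<^sup>2 * \<gamma> * (1 - A * B) + \<beta> * (B\<^sup>2 - 1) \<ge> 0)"

definition cond_C4 :: "real \<Rightarrow> real \<Rightarrow> real \<Rightarrow> real \<Rightarrow> bool" where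
  "cond_C4 A B \<beta> \<gamma> \<longleftrightarrow> (let e = exp 1 in
     (e * ((A - 1) * \<beta> + (1 - B) * (\<gamma> - 1)) + e\<^sup>2 * (A - 1) * \<gamma> + \<beta> * (1 - B)) *
     (- e * ((A + 1) * \<beta> + (B + 1) * (1 - \<gamma>)) - e\<^sup>2 * (A + 1) * \<gamma> + \<beta> * (B + 1)) \<ge> 0)"

definition conds_C :: "real \<Rightarrow> real \<Rightarrow> real \<Rightarrow> real \<Rightarrow> bool" where
  "conds_C A B \<beta> \<gamma> \<longleftrightarrow>
     cond_C1 A B \<beta> \<gamma> \<and> cond_C2 A B \<beta> \<gamma> \<and> cond_C3 A B \<beta> \<gamma> \<and> cond_C4 A B \<beta> \<gamma>"

end

(*
  Both parts concern a function q with q(0) = 1, namely q = z F' / F or q = F', which solves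
  q + z q' / (beta q + gamma) = h, where the values of h lie in the open disc with diameter
  [(1 - A) / (1 - B), (1 + A) / (1 + B)]. If q left exp(D), then at a first exit point z0 Jack's lemma
  would give q(z0) = exp(zeta) and z0 q'(z0) = m zeta exp(zeta) with |zeta| = 1 and m >= 1, so that
  h(z0) = exp(zeta) + m zeta exp(zeta) / (beta exp(zeta) + gamma), and this point lies outside the disc.
  The conditions (C1)-(C4) say this for m = 1 and zeta = 1, -1; the general case is an inequality on the
  unit circle which, after the common zeros at zeta = 1, -1 are divided out, follows from Taylor
  expansions and the nonnegativity of finitely many Bernstein coefficients.

  In part (i) one has to know that q + c does not vanish. This is avoided by working with
  u = F / ((c + 1) f) = 1 / (q + c), which solves the linear equation u (c + h) + z u' = 1. For c close
  to -0.4715 the inequality on the circle is false near zeta = -1; there, and for all smaller c, one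
  first confines u to a half plane Re u > kappa.
*)

theory Submission
  imports Defs
begin

section \<open>Expansions on the unit circle\<close>

text \<open>The obstacle is sharpness. The largest disc that the conditions permit has the values of
  h at \<zeta> = 1 and \<zeta> = -1 (for m = 1) as ends of a diameter, so the inequality on the
  circle becomes an equality at both points, and no estimate with an error term can prove it there.
  By symmetry under complex conjugation every real quantity involved is a function of x = Re
  \<zeta>. Subtracting its linear interpolant in x at -1 and 1 leaves an exact factor 1 - x^2, and
  the cofactors have enough slack for errors below 1/100. The left end 1/e - 1/(1 + c e) tends to
  -\<infinity> as c decreases to -1/e. Below c = 1/5 it is therefore replaced by 0, a lower bound of
  every disc because A \<le> 1. Only the zero at \<zeta> = 1 then survives, and Re (q + c) \<ge> 0
  has to be used as well. In part (i) general m reduces to m = 1: the expression is a quadratic in m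
  - 1 with leading coefficient 1 and nonnegative linear coefficient.\<close>

lemma Im_unit_power_bound:
  fixes z :: complex assumes "norm z = 1" shows "\<bar>Im (z ^ n)\<bar> \<le> n * \<bar>Im z\<bar>"
proof (induction n)
  case (Suc n)
  have 1: "\<bar>Re z\<bar> \<le> 1" "\<bar>Re (z ^ n)\<bar> \<le> 1"
    using abs_Re_le_cmod[of z] abs_Re_le_cmod[of "z ^ n"] assms by (simp_all add: norm_power)
  have "\<bar>Im (z ^ Suc n)\<bar> \<le> \<bar>Re z\<bar> * \<bar>Im (z ^ n)\<bar> + \<bar>Im z\<bar> * \<bar>Re (z ^ n)\<bar>"
    by (simp add: abs_mult[symmetric] abs_triangle_ineq)
  also have "\<dots> \<le> 1 * \<bar>Im (z ^ n)\<bar> + \<bar>Im z\<bar> * 1"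
    using 1 by (intro add_mono mult_mono) auto
  finally show ?case using Suc by (simp add: algebra_simps)
qed auto

lemma unit_square: "norm (z :: complex) = 1 \<Longrightarrow> (Im z)\<^sup>2 = 1 - (Re z)\<^sup>2"
  using cmod_power2[of z] by simp

lemma Re_unit_power_rec:
  fixes z :: complex assumes "norm z = 1"
  shows "Re (z ^ Suc (Suc n)) = 2 * Re z * Re (z ^ Suc n) - Re (z ^ n)"
proof -
  have "Im z * Im z = 1 - Re z * Re z"
    using unit_square[OF assms] by (simp add: power2_eq_square)
  then have "Re (z ^ n) * (Im z * Im z) = Re (z ^ n) * (1 - Re z * Re z)" by simp
  then show ?thesis by (simp add: algebra_simps)
qed

text \<open>\<open>Re (z ^ k)\<close> is the Chebyshev polynomial T_k at x = Re z, and its linear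
  interpolant at -1 and 1 is 1 or x by parity. In steps of two, T_n - T_(n+2) = 2 Im z Im (z^(n+1))
  carries the factor 1 - x^2, and 2 (n + 1) = ((n + 2)^2 - n^2) / 2.\<close>

lemma Re_unit_power_deviation:
  fixes z :: complex assumes z: "norm z = 1"
  shows "\<bar>(if even k then 1 else Re z) - Re (z ^ k)\<bar> \<le> (1 - (Re z)\<^sup>2) * (real k ^ 2 / 2)"
proof (induction k rule: induct_nat_012)
  case (ge2 n)
  have "Re (z ^ n) - Re (z ^ Suc (Suc n)) = 2 * Im z * Im (z ^ Suc n)"
    using unit_square[OF z] Re_unit_power_rec[OF z, of n] by (simp add: algebra_simps power2_eq_square)
  moreover have "\<bar>Im z * Im (z ^ Suc n)\<bar> \<le> \<bar>Im z\<bar> * (real (Suc n) * \<bar>Im z\<bar>)"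
    unfolding abs_mult by (intro mult_left_mono Im_unit_power_bound z) auto
  moreover have "\<bar>Im z\<bar> * (real (Suc n) * \<bar>Im z\<bar>) = (1 - (Re z)\<^sup>2) * real (Suc n)"
    using unit_square[OF z] by (simp add: power2_eq_square)
  ultimately have "\<bar>Re (z ^ n) - Re (z ^ Suc (Suc n))\<bar> \<le> (1 - (Re z)\<^sup>2) * real (Suc n) * 2"
    by (simp add: abs_mult del: power_Suc of_nat_Suc)
  moreover have "(1 - (Re z)\<^sup>2) * (real (Suc (Suc n)) ^ 2 / 2)
      = (1 - (Re z)\<^sup>2) * (real n ^ 2 / 2) + (1 - (Re z)\<^sup>2) * real (Suc n) * 2"
    by (simp add: algebra_simps power2_eq_square add_divide_distrib)
  moreover have "(if even (Suc (Suc n)) then 1 else Re z) = (if even n then 1 else Re z)" by simp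
  ultimately show ?case using ge2(1) by linarith
qed (use unit_square[OF z] zero_le_power2[of "Im z"] in auto)

text \<open>The same telescoping for monomials, where each step of two costs only 1 - x^2; hence a
  bound linear in k instead of quadratic.\<close>

lemma power_deviation:
  fixes x :: real assumes "\<bar>x\<bar> \<le> 1"
  shows "\<bar>(if even k then 1 else x) - x ^ k\<bar> \<le> (1 - x\<^sup>2) * (real k / 2)"
proof (induction k rule: induct_nat_012)
  case (ge2 n)
  have "x ^ n - x ^ Suc (Suc n) = (1 - x\<^sup>2) * x ^ n" by (simp add: algebra_simps power2_eq_square)
  moreover have "\<bar>x ^ n\<bar> \<le> 1" using assms by (simp add: power_abs power_le_one)
  moreover have "0 \<le> 1 - x\<^sup>2" using assms by (simp add: abs_square_le_1)
  ultimately have "\<bar>x ^ n - x ^ Suc (Suc n)\<bar> \<le> (1 - x\<^sup>2)"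
    by (simp add: abs_mult mult_left_le)
  moreover have "(1 - x\<^sup>2) * (real (Suc (Suc n)) / 2) = (1 - x\<^sup>2) * (real n / 2) + (1 - x\<^sup>2)"
    by (simp add: algebra_simps add_divide_distrib)
  moreover have "(if even (Suc (Suc n)) then 1 else x) = (if even n then 1 else x)" by simp
  ultimately show ?case using ge2(1) by linarith
qed (use assms in \<open>auto simp: abs_square_le_1\<close>)

text \<open>The majorant enters through its closed-form sum minus its first \<open>K\<close> terms,
  so no tail has to be summed. The majorants needed are multiples of k z^k / k! and k^2 / k!, whose
  sums are known multiples of exp.\<close>

lemma sums_tail_bound:
  fixes f g :: "nat \<Rightarrow> real"
  assumes "f sums F" "g sums G" "\<And>k. k \<ge> K \<Longrightarrow> \<bar>f k\<bar> \<le> g k"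
  shows "\<bar>F - sum f {..<K}\<bar> \<le> G - sum g {..<K}"
proof -
  have f: "(\<lambda>k. f (k + K)) sums (F - sum f {..<K})" and g: "(\<lambda>k. g (k + K)) sums (G - sum g {..<K})"
    using assms(1,2) by (auto intro: sums_split_initial_segment)
  have "F - sum f {..<K} \<le> G - sum g {..<K}"
    by (rule sums_le[OF _ f g]) (use assms(3)[of "_ + K"] in \<open>auto simp: abs_le_iff\<close>)
  moreover have "- (F - sum f {..<K}) \<le> G - sum g {..<K}"
    by (rule sums_le[OF _ sums_minus[OF f] g]) (use assms(3)[of "_ + K"] in \<open>auto simp: abs_le_iff\<close>)
  ultimately show ?thesis by linarith
qed

lemma exp_sums_real: "(\<lambda>k. z ^ k / fact k) sums exp (z :: real)"
  using exp_converges[of z] by (simp add: field_simps scaleR_conv_of_real)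

lemma exp_sums_times_index: "(\<lambda>k. real k * z ^ k / fact k) sums (z * exp z)"
proof -
  have "(\<lambda>k. real (Suc k) * z ^ Suc k / fact (Suc k)) = (\<lambda>k. z * (z ^ k / fact k))"
    by (rule ext) (simp add: fact_Suc divide_simps del: of_nat_Suc)
  then have "(\<lambda>k. real (Suc k) * z ^ Suc k / fact (Suc k)) sums (z * exp z)"
    using sums_mult[OF exp_sums_real] by simp
  then show ?thesis by (subst (asm) sums_Suc_iff) simp
qed

lemma exp_one_sums_square_index: "(\<lambda>k. real k ^ 2 / fact k) sums (2 * exp (1::real))"
proof -
  have "real (Suc k) ^ 2 / fact (Suc k) = real (Suc k) / fact k" for k
    by (simp add: power2_eq_square del: of_nat_Suc)
  then have "(\<lambda>k. real (Suc k) ^ 2 / fact (Suc k)) = (\<lambda>k. real k * 1 ^ k / fact k + 1 ^ k / fact k :: real)"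
    by (simp add: add_divide_distrib add.commute)
  then have "(\<lambda>k. real (Suc k) ^ 2 / fact (Suc k)) sums (1 * exp (1::real) + exp 1)"
    using sums_add[OF exp_sums_times_index exp_sums_real, of 1 1] by simp
  then show ?thesis by (subst (asm) sums_Suc_iff) simp
qed

lemma exp_1_bounds: "(271828/100000 :: real) \<le> exp 1" "exp 1 \<le> (271829/100000 :: real)"
proof -
  \<comment> \<open>For k \<ge> 10 one has 1/k! \<le> (k/10)/k!, and this majorant sums to exp 1 /
    10. The bound contains the unknown itself, but linearly and with factor 1/10, so it can be
    solved for.\<close>
  have "\<bar>exp (1::real) - (\<Sum>k<10. 1 ^ k / fact k)\<bar>
      \<le> 1 * exp 1 / 10 - (\<Sum>k<10. real k * 1 ^ k / fact k / 10)"
  proof (rule sums_tail_bound[OF exp_sums_real sums_divide[OF exp_sums_times_index]])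
    fix k :: nat assume "10 \<le> k"
    then show "\<bar>1 ^ k / fact k\<bar> \<le> real k * 1 ^ k / fact k / 10" by (simp add: divide_simps)
  qed
  then show "(271828/100000 :: real) \<le> exp 1" "exp 1 \<le> (271829/100000 :: real)"
    by (auto simp: lessThan_nat_numeral fact_numeral abs_le_iff)
qed

text \<open>Termwise interpolation: \<open>cosh z + x * sinh z\<close> is the linear interpolant in
  x of \<open>exp (z * x)\<close> at -1 and 1.\<close>

lemma parity_exp_sums:
  "(\<lambda>k. (if even k then 1 else x) * (z ^ k / fact k)) sums (cosh z + x * sinh z :: real)"
proof -
  have "(\<lambda>k. (if even k then 1 else x) * (z ^ k / fact k)) =
    (\<lambda>k. (1 + x) / 2 * (z ^ k / fact k) + (1 - x) / 2 * ((-z) ^ k / fact k))"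
    by (rule ext) (auto simp: field_simps)
  moreover have "\<dots> sums ((1 + x) / 2 * exp z + (1 - x) / 2 * exp (- z))"
    by (intro sums_add sums_mult exp_sums_real)
  ultimately show ?thesis by (simp add: cosh_field_def sinh_field_def field_simps)
qed

text \<open>Division by \<open>Y\<close>, which will be 1 - x^2. At its zeros the quotient is
  undetermined, and the approximating value \<open>w\<close> itself is chosen.\<close>

lemma approx_from_tail:
  fixes F L w s \<epsilon> :: real
  assumes "\<bar>L - F - Y * w\<bar> \<le> Y * \<epsilon>" "Y \<ge> 0" "\<epsilon> \<ge> 0"
  obtains A where "F = L - Y * A" "\<bar>A - w\<bar> \<le> \<epsilon>"
proof (cases "Y = 0")
  case True
  then show ?thesis using that[of w] assms by simp
next
  case False
  have "\<bar>(L - F) / Y - w\<bar> \<le> \<epsilon>"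
    using assms False by (simp add: divide_simps abs_le_iff algebra_simps) 
  then show ?thesis using that[of "(L - F) / Y"] False by simp
qed

text \<open>The polynomial is the exact quotient by 1 - x^2 of the first nine terms of the deviation
  from the interpolant; 83/10000 bounds what remains of the majorant, exp 2 minus its partial sum.
  The next two expansions are built in the same way.\<close>

lemma exp_double_expansion:
  fixes x :: real assumes x: "\<bar>x\<bar> \<le> 1"
  obtains A where "exp (2 * x) = cosh 2 + x * sinh 2 - (1 - x\<^sup>2) * A"
    "\<bar>A - (58/21 + 512/315*x + 16/21*x^2 + 92/315*x^3 + 2/21*x^4 + 8/315*x^5 + 2/315*x^6)\<bar> \<le> 83/10000"
proof -
  define f where "f k = ((if even k then 1 else x) - x ^ k) * (2 ^ k / fact k)" for k
  have f: "f sums (cosh 2 + x * sinh 2 - exp (2 * x))"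
    using sums_diff[OF parity_exp_sums[of x 2] exp_sums_real[of "2 * x"]]
    unfolding f_def by (simp add: algebra_simps diff_divide_distrib)
  have g: "(\<lambda>k. (1 - x\<^sup>2) * (real k * 2 ^ k / fact k / 2)) sums ((1 - x\<^sup>2) * exp 2)"
    using sums_mult[OF sums_divide[OF exp_sums_times_index[of 2], of 2], of "1 - x\<^sup>2"] by simp
  have fg: "\<bar>f k\<bar> \<le> (1 - x\<^sup>2) * (real k * 2 ^ k / fact k / 2)" for k
  proof -
    have "\<bar>f k\<bar> = \<bar>(if even k then 1 else x) - x ^ k\<bar> * (2 ^ k / fact k)" by (simp add: f_def abs_mult)
    also have "\<dots> \<le> (1 - x\<^sup>2) * (real k / 2) * (2 ^ k / fact k)"
      by (intro mult_right_mono power_deviation x) simp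
    finally show ?thesis by simp
  qed
  have e: "exp (2 :: real) \<le> 271829/100000 * (271829/100000)"
    using mult_mono[OF exp_1_bounds(2) exp_1_bounds(2)] by (simp flip: exp_add)
  have x2: "0 \<le> 1 - x\<^sup>2" using x by (simp add: abs_square_le_1)
  note sums_tail_bound[OF f g fg, of 9]
  also have "(1 - x\<^sup>2) * exp 2 - (\<Sum>k<9. (1 - x\<^sup>2) * (real k * 2 ^ k / fact k / 2))
      = (1 - x\<^sup>2) * (exp 2 - (\<Sum>k<9. real k * 2 ^ k / fact k / 2))"
    by (simp add: right_diff_distrib sum_distrib_left)
  also have "\<dots> \<le> (1 - x\<^sup>2) * (83/10000)"
    using x2 e by (intro mult_left_mono) (simp_all add: lessThan_nat_numeral fact_numeral)
  also have "sum f {..<9} = (1 - x\<^sup>2) * (58/21 + 512/315*x + 16/21*x^2 + 92/315*x^3 + 2/21*x^4 + 8/315*x^5 + 2/315*x^6)"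
    by (simp add: f_def lessThan_nat_numeral fact_numeral field_simps) 
      (simp add: power_numeral_reduce algebra_simps)
  finally show ?thesis using x2 that by (elim approx_from_tail) auto
qed

lemma Re_exp_sums: "(\<lambda>k. Re (z ^ k) * (1 / fact k)) sums Re (exp z)"
  using sums_Re[OF exp_converges[of z]] by (simp add: field_simps)

lemma Re_exp_expansion:
  fixes z :: complex assumes z: "norm z = 1"
  defines "x \<equiv> Re z"
  obtains A where "Re (exp z) = cosh 1 + x * sinh 1 - (1 - x\<^sup>2) * A"
    "\<bar>A - (361/360 + 19/30*x + 14/45*x^2 + 2/15*x^3 + 2/45*x^4)\<bar> \<le> 59/10000"
proof -
  define f where "f k = ((if even k then 1 else x) - Re (z ^ k)) * (1 / fact k)" for k
  have f: "f sums (cosh 1 + x * sinh 1 - Re (exp z))"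
    using sums_diff[OF parity_exp_sums[of x 1] Re_exp_sums[of z]]
    unfolding f_def by (simp add: diff_divide_distrib)
  have g: "(\<lambda>k. (1 - x\<^sup>2) * (real k ^ 2 / fact k / 2)) sums ((1 - x\<^sup>2) * exp 1)"
    using sums_mult[OF sums_divide[OF exp_one_sums_square_index, of 2], of "1 - x\<^sup>2"] by simp
  have fg: "\<bar>f k\<bar> \<le> (1 - x\<^sup>2) * (real k ^ 2 / fact k / 2)" for k
  proof -
    have "\<bar>f k\<bar> = \<bar>(if even k then 1 else Re z) - Re (z ^ k)\<bar> * (1 / fact k)"
      by (simp add: f_def x_def abs_mult)
    also have "\<dots> \<le> (1 - (Re z)\<^sup>2) * (real k ^ 2 / 2) * (1 / fact k)"
      by (intro mult_right_mono Re_unit_power_deviation z) simp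
    finally show ?thesis by (simp add: x_def)
  qed
  have x2: "0 \<le> 1 - x\<^sup>2" using unit_square[OF z] zero_le_power2[of "Im z"] by (simp add: x_def)
  have rec: "Re (z ^ 0) = 1" "Re (z ^ 1) = x" "Re (z ^ 2) = 2 * x * x - 1"
      "Re (z ^ 3) = 2 * x * Re (z ^ 2) - x" "Re (z ^ 4) = 2 * x * Re (z ^ 3) - Re (z ^ 2)"
      "Re (z ^ 5) = 2 * x * Re (z ^ 4) - Re (z ^ 3)" "Re (z ^ 6) = 2 * x * Re (z ^ 5) - Re (z ^ 4)"
    using Re_unit_power_rec[OF z, of 0] Re_unit_power_rec[OF z, of 1] Re_unit_power_rec[OF z, of 2]
      Re_unit_power_rec[OF z, of 3] Re_unit_power_rec[OF z, of 4]
    unfolding x_def by (simp_all add: eval_nat_numeral)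
  note sums_tail_bound[OF f g fg, of 7]
  also have "(1 - x\<^sup>2) * exp 1 - (\<Sum>k<7. (1 - x\<^sup>2) * (real k ^ 2 / fact k / 2))
      = (1 - x\<^sup>2) * (exp 1 - (\<Sum>k<7. real k ^ 2 / fact k / 2))"
    by (simp add: right_diff_distrib sum_distrib_left)
  also have "\<dots> \<le> (1 - x\<^sup>2) * (59/10000)"
    using x2 exp_1_bounds(2) by (intro mult_left_mono) (simp_all add: lessThan_nat_numeral fact_numeral)
  also have "sum f {..<7} = (1 - x\<^sup>2) * (361/360 + 19/30*x + 14/45*x^2 + 2/15*x^3 + 2/45*x^4)"
    by (simp add: f_def rec lessThan_nat_numeral fact_numeral flip: x_def)
       (simp add: field_simps power_numeral_reduce)
  finally show ?thesis using x2 that by (elim approx_from_tail) (auto simp: x_def)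
qed

lemma Re_exp_cnj_expansion:
  fixes z :: complex assumes z: "norm z = 1"
  defines "x \<equiv> Re z"
  obtains A where "Re (exp z * cnj z) = sinh 1 + x * cosh 1 - (1 - x\<^sup>2) * A"
    "\<bar>A - (1/3 + 29/180*x + 1/15*x^2 + 1/45*x^3)\<bar> \<le> 43/10000"
proof -
  define l where "l k = (if even k then 1 else x)" for k :: nat
  define f where "f k = (if k = 0 then 0 else (l (k - 1) - Re (z ^ (k - 1))) * (1 / fact k))" for k
  have zz: "z * cnj z = 1" using z complex_norm_square[of z] by simp
  \<comment> \<open>For k \<ge> 1 the product is z^(k-1). The term k = 0 is \<open>cnj z\<close>,
    with real part x, which is its own interpolant; hence \<open>f 0\<close> is 0.\<close>
  have pw: "Re (z ^ k * cnj z) = (if k = 0 then x else Re (z ^ (k - 1)))" for k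
  proof (cases k)
    case (Suc n)
    have "z ^ k * cnj z = z ^ n * (z * cnj z)" by (simp add: Suc)
    then have "z ^ k * cnj z = z ^ n" unfolding zz by simp
    then show ?thesis using Suc by (simp del: power_Suc)
  qed (simp add: x_def)
  have e1: "(\<lambda>k. Re (z ^ k * cnj z) * (1 / fact k)) sums Re (exp z * cnj z)"
    using sums_Re[OF sums_mult2[OF exp_converges[of z], of "cnj z"]]
    by (simp add: field_simps)
  have e2: "(\<lambda>k. (if even k then x else 1) * (1 / fact k)) sums (x * cosh 1 + sinh 1)"
    using sums_add[OF parity_exp_sums[of 0 1, THEN sums_mult, of x]
          sums_diff[OF parity_exp_sums[of 1 1] parity_exp_sums[of 0 1]]]
    by (rule back_subst[of "\<lambda>f. f sums _", OF back_subst[of "\<lambda>s. _ sums s"]]) auto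
  have "(\<lambda>k. (if even k then x else 1) * (1 / fact k) - Re (z ^ k * cnj z) * (1 / fact k)) = f"
    unfolding pw by (rule ext) (auto simp: f_def l_def diff_divide_distrib simp flip: x_def)
  then have f: "f sums (sinh 1 + x * cosh 1 - Re (exp z * cnj z))"
    using sums_diff[OF e2 e1] by (simp add: add.commute)
  have "(\<lambda>k. (1 - x\<^sup>2) * ((real k ^ 2 / fact k - 2 * (real k * 1 ^ k / fact k) + 1 ^ k / fact k) / 2))
      sums ((1 - x\<^sup>2) * ((2 * exp 1 - 2 * (1 * exp 1) + exp 1) / 2))"
    by (intro sums_mult sums_divide sums_add sums_diff exp_one_sums_square_index exp_sums_times_index exp_sums_real)
  moreover have "(real k ^ 2 / fact k - 2 * (real k * 1 ^ k / fact k) + 1 ^ k / fact k) / 2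
      = (real k - 1) ^ 2 / fact k / 2" for k
    by (simp add: power2_diff add_divide_distrib diff_divide_distrib)
  ultimately have g: "(\<lambda>k. (1 - x\<^sup>2) * ((real k - 1) ^ 2 / fact k / 2)) sums ((1 - x\<^sup>2) * (exp 1 / 2))"
    by simp
  have x2: "0 \<le> 1 - x\<^sup>2" using unit_square[OF z] zero_le_power2[of "Im z"] by (simp add: x_def)
  have fg: "\<bar>f k\<bar> \<le> (1 - x\<^sup>2) * ((real k - 1) ^ 2 / fact k / 2)" for k
  proof (cases k)
    case (Suc n)
    have "\<bar>f k\<bar> = \<bar>(if even n then 1 else Re z) - Re (z ^ n)\<bar> * (1 / fact k)"
      by (simp add: f_def x_def l_def Suc abs_mult del: fact_Suc)
    also have "\<dots> \<le> (1 - (Re z)\<^sup>2) * (real n ^ 2 / 2) * (1 / fact k)"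
      by (intro mult_right_mono Re_unit_power_deviation z) simp
    finally show ?thesis using Suc by (simp add: x_def del: fact_Suc)
  qed (use x2 in \<open>simp add: f_def\<close>)
  have rec: "Re (z ^ 0) = 1" "Re (z ^ 1) = x" "Re (z ^ 2) = 2 * x * x - 1"
      "Re (z ^ 3) = 2 * x * Re (z ^ 2) - x" "Re (z ^ 4) = 2 * x * Re (z ^ 3) - Re (z ^ 2)"
      "Re (z ^ 5) = 2 * x * Re (z ^ 4) - Re (z ^ 3)"
    using Re_unit_power_rec[OF z, of 0] Re_unit_power_rec[OF z, of 1] Re_unit_power_rec[OF z, of 2]
      Re_unit_power_rec[OF z, of 3]
    unfolding x_def by (simp_all add: eval_nat_numeral)
  note sums_tail_bound[OF f g fg, of 7]
  also have "(1 - x\<^sup>2) * (exp 1 / 2) - (\<Sum>k<7. (1 - x\<^sup>2) * ((real k - 1) ^ 2 / fact k / 2))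
      = (1 - x\<^sup>2) * (exp 1 / 2 - (\<Sum>k<7. (real k - 1) ^ 2 / fact k / 2))"
    by (simp add: right_diff_distrib sum_distrib_left)
  also have "\<dots> \<le> (1 - x\<^sup>2) * (43/10000)"
    using x2 exp_1_bounds(2) by (intro mult_left_mono) (simp_all add: lessThan_nat_numeral fact_numeral)
  also have "sum f {..<7} = (1 - x\<^sup>2) * (1/3 + 29/180*x + 1/15*x^2 + 1/45*x^3)"
    by (simp add: f_def l_def rec lessThan_nat_numeral fact_numeral flip: x_def)
       (simp add: field_simps power_numeral_reduce)
  finally show ?thesis using x2 that by (elim approx_from_tail) (auto simp: x_def)
qed

text \<open>Here \<open>y\<close> stands for the imaginary part, so 1 - x^2 = y^2 and an expansion
  in even powers of y already has the required form; the interpolant at x = -1 and 1 is the constant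
  1. The remainder of order y^8 is reduced to y^2 by |y| \<le> 1.\<close>

lemma cos_double_expansion:
  fixes x y :: real assumes xy: "x\<^sup>2 + y\<^sup>2 = 1"
  obtains A where "cos (2 * y) = 1 - (1 - x\<^sup>2) * A"
    "\<bar>A - (64/45 + 22/45*x^2 + 4/45*x^4)\<bar> \<le> 64/10000"
proof -
  have y: "1 - x\<^sup>2 = y\<^sup>2" "0 \<le> y\<^sup>2" using xy by auto
  then have y1: "y\<^sup>2 \<le> 1" using zero_le_power2[of x] by linarith
  obtain t where t: "cos (2 * y) = (\<Sum>m<8. cos_coeff m * (2 * y) ^ m) + cos (t + 1/2 * real 8 * pi) / fact 8 * (2 * y) ^ 8"
    using Maclaurin_cos_expansion[of "2 * y" 8] by blast
  have "\<bar>cos (2 * y) - (\<Sum>m<8. cos_coeff m * (2 * y) ^ m)\<bar> \<le> 1 / fact 8 * \<bar>(2 * y) ^ 8\<bar>"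
    unfolding t by (simp add: abs_mult divide_right_mono mult_left_le_one_le)
  also have "\<bar>(2 * y) ^ 8\<bar> = 256 * y\<^sup>2 * (y\<^sup>2) ^ 3" by (simp add: power_mult_distrib flip: power_mult power_add)
  also have "1 / fact 8 * (256 * y\<^sup>2 * (y\<^sup>2) ^ 3) \<le> 1 / fact 8 * (256 * y\<^sup>2 * 1)"
    using y(2) power_le_one[OF y(2) y1, of 3] by (intro mult_left_mono) auto
  also have "\<dots> = y\<^sup>2 * (2/315)" by (simp add: fact_numeral)
  finally have 1: "\<bar>cos (2 * y) - (\<Sum>m<8. cos_coeff m * (2 * y) ^ m)\<bar> \<le> y\<^sup>2 * (2/315)" .
  have "(\<Sum>m<8. cos_coeff m * (2 * y) ^ m) = 1 - 2 * y\<^sup>2 + 2/3 * (y\<^sup>2) ^ 2 - 4/45 * (y\<^sup>2) ^ 3"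
    by (simp add: cos_coeff_def lessThan_nat_numeral fact_numeral power_mult_distrib flip: power_mult)
  also have "\<dots> = 1 - y\<^sup>2 * (64/45 + 22/45*x^2 + 4/45*x^4)"
    unfolding y(1)[symmetric] by (simp add: power_numeral_reduce field_simps)
  finally have "\<bar>cos (2 * y) - (1 - y\<^sup>2 * (64/45 + 22/45*x^2 + 4/45*x^4))\<bar> \<le> y\<^sup>2 * (2/315)"
    using 1 by simp
  moreover have "y\<^sup>2 * (2/315) \<le> y\<^sup>2 * (64/10000)" by (intro mult_left_mono) auto
  ultimately have "\<bar>cos (2 * y) - (1 - y\<^sup>2 * (64/45 + 22/45*x^2 + 4/45*x^4))\<bar> \<le> y\<^sup>2 * (64/10000)"
    by (rule order_trans)
  then have "\<bar>1 - cos (2 * y) - y\<^sup>2 * (64/45 + 22/45*x^2 + 4/45*x^4)\<bar> \<le> y\<^sup>2 * (64/10000)"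
    by linarith
  then show ?thesis using y that by (elim approx_from_tail) auto
qed

section \<open>Polynomial estimates\<close>

text \<open>Up to positive factors, the terms in \<open>b\<close> are the Bernstein coefficients of the polynomial on \<open>[-1, 1]\<close>.\<close>

lemma poly8_nonneg:
  fixes x :: real
  assumes x: "\<bar>x\<bar> \<le> 1"
    and b: "0 \<le> c0 - c1 + c2 - c3 + c4 - c5 + c6 - c7 + c8"
      "0 \<le> 8*c0 - 6*c1 + 4*c2 - 2*c3 + 2*c5 - 4*c6 + 6*c7 - 8*c8"
      "0 \<le> 28*c0 - 14*c1 + 4*c2 + 2*c3 - 4*c4 + 2*c5 + 4*c6 - 14*c7 + 28*c8"
      "0 \<le> 56*c0 - 14*c1 - 4*c2 + 6*c3 - 6*c5 + 4*c6 + 14*c7 - 56*c8"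
      "0 \<le> 70*c0 - 10*c2 + 6*c4 - 10*c6 + 70*c8"
      "0 \<le> 56*c0 + 14*c1 - 4*c2 - 6*c3 + 6*c5 + 4*c6 - 14*c7 - 56*c8"
      "0 \<le> 28*c0 + 14*c1 + 4*c2 - 2*c3 - 4*c4 - 2*c5 + 4*c6 + 14*c7 + 28*c8"
      "0 \<le> 8*c0 + 6*c1 + 4*c2 + 2*c3 - 2*c5 - 4*c6 - 6*c7 - 8*c8"
      "0 \<le> c0 + c1 + c2 + c3 + c4 + c5 + c6 + c7 + c8"
  shows "0 \<le> c0 + c1*x + c2*x^2 + c3*x^3 + c4*x^4 + c5*x^5 + c6*x^6 + c7*x^7 + c8*x^8"
proof -
  have q: "0 \<le> (1 + x) ^ i * (1 - x) ^ j" for i j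
    using x by (intro mult_nonneg_nonneg zero_le_power; linarith)
  have "0 \<le> (c0 - c1 + c2 - c3 + c4 - c5 + c6 - c7 + c8) * ((1 + x)^0 * (1 - x)^8)
      + (8*c0 - 6*c1 + 4*c2 - 2*c3 + 2*c5 - 4*c6 + 6*c7 - 8*c8) * ((1 + x)^1 * (1 - x)^7)
      + (28*c0 - 14*c1 + 4*c2 + 2*c3 - 4*c4 + 2*c5 + 4*c6 - 14*c7 + 28*c8) * ((1 + x)^2 * (1 - x)^6)
      + (56*c0 - 14*c1 - 4*c2 + 6*c3 - 6*c5 + 4*c6 + 14*c7 - 56*c8) * ((1 + x)^3 * (1 - x)^5)
      + (70*c0 - 10*c2 + 6*c4 - 10*c6 + 70*c8) * ((1 + x)^4 * (1 - x)^4)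
      + (56*c0 + 14*c1 - 4*c2 - 6*c3 + 6*c5 + 4*c6 - 14*c7 - 56*c8) * ((1 + x)^5 * (1 - x)^3)
      + (28*c0 + 14*c1 + 4*c2 - 2*c3 - 4*c4 - 2*c5 + 4*c6 + 14*c7 + 28*c8) * ((1 + x)^6 * (1 - x)^2)
      + (8*c0 + 6*c1 + 4*c2 + 2*c3 - 2*c5 - 4*c6 - 6*c7 - 8*c8) * ((1 + x)^7 * (1 - x)^1)
      + (c0 + c1 + c2 + c3 + c4 + c5 + c6 + c7 + c8) * ((1 + x)^8 * (1 - x)^0)"
    by (intro add_nonneg_nonneg mult_nonneg_nonneg[OF b(1) q] mult_nonneg_nonneg[OF b(2) q]
        mult_nonneg_nonneg[OF b(3) q] mult_nonneg_nonneg[OF b(4) q] mult_nonneg_nonneg[OF b(5) q]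
        mult_nonneg_nonneg[OF b(6) q] mult_nonneg_nonneg[OF b(7) q] mult_nonneg_nonneg[OF b(8) q]
        mult_nonneg_nonneg[OF b(9) q])
  also have "\<dots> = 256 * (c0 + c1*x + c2*x^2 + c3*x^3 + c4*x^4 + c5*x^5 + c6*x^6 + c7*x^7 + c8*x^8)"
    by algebra
  finally show ?thesis by simp
qed

text \<open>
  With \<open>x = Re z\<close> on the unit circle, \<open>A1\<close>, \<open>A2\<close>, \<open>A3\<close>, \<open>A4\<close> stand for the quotients by \<open>1 - x\<^sup>2\<close> that
  remain when \<open>exp (2 * x)\<close>, \<open>Re (exp z)\<close>, \<open>Re (exp z * cnj z)\<close>, \<open>cos (2 * Im z)\<close> are subtracted from
  their linear interpolants in \<open>x\<close> at \<open>-1\<close> and \<open>1\<close>; \<open>B1\<close>, \<open>B2\<close>, \<open>B3\<close> are the same quotients at \<open>- z\<close>,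
  and \<open>E\<close>, \<open>F\<close> stand for \<open>exp 1\<close>, \<open>exp (-1)\<close>.
\<close>

locale circle_coeffs =
  fixes x A1 A2 A3 A4 B1 B2 B3 E F :: real
  assumes x: "\<bar>x\<bar> \<le> 1"
    and E: "271828/100000 \<le> E" "E \<le> 271829/100000" and EF: "E * F = 1"
    and A1: "\<bar>A1 - (58/21 + 512/315*x + 16/21*x^2 + 92/315*x^3 + 2/21*x^4 + 8/315*x^5
        + 2/315*x^6)\<bar> \<le> 83/10000"
    and A2: "\<bar>A2 - (361/360 + 19/30*x + 14/45*x^2 + 2/15*x^3 + 2/45*x^4)\<bar> \<le> 59/10000"
    and A3: "\<bar>A3 - (1/3 + 29/180*x + 1/15*x^2 + 1/45*x^3)\<bar> \<le> 43/10000"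
    and A4: "\<bar>A4 - (64/45 + 22/45*x^2 + 4/45*x^4)\<bar> \<le> 64/10000"
    and B1: "\<bar>B1 - (58/21 - 512/315*x + 16/21*x^2 - 92/315*x^3 + 2/21*x^4 - 8/315*x^5
        + 2/315*x^6)\<bar> \<le> 83/10000"
    and B2: "\<bar>B2 - (361/360 - 19/30*x + 14/45*x^2 - 2/15*x^3 + 2/45*x^4)\<bar> \<le> 59/10000"
    and B3: "\<bar>B3 - (1/3 - 29/180*x + 1/15*x^2 - 1/45*x^3)\<bar> \<le> 43/10000"
begin

lemma E_power_bounds:
  "738904/100000 \<le> E^2" "E^2 \<le> 738911/100000" "200852/10000 \<le> E^3"
      "E^3 \<le> 200858/10000" "545971/10000 \<le> E^4" "E^4 \<le> 545989/10000"
  using power_mono[OF E(1), of 2] power_mono[OF E(2), of 2] power_mono[OF E(1), of 3] power_mono[OF E(2), of 3]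
    power_mono[OF E(1), of 4] power_mono[OF E(2), of 4] E by (simp_all add: power_divide)

lemma F_bounds: "367877/1000000 \<le> F" "F \<le> 367881/1000000" "135333/1000000 \<le> F^2"
    "F^2 \<le> 135337/1000000"
proof -
  have F: "F = 1 / E" using EF E by (simp add: field_simps)
  show 1: "367877/1000000 \<le> F" "F \<le> 367881/1000000"
    using E unfolding F by (simp_all add: field_simps)
  have "0 \<le> F" using 1(1) by simp
  then have "(367877/1000000)^2 \<le> F^2"
      "F^2 \<le> (367881/1000000)^2" using 1 by (intro power_mono; simp)+
  then show "135333/1000000 \<le> F^2" "F^2 \<le> 135337/1000000" by (simp_all add: power_divide)
qed

lemmas num_bounds = E E_power_bounds F_bounds
lemmas coeff_bounds =
  A1[THEN abs_le_D1] A1[THEN abs_le_D2]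
  A2[THEN abs_le_D1] A2[THEN abs_le_D2]
  A3[THEN abs_le_D1] A3[THEN abs_le_D2]
  A4[THEN abs_le_D1] A4[THEN abs_le_D2]
  B1[THEN abs_le_D1] B1[THEN abs_le_D2]
  B2[THEN abs_le_D1] B2[THEN abs_le_D2]
  B3[THEN abs_le_D1] B3[THEN abs_le_D2]
lemmas x_bounds = x[THEN abs_le_D1] x[THEN abs_le_D2]

lemma x_sq: "0 \<le> 1 - x\<^sup>2"
  using x by (simp add: abs_square_le_1)

text \<open>Each truncated expansion stays nonnegative after its error bound is subtracted. This
  sign is what allows coefficients depending on e to be replaced by rational lower bounds in the
  estimates that follow.\<close>

lemma coeffs_nonneg: "0 \<le> A1" "0 \<le> A2" "0 \<le> A3" "0 \<le> A4" "0 \<le> B1" "0 \<le> B2"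
    "0 \<le> B3"
proof -
  show "0 \<le> A1" using coeff_bounds
    poly8_nonneg[OF x, of "578257/210000" "512/315" "16/21" "92/315" "2/21" "8/315" "2/315" "0"
        "0"] by linarith
  show "0 \<le> A2" using coeff_bounds
    poly8_nonneg[OF x, of "89719/90000" "19/30" "14/45" "2/15" "2/45" "0" "0" "0" "0"] by linarith
  show "0 \<le> A3" using coeff_bounds
    poly8_nonneg[OF x, of "9871/30000" "29/180" "1/15" "1/45" "0" "0" "0" "0" "0"] by linarith
  show "0 \<le> A4" using coeff_bounds
    poly8_nonneg[OF x, of "7964/5625" "0" "22/45" "0" "4/45" "0" "0" "0" "0"] by linarith
  show "0 \<le> B1" using coeff_bounds
    poly8_nonneg[OF x, of "578257/210000" "-512/315" "16/21" "-92/315" "2/21" "-8/315" "2/315" "0"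
        "0"] by linarith
  show "0 \<le> B2" using coeff_bounds
    poly8_nonneg[OF x, of "89719/90000" "-19/30" "14/45" "-2/15" "2/45" "0" "0" "0" "0"] by linarith
  show "0 \<le> B3" using coeff_bounds
    poly8_nonneg[OF x, of "9871/30000" "-29/180" "1/15" "-1/45" "0" "0" "0" "0" "0"] by linarith
qed

text \<open>The forms \<open>shift_coeff_j\<close> are the coefficients in powers of \<open>c - 1/5\<close> of \<open>remainder_nonneg_large\<close>.\<close>

lemma shift_coeff_0: "0 \<le> (-1/5*E - 26/25*E^2 - 1/5*E^3) * A1
    + (1/5 + 19/25*E - 2/125*E^2 + 29/25*E^3 + 1/5*E^4) * A2 + (-2/5*E - 52/25*E^2 - 2/5*E^3) * A3
        + (1/25 + 21/125*E + 2/25*E^2 + 31/125*E^3 + 1/25*E^4) * A4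
        + (-6/125*E - 1/625*E^2 + 4/125*E^3) * B1
        + (1/125 - 279/625*E + 231/625*E^3 + 1/125*E^4) * B2
        + (-1/25 - 21/125*E - 2/25*E^2 - 31/125*E^3 - 1/25*E^4) * B3"
proof -
  \<comment> \<open>Each coefficient is rounded down to a rational; then \<open>A1\<close>, ...,
    \<open>B3\<close> are replaced by their expansions. The constant term of the resulting
    polynomial absorbs all error bounds, weighted with the absolute values of the
    coefficients.\<close>
  have "(-6123/500) * A1 + (7273/200) * A2 + (-24491/1000) * A3 + (2063/250) * A4 + (1/2) * B1
      + (3327/500) * B2 + (-4127/500) * B3
      \<le> (-1/5*E - 26/25*E^2 - 1/5*E^3) * A1
      + (1/5 + 19/25*E - 2/125*E^2 + 29/25*E^3 + 1/5*E^4) * A2 + (-2/5*E - 52/25*E^2 - 2/5*E^3) * A3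
      + (1/25 + 21/125*E + 2/25*E^2 + 31/125*E^3 + 1/25*E^4) * A4
      + (-6/125*E - 1/625*E^2 + 4/125*E^3) * B1 + (1/125 - 279/625*E + 231/625*E^3 + 1/125*E^4) * B2
      + (-1/25 - 21/125*E - 2/25*E^2 - 31/125*E^3 - 1/25*E^4) * B3"
    by (intro add_mono mult_right_mono coeffs_nonneg) (use num_bounds in linarith)+
  moreover have "0 \<le> (-6123/500) * A1 + (7273/200) * A2 + (-24491/1000) * A3 + (2063/250) * A4
      + (1/2) * B1 + (3327/500) * B2 + (-4127/500) * B3"
    using poly8_nonneg[OF x, of "82238411/7500000" "-1896847/420000" "18857/3000" "-38429/315000"
        "3817/2500" "-12746/39375" "-839/11250" "0" "0"]
      coeff_bounds by linarith
  ultimately show ?thesis by linarith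
qed

lemma shift_coeff_1: "0 \<le> (-E - 2/5*E^2 - E^3) * A1
    + (1 - 7/5*E - 6/25*E^2 + 3/5*E^3 + E^4) * A2 + (-2*E - 4/5*E^2 - 2*E^3) * A3
        + (2/5 + 18/25*E + 4/5*E^2 + 38/25*E^3 + 2/5*E^4) * A4
        + (-13/25*E - 4/125*E^2 + 7/25*E^3) * B1 + (3/25 - 311/125*E + 219/125*E^3 + 3/25*E^4) * B2
        + (-2/5 - 18/25*E - 4/5*E^2 - 38/25*E^3 - 2/5*E^4) * B3"
proof -
  have "(-644/25) * A1 + (62069/1000) * A2 + (-1288/25) * A3 + (15159/250) * A4 + (3973/1000) * B1
      + (35097/1000) * B2 + (-60639/1000) * B3
      \<le> (-E - 2/5*E^2 - E^3) * A1 + (1 - 7/5*E - 6/25*E^2 + 3/5*E^3 + E^4) * A2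
      + (-2*E - 4/5*E^2 - 2*E^3) * A3 + (2/5 + 18/25*E + 4/5*E^2 + 38/25*E^3 + 2/5*E^4) * A4
      + (-13/25*E - 4/125*E^2 + 7/25*E^3) * B1 + (3/25 - 311/125*E + 219/125*E^3 + 3/25*E^4) * B2
      + (-2/5 - 18/25*E - 4/5*E^2 - 38/25*E^3 - 2/5*E^4) * B3"
    by (intro add_mono mult_right_mono coeffs_nonneg) (use num_bounds in linarith)+
  moreover have "0 \<le> (-644/25) * A1 + (62069/1000) * A2 + (-1288/25) * A3 + (15159/250) * A4
      + (3973/1000) * B1 + (35097/1000) * B2 + (-60639/1000) * B3"
    using poly8_nonneg[OF x, of "26593371769/315000000" "-37518371/1260000" "11275993/315000"
        "-1538779/315000" "1202261/157500" "-9911/13125" "-21787/157500" "0" "0"]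
      coeff_bounds by linarith
  ultimately show ?thesis by linarith
qed

lemma shift_coeff_2: "0 \<le> (-1*E^2) * A1 + (-E - 6/5*E^2 - E^3) * A2 + (-2*E^2) * A3
    + (1 - 2/5*E + 2*E^2 + 8/5*E^3 + E^4) * A4 + (-8/5*E - 6/25*E^2 + 2/5*E^3) * B1
        + (3/5 - 34/25*E - 4/25*E^3 + 3/5*E^4) * B2 + (-1 + 2/5*E - 2*E^2 - 8/5*E^3 - E^4) * B3"
proof -
  have "(-739/100) * A1 + (-3959/125) * A2 + (-14779/1000) * A3 + (12678/125) * A4
      + (1911/1000) * B1 + (26447/1000) * B2 + (-25357/250) * B3
      \<le> (-1*E^2) * A1 + (-E - 6/5*E^2 - E^3) * A2 + (-2*E^2) * A3
      + (1 - 2/5*E + 2*E^2 + 8/5*E^3 + E^4) * A4 + (-8/5*E - 6/25*E^2 + 2/5*E^3) * B1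
      + (3/5 - 34/25*E - 4/25*E^3 + 3/5*E^4) * B2 + (-1 + 2/5*E - 2*E^2 - 8/5*E^3 - E^4) * B3"
    by (intro add_mono mult_right_mono coeffs_nonneg) (use num_bounds in linarith)+
  moreover have "0 \<le> (-739/100) * A1 + (-3959/125) * A2 + (-14779/1000) * A3 + (12678/125) * A4
      + (1911/1000) * B1 + (26447/1000) * B2 + (-25357/250) * B3"
    using poly8_nonneg[OF x, of "52649670667/630000000" "-47837663/1260000" "11351939/315000"
        "-2690147/315000" "325294/39375" "-9301/39375" "-5479/157500" "0" "0"]
      coeff_bounds by linarith
  ultimately show ?thesis by linarith
qed

lemma shift_coeff_3: "0 \<le> (-2*E^2) * A2 + (E + E^3) * A4 + (-E - 4/5*E^2 - E^3) * B1
    + (1 - 1/5*E + 9/5*E^3 + E^4) * B2 + (-E - E^3) * B3"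
proof -
  have "(-14779/1000) * A2 + (22803/1000) * A4 + (-7179/250) * B1 + (45603/500) * B2
      + (-4561/200) * B3 \<le> (-2*E^2) * A2 + (E + E^3) * A4 + (-E - 4/5*E^2 - E^3) * B1
      + (1 - 1/5*E + 9/5*E^3 + E^4) * B2 + (-E - E^3) * B3"
    by (intro add_mono mult_right_mono coeffs_nonneg) (use num_bounds in linarith)+
  moreover have "0 \<le> (-14779/1000) * A2 + (22803/1000) * A4 + (-7179/250) * B1
      + (45603/500) * B2 + (-4561/200) * B3"
    using poly8_nonneg[OF x, of "66307663/3150000" "-21136247/1260000" "3630763/315000"
        "-1649863/315000" "423491/157500" "9572/13125" "-2393/13125" "0" "0"]
      coeff_bounds by linarith
  ultimately show ?thesis by linarith
qed

lemma shift_coeff_4: "0 \<le> (-1*E^2) * B1 + (E + E^3) * B2"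
proof -
  have "(-739/100) * B1 + (22803/1000) * B2 \<le> (-1*E^2) * B1 + (E + E^3) * B2"
    by (intro add_mono mult_right_mono coeffs_nonneg) (use num_bounds in linarith)+
  moreover have "0 \<le> (-739/100) * B1 + (22803/1000) * B2"
    using poly8_nonneg[OF x, of "474598063/210000000" "-1531037/630000" "76849/52500"
        "-138923/157500" "5419/17500" "1478/7875" "-739/15750" "0" "0"]
      coeff_bounds by linarith
  ultimately show ?thesis by linarith
qed

text \<open>This form and the two after it are the coefficients of k^0, k^1 and k^2 that remain in
  \<open>boundary_R\<close> once the factor 1 - x^2 is split off.\<close>

lemma two_cosh_A2_minus_A1: "0 \<le> (-1) * A1 + (F + E) * A2"
proof -
  have "(-1) * A1 + (1543/500) * A2 \<le> (-1) * A1 + (F + E) * A2"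
    by (intro add_mono mult_right_mono coeffs_nonneg) (use num_bounds in linarith)+
  moreover have "0 \<le> (-1) * A1 + (1543/500) * A2"
    using poly8_nonneg[OF x, of "96440419/315000000" "103657/315000" "15607/78750" "9403/78750"
        "3301/78750" "-8/315" "-2/315" "0" "0"]
      coeff_bounds by linarith
  ultimately show ?thesis by linarith
qed

lemma sinh_A2_minus_cosh_A3: "0 \<le> (-F + E) * A2 + (-F - E) * A3"
proof -
  have "(47/20) * A2 + (-3087/1000) * A3 \<le> (-F + E) * A2 + (-F - E) * A3"
    by (intro add_mono mult_right_mono coeffs_nonneg) (use num_bounds in linarith)+
  moreover have "0 \<le> (47/20) * A2 + (-3087/1000) * A3"
    using poly8_nonneg[OF x, of "117034981/90000000" "59459/60000" "23639/45000" "3671/15000"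
        "47/450" "0" "0" "0" "0"]
      coeff_bounds by linarith
  ultimately show ?thesis by linarith
qed

lemma A1_minus_two_sinh_A3: "0 \<le> (1) * A1 + (F - E) * A3"
proof -
  have "(1) * A1 + (-2351/1000) * A3 \<le> (1) * A1 + (F - E) * A3"
    by (intro add_mono mult_right_mono coeffs_nonneg) (use num_bounds in linarith)+
  moreover have "0 \<le> (1) * A1 + (-2351/1000) * A3"
    using poly8_nonneg[OF x, of "411564047/210000000" "1570747/1260000" "21181/35000" "25181/105000"
        "2/21" "8/315" "2/315" "0" "0"]
      coeff_bounds by linarith
  ultimately show ?thesis by linarith
qed

text \<open>Replacements common to the four forms below: the factors 1 + x, (1 - x)^2 (1 + x) and 1
  - x are nonnegative, so \<open>S\<close>, \<open>l\<close> and \<open>A2\<close> may be bounded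
  from below and \<open>E\<close>, \<open>F\<close> from above. The last two terms of the conclusion
  are together -2 (1 - x) (Re (exp z) + c), the trace of the half plane hypothesis.\<close>

lemma bernstein_coeff_nonneg:
  assumes "q \<le> S" "l' \<le> l"
    and "0 \<le> l' + (1 + x) * q + 2 * (1 - x)^2 * (1 + x) * (89719/90000 + 19/30*x + 14/45*x^2
        + 2/15*x^3 + 2/45*x^4)
      - (1 - x) * ((1 + x) * (271829/100000) + (1 - x) * (367881/1000000) + 2 * c)"
  shows "0 \<le> l + (1 + x) * S + 2 * (1 - x)^2 * (1 + x) * A2 - (1 - x) * ((1 + x) * E
      + (1 - x) * F + 2 * c)"
proof -
  have x1: "0 \<le> 1 + x" "0 \<le> 1 - x" using x_bounds by linarith+
  have "(1 + x) * q \<le> (1 + x) * S" using assms(1) x1(1) by (rule mult_left_mono)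
  moreover have "2 * (1 - x)^2 * (1 + x) * (89719/90000 + 19/30*x + 14/45*x^2 + 2/15*x^3 + 2/45*x^4)
      \<le> 2 * (1 - x)^2 * (1 + x) * A2"
    by (rule mult_left_mono) (use coeff_bounds x1 in \<open>linarith | simp\<close>)+
  moreover have "(1 + x) * E + (1 - x) * F \<le> (1 + x) * (271829/100000) + (1 - x) * (367881/1000000)"
    using x1 num_bounds by (intro add_mono mult_left_mono)
  then have "(1 - x) * ((1 + x) * E + (1 - x) * F + 2 * c)
      \<le> (1 - x) * ((1 + x) * (271829/100000) + (1 - x) * (367881/1000000) + 2 * c)"
    using x1 by (intro mult_left_mono add_right_mono)
  ultimately show ?thesis using assms(2,3) by linarith
qed

text \<open>
  The forms \<open>bernstein_coeff_j\<close> are the Bernstein coefficients in \<open>c \<in> [-1/2, 1/5]\<close> of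
  \<open>remainder_nonneg_small\<close>.
\<close>

lemma bernstein_coeff_0:
  "0 \<le> -1/4*F^2 + 5/4*F - 37/16 + 9/8*E + 13/16*E^2 - 3/8*E^3 + (1 + x) * ((1/2 - E) * A1
      + (-1/2 + 3/2*E + E^2) * A2 + (1 - 2*E) * A3 + (-1/4*E - 1/2*E^2) * A4
      + (1/8*E + 1/4*E^2) * B2 + (1/4*E + 1/2*E^2) * B3) + 2 * (1 - x)^2 * (1 + x) * A2 - (1
      - x) * ((1 + x) * E + (1 - x) * F + 2 * (-1/2))"
proof (rule bernstein_coeff_nonneg)
  have "(-2219/1000) * A1 + (5483/500) * A2 + (-4437/1000) * A3 + (-35/8) * A4 + (2187/1000) * B2
      + (2187/500) * B3 \<le> (1/2 - E) * A1 + (-1/2 + 3/2*E + E^2) * A2 + (1 - 2*E) * A3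
      + (-1/4*E - 1/2*E^2) * A4 + (1/8*E + 1/4*E^2) * B2 + (1/4*E + 1/2*E^2) * B3"
    by (intro add_mono mult_right_mono coeffs_nonneg) (use num_bounds in linarith)+
  moreover have "59016557/90000000 + 96071/180000*x + 11623/45000*x^2 + 14699/45000*x^3
      - 88/5625*x^4 - 317/5625*x^5 - 317/22500*x^6
      \<le> (-2219/1000) * A1 + (5483/500) * A2 + (-4437/1000) * A3 + (-35/8) * A4
      + (2187/1000) * B2 + (2187/500) * B3"
    using coeff_bounds by linarith
  ultimately show "59016557/90000000 + 96071/180000*x + 11623/45000*x^2 + 14699/45000*x^3
      - 88/5625*x^4 - 317/5625*x^5 - 317/22500*x^6
      \<le> (1/2 - E) * A1 + (-1/2 + 3/2*E + E^2) * A2 + (1 - 2*E) * A3 + (-1/4*E - 1/2*E^2) * A4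
      + (1/8*E + 1/4*E^2) * B2 + (1/4*E + 1/2*E^2) * B3" by linarith
  show "-179/500 \<le> -1/4*F^2 + 5/4*F - 37/16 + 9/8*E + 13/16*E^2 - 3/8*E^3" using num_bounds
      by linarith
  have "-179/500 + (1 + x) * (59016557/90000000 + 96071/180000*x + 11623/45000*x^2 + 14699/45000*x^3
      - 88/5625*x^4 - 317/5625*x^5 - 317/22500*x^6) + 2 * (1 - x)^2 * (1 + x) * (89719/90000
      + 19/30*x + 14/45*x^2 + 2/15*x^3 + 2/45*x^4) - (1 - x) * ((1 + x) * (271829/100000)
      + (1 - x) * (367881/1000000) + 2 * (-1/2))
      = 18479167/90000000 + 17832637/90000000*x + 1512677/3000000*x^2 + 14347/15000*x^3
      + 2333/3000*x^4 + 73/375*x^5 + 161/1500*x^6 + 187/2500*x^7"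
    by algebra
  also have "0 \<le> \<dots>"
    using poly8_nonneg[OF x, of "18479167/90000000" "17832637/90000000" "1512677/3000000"
        "14347/15000" "2333/3000" "73/375" "161/1500" "187/2500" "0"] by linarith
  finally show "0 \<le> -179/500 + (1 + x) * (59016557/90000000 + 96071/180000*x + 11623/45000*x^2
      + 14699/45000*x^3 - 88/5625*x^4 - 317/5625*x^5 - 317/22500*x^6) + 2 * (1 - x)^2 * (1
      + x) * (89719/90000 + 19/30*x + 14/45*x^2 + 2/15*x^3 + 2/45*x^4) - (1 - x) * ((1
      + x) * (271829/100000) + (1 - x) * (367881/1000000) + 2 * (-1/2))" .
qed

lemma bernstein_coeff_1:
  "0 \<le> -2/15*F^2 + 47/60*F - 211/120 + 107/120*E + 73/120*E^2 - 17/120*E^3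
      + (1 + x) * ((4/15 - E) * A1 + (-1/30 + 19/15*E + E^2) * A2 + (8/15 - 2*E) * A3
      + (-1/4*E - 4/15*E^2) * A4 + (1/15*E + 1/60*E^2) * B2
      + (1/4*E + 4/15*E^2) * B3) + 2 * (1 - x)^2 * (1 + x) * A2 - (1 - x) * ((1 + x) * E
      + (1 - x) * F + 2 * (-4/15))"
proof (rule bernstein_coeff_nonneg)
  have "(-613/250) * A1 + (5399/500) * A2 + (-613/125) * A3 + (-2651/1000) * A4 + (38/125) * B2
      + (2649/1000) * B3 \<le> (4/15 - E) * A1 + (-1/30 + 19/15*E + E^2) * A2 + (8/15 - 2*E) * A3
      + (-1/4*E - 4/15*E^2) * A4 + (1/15*E + 1/60*E^2) * B2 + (1/4*E + 4/15*E^2) * B3"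
    by (intro add_mono mult_right_mono coeffs_nonneg) (use num_bounds in linarith)+
  moreover have "-186875051/630000000 + 606419/420000*x + 43907/315000*x^2 + 162293/315000*x^3
      + 191/7875*x^4 - 2452/39375*x^5 - 613/39375*x^6
      \<le> (-613/250) * A1 + (5399/500) * A2 + (-613/125) * A3 + (-2651/1000) * A4 + (38/125) * B2
      + (2649/1000) * B3"
    using coeff_bounds by linarith
  ultimately show "-186875051/630000000 + 606419/420000*x + 43907/315000*x^2 + 162293/315000*x^3
      + 191/7875*x^4 - 2452/39375*x^5 - 613/39375*x^6
      \<le> (4/15 - E) * A1 + (-1/30 + 19/15*E + E^2) * A2 + (8/15 - 2*E) * A3
      + (-1/4*E - 4/15*E^2) * A4 + (1/15*E + 1/60*E^2) * B2 + (1/4*E + 4/15*E^2) * B3" by linarith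
  show "517/200 \<le> -2/15*F^2 + 47/60*F - 211/120 + 107/120*E + 73/120*E^2 - 17/120*E^3"
      using num_bounds by linarith
  have "517/200 + (1 + x) * (-186875051/630000000 + 606419/420000*x + 43907/315000*x^2
      + 162293/315000*x^3 + 191/7875*x^4 - 2452/39375*x^5 - 613/39375*x^6) + 2 * (1 - x)^2 * (1
      + x) * (89719/90000 + 19/30*x + 14/45*x^2 + 2/15*x^3 + 2/45*x^4) - (1 - x) * ((1
      + x) * (271829/100000) + (1 - x) * (367881/1000000) + 2 * (-4/15))
      = 363151073/210000000 + 392217509/630000000*x + 81613417/63000000*x^2 + 323233/315000*x^3
      + 316933/315000*x^4 + 3001/13125*x^5 + 787/7875*x^6 + 2887/39375*x^7"
    by algebra
  also have "0 \<le> \<dots>"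
    using poly8_nonneg[OF x, of "363151073/210000000" "392217509/630000000" "81613417/63000000"
        "323233/315000" "316933/315000" "3001/13125" "787/7875" "2887/39375" "0"] by linarith
  finally show "0 \<le> 517/200 + (1 + x) * (-186875051/630000000 + 606419/420000*x
      + 43907/315000*x^2 + 162293/315000*x^3 + 191/7875*x^4 - 2452/39375*x^5 - 613/39375*x^6)
      + 2 * (1 - x)^2 * (1 + x) * (89719/90000 + 19/30*x + 14/45*x^2 + 2/15*x^3 + 2/45*x^4) - (1
      - x) * ((1 + x) * (271829/100000) + (1 - x) * (367881/1000000) + 2 * (-4/15))" .
qed

lemma bernstein_coeff_2:
  "0 \<le> -1/60*F^2 + 12/25*F - 149/100 + 173/300*E + 79/150*E^2 + 1/100*E^3
      + (1 + x) * ((1/30 - E) * A1 + (8/75 + 31/30*E + E^2) * A2 + (1/15 - 2*E) * A3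
      + (-13/150*E - 1/30*E^2) * A4 + (-11/150*E - 4/75*E^2) * B2
      + (13/150*E + 1/30*E^2) * B3) + 2 * (1 - x)^2 * (1 + x) * A2 - (1 - x) * ((1 + x) * E
      + (1 - x) * F + 2 * (-1/30))"
proof (rule bernstein_coeff_nonneg)
  have "(-537/200) * A1 + (1288/125) * A2 + (-537/100) * A3 + (-241/500) * A4 + (-297/500) * B2
      + (481/1000) * B3 \<le> (1/30 - E) * A1 + (8/75 + 31/30*E + E^2) * A2 + (1/15 - 2*E) * A3
      + (-13/150*E - 1/30*E^2) * A4 + (-11/150*E - 4/75*E^2) * B2 + (13/150*E + 1/30*E^2) * B3"
    by (intro add_mono mult_right_mono coeffs_nonneg) (use num_bounds in linarith)+
  moreover have "-34255507/315000000 + 2009971/1260000*x + 130283/315000*x^2 + 169739/315000*x^3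
      + 20947/157500*x^4 - 179/2625*x^5 - 179/10500*x^6
      \<le> (-537/200) * A1 + (1288/125) * A2 + (-537/100) * A3 + (-241/500) * A4 + (-297/500) * B2
      + (481/1000) * B3"
    using coeff_bounds by linarith
  ultimately show "-34255507/315000000 + 2009971/1260000*x + 130283/315000*x^2 + 169739/315000*x^3
      + 20947/157500*x^4 - 179/2625*x^5 - 179/10500*x^6
      \<le> (1/30 - E) * A1 + (8/75 + 31/30*E + E^2) * A2 + (1/15 - 2*E) * A3
      + (-13/150*E - 1/30*E^2) * A4 + (-11/150*E - 4/75*E^2) * B2 + (13/150*E + 1/30*E^2) * B3"
      by linarith
  show "543/125 \<le> -1/60*F^2 + 12/25*F - 149/100 + 173/300*E + 79/150*E^2 + 1/100*E^3"
      using num_bounds by linarith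
  have "543/125 + (1 + x) * (-34255507/315000000 + 2009971/1260000*x + 130283/315000*x^2
      + 169739/315000*x^3 + 20947/157500*x^4 - 179/2625*x^5 - 179/10500*x^6) + 2 * (1 - x)^2 * (1
      + x) * (89719/90000 + 19/30*x + 14/45*x^2 + 2/15*x^3 + 2/45*x^4) - (1 - x) * ((1
      + x) * (271829/100000) + (1 - x) * (367881/1000000) + 2 * (-1/30))
      = 84249469/26250000 + 449969273/315000000*x + 36141439/21000000*x^2 + 83411/63000*x^3
      + 358633/315000*x^4 + 52207/157500*x^5 + 583/6300*x^6 + 2263/31500*x^7"
    by algebra
  also have "0 \<le> \<dots>"
    using poly8_nonneg[OF x, of "84249469/26250000" "449969273/315000000" "36141439/21000000"
        "83411/63000" "358633/315000" "52207/157500" "583/6300" "2263/31500" "0"] by linarith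
  finally show "0 \<le> 543/125 + (1 + x) * (-34255507/315000000 + 2009971/1260000*x
      + 130283/315000*x^2 + 169739/315000*x^3 + 20947/157500*x^4 - 179/2625*x^5 - 179/10500*x^6)
      + 2 * (1 - x)^2 * (1 + x) * (89719/90000 + 19/30*x + 14/45*x^2 + 2/15*x^3 + 2/45*x^4) - (1
      - x) * ((1 + x) * (271829/100000) + (1 - x) * (367881/1000000) + 2 * (-1/30))" .
qed

lemma bernstein_coeff_3:
  "0 \<le> 1/10*F^2 + 17/50*F - 167/125 + 9/50*E + 99/250*E^2 + 2/25*E^3
      + (1 + x) * ((-1/5 - E) * A1 + (-2/25 + 4/5*E + E^2) * A2 + (-2/5 - 2*E) * A3
      + (6/25*E + 1/5*E^2) * A4 + (6/125*E + 1/25*E^2) * B2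
      + (-6/25*E - 1/5*E^2) * B3) + 2 * (1 - x)^2 * (1 + x) * A2 - (1 - x) * ((1 + x) * E
      + (1 - x) * F + 2 * (1/5))"
proof (rule bernstein_coeff_nonneg)
  have "(-2919/1000) * A1 + (9483/1000) * A2 + (-5837/1000) * A3 + (213/100) * A4 + (213/500) * B2
      + (-2131/1000) * B3 \<le> (-1/5 - E) * A1 + (-2/25 + 4/5*E + E^2) * A2 + (-2/5 - 2*E) * A3
      + (6/25*E + 1/5*E^2) * A4 + (6/125*E + 1/25*E^2) * B2 + (-6/25*E - 1/5*E^2) * B3"
    by (intro add_mono mult_right_mono coeffs_nonneg) (use num_bounds in linarith)+
  moreover have "31759097/15000000 + 2219/5625*x + 10267/7500*x^2 + 1534/5625*x^3 + 1319/3750*x^4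
      - 139/1875*x^5 - 139/7500*x^6 \<le> (-2919/1000) * A1 + (9483/1000) * A2 + (-5837/1000) * A3
      + (213/100) * A4 + (213/500) * B2 + (-2131/1000) * B3"
    using coeff_bounds by linarith
  ultimately show "31759097/15000000 + 2219/5625*x + 10267/7500*x^2 + 1534/5625*x^3 + 1319/3750*x^4
      - 139/1875*x^5 - 139/7500*x^6 \<le> (-1/5 - E) * A1 + (-2/25 + 4/5*E + E^2) * A2
      + (-2/5 - 2*E) * A3 + (6/25*E + 1/5*E^2) * A4 + (6/125*E + 1/25*E^2) * B2
      + (-6/25*E - 1/5*E^2) * B3" by linarith
  show "478/125 \<le> 1/10*F^2 + 17/50*F - 167/125 + 9/50*E + 99/250*E^2 + 2/25*E^3"
      using num_bounds by linarith
  have "478/125 + (1 + x) * (31759097/15000000 + 2219/5625*x + 10267/7500*x^2 + 1534/5625*x^3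
      + 1319/3750*x^4 - 139/1875*x^5 - 139/7500*x^6) + 2 * (1 - x)^2 * (1 + x) * (89719/90000
      + 19/30*x + 14/45*x^2 + 2/15*x^3 + 2/45*x^4) - (1 - x) * ((1 + x) * (271829/100000)
      + (1 - x) * (367881/1000000) + 2 * (1/5))
      = 50049649/11250000 + 43806527/15000000*x + 13280681/9000000*x^2 + 90593/45000*x^3
      + 491/450*x^4 + 2041/3750*x^5 + 383/4500*x^6 + 1583/22500*x^7"
    by algebra
  also have "0 \<le> \<dots>"
    using poly8_nonneg[OF x, of "50049649/11250000" "43806527/15000000" "13280681/9000000"
        "90593/45000" "491/450" "2041/3750" "383/4500" "1583/22500" "0"] by linarith
  finally show "0 \<le> 478/125 + (1 + x) * (31759097/15000000 + 2219/5625*x + 10267/7500*x^2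
      + 1534/5625*x^3 + 1319/3750*x^4 - 139/1875*x^5 - 139/7500*x^6) + 2 * (1 - x)^2 * (1
      + x) * (89719/90000 + 19/30*x + 14/45*x^2 + 2/15*x^3 + 2/45*x^4) - (1 - x) * ((1
      + x) * (271829/100000) + (1 - x) * (367881/1000000) + 2 * (1/5))" .
qed

section \<open>The linear coefficient in m - 1, where m is the factor from Jack's lemma\<close>

lemma linear_part_bounds:
  "(((1 + x) * F - (1 - x) * E) / 2 + (1 - x\<^sup>2) * B3)
      \<le> (((1 + x) * (367881/1000000) - (1 - x) * (271828/100000)) / 2
      + (1 - x\<^sup>2) * (10129/30000 - 29/180*x + 1/15*x^2 - 1/45*x^3))"
  "(((1 + x) * (367877/1000000) - (1 - x) * (271829/100000)) / 2
      + (1 - x\<^sup>2) * (9871/30000 - 29/180*x + 1/15*x^2 - 1/45*x^3))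
      \<le> (((1 + x) * F - (1 - x) * E) / 2 + (1 - x\<^sup>2) * B3)"
  "(((1 + x) * (271828/100000) - (1 - x) * (367881/1000000)) / 2 - (1 - x\<^sup>2) * (10129/30000
      + 29/180*x + 1/15*x^2 + 1/45*x^3)) \<le> (((1 + x) * E - (1 - x) * F) / 2 - (1 - x\<^sup>2) * A3)"
proof -
  have x1: "0 \<le> 1 + x" "0 \<le> 1 - x" using x_bounds by linarith+
  have *: "(1 + x) * F \<le> (1 + x) * (367881/1000000)" "(1 + x) * (367877/1000000) \<le> (1 + x) * F"
    "(1 - x) * E \<le> (1 - x) * (271829/100000)" "(1 - x) * (271828/100000) \<le> (1 - x) * E"
    "(1 + x) * (271828/100000) \<le> (1 + x) * E" "(1 - x) * F \<le> (1 - x) * (367881/1000000)"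
    using x1 num_bounds by (simp_all only: mult_left_mono)
  have **: "(1 - x\<^sup>2) * B3 \<le> (1 - x\<^sup>2) * (10129/30000 - 29/180*x + 1/15*x^2 - 1/45*x^3)"
    "(1 - x\<^sup>2) * (9871/30000 - 29/180*x + 1/15*x^2 - 1/45*x^3) \<le> (1 - x\<^sup>2) * B3"
    "(1 - x\<^sup>2) * A3 \<le> (1 - x\<^sup>2) * (10129/30000 + 29/180*x + 1/15*x^2 + 1/45*x^3)"
    by (rule mult_left_mono[OF _ x_sq]; use coeff_bounds in linarith)+
  show "(((1 + x) * F - (1 - x) * E) / 2 + (1 - x\<^sup>2) * B3)
      \<le> (((1 + x) * (367881/1000000) - (1 - x) * (271828/100000)) / 2
      + (1 - x\<^sup>2) * (10129/30000 - 29/180*x + 1/15*x^2 - 1/45*x^3))"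
    by (rule add_mono[OF divide_right_mono[OF diff_mono[OF *(1) *(4)]] **(1)]) simp
  show "(((1 + x) * (367877/1000000) - (1 - x) * (271829/100000)) / 2
      + (1 - x\<^sup>2) * (9871/30000 - 29/180*x + 1/15*x^2 - 1/45*x^3))
      \<le> (((1 + x) * F - (1 - x) * E) / 2 + (1 - x\<^sup>2) * B3)"
    by (rule add_mono[OF divide_right_mono[OF diff_mono[OF *(2) *(3)]] **(2)]) simp
  show "(((1 + x) * (271828/100000) - (1 - x) * (367881/1000000)) / 2 - (1
      - x\<^sup>2) * (10129/30000 + 29/180*x + 1/15*x^2 + 1/45*x^3))
      \<le> (((1 + x) * E - (1 - x) * F) / 2 - (1 - x\<^sup>2) * A3)"
    by (rule diff_mono[OF divide_right_mono[OF diff_mono[OF *(5) *(6)]] **(3)]) simp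
qed

text \<open>Put \<psi> = Re (exp (-z) cnj z), \<phi> = Re (exp z cnj z) and s = (a + b)/2. The
  coefficient of m - 1 is 2 ((c + 1/2) (x - s \<psi>) + (1 + \<phi> - x/2) - s (x - \<psi>/2)). The
  slope in c and the value at c = -1/2 are both affine in s, which stays in [3/2, 41/20], so they
  need checking only at these two numbers.\<close>

lemma slope_nonneg_lower: "0 \<le> x - 3/2 * (((1 + x) * F - (1 - x) * E) / 2 + (1 - x\<^sup>2) * B3)"
proof -
  have "0 \<le> 5025397/4000000 - 12875449/12000000*x + 8129/20000*x^2 - 5/24*x^3 + 1/10*x^4 - 1/30*x^5"
    using poly8_nonneg[OF x, of "5025397/4000000" "-12875449/12000000" "8129/20000" "-5/24" "1/10"
        "-1/30" "0" "0" "0"] by linarith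
  also have "\<dots> = x - 3/2 * (((1 + x) * (367881/1000000) - (1 - x) * (271828/100000)) / 2
      + (1 - x\<^sup>2) * (10129/30000 - 29/180*x + 1/15*x^2 - 1/45*x^3))" by algebra
  also have "\<dots> \<le> x - 3/2 * (((1 + x) * F - (1 - x) * E) / 2 + (1 - x\<^sup>2) * B3)"
    by (rule diff_left_mono[OF mult_left_mono[OF linear_part_bounds(1)]]) simp
  finally show ?thesis .
qed

lemma intercept_nonneg_lower: "0 \<le> 1 + (((1 + x) * E - (1 - x) * F) / 2 - (1 - x\<^sup>2) * A3) - x / 2
    - 3/2 * (x - (((1 + x) * F - (1 - x) * E) / 2 + (1 - x\<^sup>2) * B3) / 2)"
proof -
  have "0 \<le> 28870471/24000000 + 6025661/14400000*x + 8903/120000*x^2 + 35/144*x^3 + 1/60*x^4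
      + 7/180*x^5"
    using poly8_nonneg[OF x, of "28870471/24000000" "6025661/14400000" "8903/120000" "35/144" "1/60"
        "7/180" "0" "0" "0"] by linarith
  also have "\<dots> = 1 + (((1 + x) * (271828/100000) - (1 - x) * (367881/1000000)) / 2 - (1
      - x\<^sup>2) * (10129/30000 + 29/180*x + 1/15*x^2 + 1/45*x^3)) - x / 2 - 3/2 * (x - (((1
      + x) * (367877/1000000) - (1 - x) * (271829/100000)) / 2
      + (1 - x\<^sup>2) * (9871/30000 - 29/180*x + 1/15*x^2 - 1/45*x^3)) / 2)"
    by (simp add: field_simps power_numeral_reduce)
  also have "\<dots> \<le> 1 + (((1 + x) * E - (1 - x) * F) / 2 - (1 - x\<^sup>2) * A3) - x / 2
      - 3/2 * (x - (((1 + x) * F - (1 - x) * E) / 2 + (1 - x\<^sup>2) * B3) / 2)"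
    by (rule diff_mono[OF diff_right_mono[OF add_left_mono[OF linear_part_bounds(3)]]
      mult_left_mono[OF diff_left_mono[OF divide_right_mono[OF linear_part_bounds(2)]]]]) simp_all
  finally show ?thesis .
qed

lemma slope_nonneg_upper: "0 \<le> x - 41/20 * (((1 + x) * F - (1 - x) * E) / 2 + (1 - x\<^sup>2) * B3)"
proof -
  have "0 \<le> 206041277/120000000 - 659893409/360000000*x + 333289/600000*x^2 - 41/144*x^3
      + 41/300*x^4 - 41/900*x^5"
    using poly8_nonneg[OF x, of "206041277/120000000" "-659893409/360000000" "333289/600000"
        "-41/144" "41/300" "-41/900" "0" "0" "0"] by linarith
  also have "\<dots> = x - 41/20 * (((1 + x) * (367881/1000000) - (1 - x) * (271828/100000)) / 2
      + (1 - x\<^sup>2) * (10129/30000 - 29/180*x + 1/15*x^2 - 1/45*x^3))" by algebra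
  also have "\<dots> \<le> x - 41/20 * (((1 + x) * F - (1 - x) * E) / 2 + (1 - x\<^sup>2) * B3)"
    by (rule diff_left_mono[OF mult_left_mono[OF linear_part_bounds(1)]]) simp
  finally show ?thesis .
qed

lemma intercept_nonneg_upper: "0 \<le> 1 + (((1 + x) * E - (1 - x) * F) / 2 - (1 - x\<^sup>2) * A3) - x / 2
    - 41/20 * (x - (((1 + x) * F - (1 - x) * E) / 2 + (1 - x\<^sup>2) * B3) / 2)"
proof -
  have "0 \<le> 232857281/240000000 + 19879287/80000000*x + 2449/1200000*x^2 + 9/32*x^3 - 1/600*x^4
      + 9/200*x^5"
    using poly8_nonneg[OF x, of "232857281/240000000" "19879287/80000000" "2449/1200000" "9/32"
        "-1/600" "9/200" "0" "0" "0"] by linarith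
  also have "\<dots> = 1 + (((1 + x) * (271828/100000) - (1 - x) * (367881/1000000)) / 2 - (1
      - x\<^sup>2) * (10129/30000 + 29/180*x + 1/15*x^2 + 1/45*x^3)) - x / 2 - 41/20 * (x - (((1
      + x) * (367877/1000000) - (1 - x) * (271829/100000)) / 2
      + (1 - x\<^sup>2) * (9871/30000 - 29/180*x + 1/15*x^2 - 1/45*x^3)) / 2)"
    by (simp add: field_simps power_numeral_reduce)
  also have "\<dots> \<le> 1 + (((1 + x) * E - (1 - x) * F) / 2 - (1 - x\<^sup>2) * A3) - x / 2
      - 41/20 * (x - (((1 + x) * F - (1 - x) * E) / 2 + (1 - x\<^sup>2) * B3) / 2)"
    by (rule diff_mono[OF diff_right_mono[OF add_left_mono[OF linear_part_bounds(3)]]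
      mult_left_mono[OF diff_left_mono[OF divide_right_mono[OF linear_part_bounds(2)]]]]) simp_all
  finally show ?thesis .
qed

text \<open>For c \<ge> 1/5 this is the cofactor of 1 - x^2 in \<open>affine_expansion\<close>,
  multiplied by the common denominator E (1 + c E) (E + c) of a and b; the result is a polynomial of
  degree 4 in c.\<close>

lemma remainder_nonneg_large:
  assumes c: "1/5 \<le> c"
  shows "0 \<le> - (E * (1 + c * E) * (E + c)) * (A1 + 2 * A3 + 2 * c * A2)
      + ((1 + c * E - E) * (E + c) + E^2 * (E + c + 1) * (1 + c * E)) * (A2 + c * A4 + c^2 * B2 - c * B3)
      - E * (1 + c * E - E) * (E + c + 1) * (2 * c * B2 + c^2 * B1)"
proof -
  define t where "t = c - 1/5"
  have t: "0 \<le> t" and ct: "c = t + 1/5" using c by (simp_all add: t_def)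
  note n0 = mult_nonneg_nonneg[OF zero_le_power[OF t, of 0] shift_coeff_0]
  note n1 = mult_nonneg_nonneg[OF zero_le_power[OF t, of 1] shift_coeff_1]
  note n2 = mult_nonneg_nonneg[OF zero_le_power[OF t, of 2] shift_coeff_2]
  note n3 = mult_nonneg_nonneg[OF zero_le_power[OF t, of 3] shift_coeff_3]
  note n4 = mult_nonneg_nonneg[OF zero_le_power[OF t, of 4] shift_coeff_4]
  have "- (E * (1 + c * E) * (E + c)) * (A1 + 2 * A3 + 2 * c * A2)
      + ((1 + c * E - E) * (E + c) + E^2 * (E + c + 1) * (1 + c * E)) * (A2 + c * A4 + c^2 * B2 - c * B3)
      - E * (1 + c * E - E) * (E + c + 1) * (2 * c * B2 + c^2 * B1)
    = t^0 * ((-1/5*E - 26/25*E^2 - 1/5*E^3) * A1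
        + (1/5 + 19/25*E - 2/125*E^2 + 29/25*E^3 + 1/5*E^4) * A2
        + (-2/5*E - 52/25*E^2 - 2/5*E^3) * A3
        + (1/25 + 21/125*E + 2/25*E^2 + 31/125*E^3 + 1/25*E^4) * A4
        + (-6/125*E - 1/625*E^2 + 4/125*E^3) * B1
        + (1/125 - 279/625*E + 231/625*E^3 + 1/125*E^4) * B2
        + (-1/25 - 21/125*E - 2/25*E^2 - 31/125*E^3 - 1/25*E^4) * B3)
      + t^1 * ((-E - 2/5*E^2 - E^3) * A1 + (1 - 7/5*E - 6/25*E^2 + 3/5*E^3 + E^4) * A2
      + (-2*E - 4/5*E^2 - 2*E^3) * A3 + (2/5 + 18/25*E + 4/5*E^2 + 38/25*E^3 + 2/5*E^4) * A4
      + (-13/25*E - 4/125*E^2 + 7/25*E^3) * B1 + (3/25 - 311/125*E + 219/125*E^3 + 3/25*E^4) * B2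
      + (-2/5 - 18/25*E - 4/5*E^2 - 38/25*E^3 - 2/5*E^4) * B3)
      + t^2 * ((-1*E^2) * A1 + (-E - 6/5*E^2 - E^3) * A2 + (-2*E^2) * A3
      + (1 - 2/5*E + 2*E^2 + 8/5*E^3 + E^4) * A4 + (-8/5*E - 6/25*E^2 + 2/5*E^3) * B1
      + (3/5 - 34/25*E - 4/25*E^3 + 3/5*E^4) * B2 + (-1 + 2/5*E - 2*E^2 - 8/5*E^3 - E^4) * B3)
      + t^3 * ((-2*E^2) * A2 + (E + E^3) * A4 + (-E - 4/5*E^2 - E^3) * B1
      + (1 - 1/5*E + 9/5*E^3 + E^4) * B2 + (-E - E^3) * B3)
      + t^4 * ((-1*E^2) * B1 + (E + E^3) * B2)"
    unfolding ct by algebra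
  with add_nonneg_nonneg[OF add_nonneg_nonneg[OF add_nonneg_nonneg[OF add_nonneg_nonneg[OF n0 n1] n2] n3] n4]
  show ?thesis by (simp only:)
qed

text \<open>With a = 0 only the factor 1 - x can be split off. The expression is (E + c) Re (p a cnj
  (p b)) / (1 - x) for m = 1, less 2 (1 - x) (Re (exp z) + c), a term that is nonnegative in the
  half plane where the inequality is needed.\<close>

lemma remainder_nonneg_small:
  assumes c: "-1/2 \<le> c" "c \<le> 1/5"
  shows "0 \<le> 1/2 * ((F - 1 + c) * ((E + c) * (F - 1 + c) - E * (E + c + 1) * (1 + c * E)))
      + (1 + x) * (- (E + c) * (A1 + 2 * A3 + 2 * c * A2) + E * (E + c + 1) * (A2 + c * A4
      + c^2 * B2 - c * B3))
      + 2 * (1 - x)^2 * (1 + x) * A2 - (1 - x) * ((1 + x) * E + (1 - x) * F + 2 * c)"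
proof -
  \<comment> \<open>The affine map of [-1/2, 1/5] onto [0, 1]; the expression is cubic in c, so the
    Bernstein weights are 1, 3, 3, 1.\<close>
  define s where "s = (2 * c + 1) * (5/7)"
  have s: "0 \<le> s" "0 \<le> 1 - s" and cs: "c = s * (7/10) - 1/2" using c
      by (auto simp: s_def field_simps)
  have "0 \<le> 1 * (s^0 * (1 - s)^3)" using s by simp
  note n0 = mult_nonneg_nonneg[OF this bernstein_coeff_0]
  have "0 \<le> 3 * (s^1 * (1 - s)^2)" using s by simp
  note n1 = mult_nonneg_nonneg[OF this bernstein_coeff_1]
  have "0 \<le> 3 * (s^2 * (1 - s)^1)" using s by simp
  note n2 = mult_nonneg_nonneg[OF this bernstein_coeff_2]
  have "0 \<le> 1 * (s^3 * (1 - s)^0)" using s by simp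
  note n3 = mult_nonneg_nonneg[OF this bernstein_coeff_3]
  have "1/2 * ((F - 1 + c) * ((E + c) * (F - 1 + c) - E * (E + c + 1) * (1 + c * E)))
      + (1 + x) * (- (E + c) * (A1 + 2 * A3 + 2 * c * A2) + E * (E + c + 1) * (A2 + c * A4
      + c^2 * B2 - c * B3))
      + 2 * (1 - x)^2 * (1 + x) * A2 - (1 - x) * ((1 + x) * E + (1 - x) * F + 2 * c)
    = 1 * (s^0 * (1 - s)^3) * (-1/4*F^2 + 5/4*F - 37/16 + 9/8*E + 13/16*E^2 - 3/8*E^3
        + (1 + x) * ((1/2 - E) * A1 + (-1/2 + 3/2*E + E^2) * A2 + (1 - 2*E) * A3
        + (-1/4*E - 1/2*E^2) * A4 + (1/8*E + 1/4*E^2) * B2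
        + (1/4*E + 1/2*E^2) * B3) + 2 * (1 - x)^2 * (1 + x) * A2 - (1 - x) * ((1 + x) * E
        + (1 - x) * F + 2 * (-1/2)))
      + 3 * (s^1 * (1 - s)^2) * (-2/15*F^2 + 47/60*F - 211/120 + 107/120*E + 73/120*E^2 - 17/120*E^3
      + (1 + x) * ((4/15 - E) * A1 + (-1/30 + 19/15*E + E^2) * A2 + (8/15 - 2*E) * A3
      + (-1/4*E - 4/15*E^2) * A4 + (1/15*E + 1/60*E^2) * B2
      + (1/4*E + 4/15*E^2) * B3) + 2 * (1 - x)^2 * (1 + x) * A2 - (1 - x) * ((1 + x) * E
      + (1 - x) * F + 2 * (-4/15)))
      + 3 * (s^2 * (1 - s)^1) * (-1/60*F^2 + 12/25*F - 149/100 + 173/300*E + 79/150*E^2 + 1/100*E^3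
      + (1 + x) * ((1/30 - E) * A1 + (8/75 + 31/30*E + E^2) * A2 + (1/15 - 2*E) * A3
      + (-13/150*E - 1/30*E^2) * A4 + (-11/150*E - 4/75*E^2) * B2
      + (13/150*E + 1/30*E^2) * B3) + 2 * (1 - x)^2 * (1 + x) * A2 - (1 - x) * ((1 + x) * E
      + (1 - x) * F + 2 * (-1/30)))
      + 1 * (s^3 * (1 - s)^0) * (1/10*F^2 + 17/50*F - 167/125 + 9/50*E + 99/250*E^2 + 2/25*E^3
      + (1 + x) * ((-1/5 - E) * A1 + (-2/25 + 4/5*E + E^2) * A2 + (-2/5 - 2*E) * A3
      + (6/25*E + 1/5*E^2) * A4 + (6/125*E + 1/25*E^2) * B2
      + (-6/25*E - 1/5*E^2) * B3) + 2 * (1 - x)^2 * (1 + x) * A2 - (1 - x) * ((1 + x) * E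
      + (1 - x) * F + 2 * (1/5)))"
    unfolding cs using EF by algebra
  with add_nonneg_nonneg[OF add_nonneg_nonneg[OF add_nonneg_nonneg[OF n0 n1] n2] n3]
  show ?thesis by (simp only:)
qed

end

section \<open>The boundary inequalities\<close>

lemma circle_coeffs_exist:
  fixes z :: complex
  assumes z: "norm z = 1"
  defines "x \<equiv> Re z" and "E \<equiv> exp (1::real)" and "F \<equiv> exp (- 1::real)"
  obtains A1 A2 A3 A4 B1 B2 B3 where "circle_coeffs x A1 A2 A3 A4 B1 B2 B3 E F"
    "exp (2 * x) = ((1 + x) * E^2 + (1 - x) * F^2) / 2 - (1 - x\<^sup>2) * A1"
    "exp (- 2 * x) = ((1 - x) * E^2 + (1 + x) * F^2) / 2 - (1 - x\<^sup>2) * B1"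
    "Re (exp z) = ((1 + x) * E + (1 - x) * F) / 2 - (1 - x\<^sup>2) * A2"
    "Re (exp (- z)) = ((1 - x) * E + (1 + x) * F) / 2 - (1 - x\<^sup>2) * B2"
    "Re (exp z * cnj z) = ((1 + x) * E - (1 - x) * F) / 2 - (1 - x\<^sup>2) * A3"
    "Re (exp (- z) * cnj z) = ((1 + x) * F - (1 - x) * E) / 2 + (1 - x\<^sup>2) * B3"
    "cos (2 * Im z) = 1 - (1 - x\<^sup>2) * A4"
proof -
  have xy: "x\<^sup>2 + (Im z)\<^sup>2 = 1" using unit_square[OF z] by (simp add: x_def)
  have x1: "\<bar>x\<bar> \<le> 1" "\<bar>- x\<bar> \<le> 1" using abs_Re_le_cmod[of z] z by (simp_all add: x_def)
  have z': "norm (- z) = 1" using z by simp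
  obtain A1 where A1: "exp (2 * x) = cosh 2 + x * sinh 2 - (1 - x\<^sup>2) * A1"
    "\<bar>A1 - (58/21 + 512/315*x + 16/21*x^2 + 92/315*x^3 + 2/21*x^4 + 8/315*x^5 + 2/315*x^6)\<bar> \<le> 83/10000"
    by (rule exp_double_expansion[OF x1(1)])
  obtain B1 where B1: "exp (2 * (- x)) = cosh 2 + (- x) * sinh 2 - (1 - (- x)\<^sup>2) * B1"
    "\<bar>B1 - (58/21 + 512/315*(- x) + 16/21*(- x)^2 + 92/315*(- x)^3 + 2/21*(- x)^4 + 8/315*(- x)^5 + 2/315*(- x)^6)\<bar> \<le> 83/10000"
    by (rule exp_double_expansion[OF x1(2)])
  obtain A2 where A2: "Re (exp z) = cosh 1 + x * sinh 1 - (1 - x\<^sup>2) * A2"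
    "\<bar>A2 - (361/360 + 19/30*x + 14/45*x^2 + 2/15*x^3 + 2/45*x^4)\<bar> \<le> 59/10000"
    unfolding x_def by (rule Re_exp_expansion[OF z])
  obtain B2 where B2: "Re (exp (- z)) = cosh 1 + - x * sinh 1 - (1 - (- x)\<^sup>2) * B2"
    "\<bar>B2 - (361/360 + 19/30*(- x) + 14/45*(- x)^2 + 2/15*(- x)^3 + 2/45*(- x)^4)\<bar> \<le> 59/10000"
    by (rule Re_exp_expansion[OF z', unfolded uminus_complex.sel, folded x_def])
  obtain A3 where A3: "Re (exp z * cnj z) = sinh 1 + x * cosh 1 - (1 - x\<^sup>2) * A3"
    "\<bar>A3 - (1/3 + 29/180*x + 1/15*x^2 + 1/45*x^3)\<bar> \<le> 43/10000"
    unfolding x_def by (rule Re_exp_cnj_expansion[OF z])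
  obtain B3 where B3: "Re (exp (- z) * cnj (- z)) = sinh 1 + - x * cosh 1 - (1 - (- x)\<^sup>2) * B3"
    "\<bar>B3 - (1/3 + 29/180*(- x) + 1/15*(- x)^2 + 1/45*(- x)^3)\<bar> \<le> 43/10000"
    using Re_exp_cnj_expansion[OF z', unfolded uminus_complex.sel(1), folded x_def] .
  obtain A4 where A4: "cos (2 * Im z) = 1 - (1 - x\<^sup>2) * A4"
    "\<bar>A4 - (64/45 + 22/45*x^2 + 4/45*x^4)\<bar> \<le> 64/10000"
    by (rule cos_double_expansion[OF xy])
  have ch: "cosh 1 = (E + F) / 2" "sinh 1 = (E - F) / 2" "cosh 2 = (E^2 + F^2) / 2" "sinh 2 = (E^2 - F^2) / 2"
    by (simp_all add: E_def F_def cosh_field_def sinh_field_def flip: exp_double)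
  have neg: "58/21 + 512/315*(- x) + 16/21*(- x)^2 + 92/315*(- x)^3 + 2/21*(- x)^4 + 8/315*(- x)^5 + 2/315*(- x)^6
      = 58/21 - 512/315*x + 16/21*x^2 - 92/315*x^3 + 2/21*x^4 - 8/315*x^5 + 2/315*x^6"
    "361/360 + 19/30*(- x) + 14/45*(- x)^2 + 2/15*(- x)^3 + 2/45*(- x)^4
      = 361/360 - 19/30*x + 14/45*x^2 - 2/15*x^3 + 2/45*x^4"
    "1/3 + 29/180*(- x) + 1/15*(- x)^2 + 1/45*(- x)^3 = 1/3 - 29/180*x + 1/15*x^2 - 1/45*x^3"
    by simp_all
  have EF: "E * F = 1" by (simp add: E_def F_def flip: exp_add)
  show ?thesis
  proof (rule that)
    show "circle_coeffs x A1 A2 A3 A4 B1 B2 B3 E F"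
      by (intro circle_coeffs.intro x1(1) exp_1_bounds[folded E_def] EF A1(2) A2(2) A3(2) A4(2)
        B1(2)[unfolded neg] B2(2)[unfolded neg] B3(2)[unfolded neg])
    show "exp (2 * x) = ((1 + x) * E^2 + (1 - x) * F^2) / 2 - (1 - x\<^sup>2) * A1"
      unfolding A1(1) ch by (simp add: field_simps)
    have "exp (- 2 * x) = exp (2 * (- x))" by simp
    then show "exp (- 2 * x) = ((1 - x) * E^2 + (1 + x) * F^2) / 2 - (1 - x\<^sup>2) * B1"
      unfolding B1(1) ch by (simp add: field_simps)
    show "Re (exp z) = ((1 + x) * E + (1 - x) * F) / 2 - (1 - x\<^sup>2) * A2"
      unfolding A2(1) ch by (simp add: field_simps)
    show "Re (exp (- z)) = ((1 - x) * E + (1 + x) * F) / 2 - (1 - x\<^sup>2) * B2"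
      unfolding B2(1) ch by (simp add: field_simps)
    show "Re (exp z * cnj z) = ((1 + x) * E - (1 - x) * F) / 2 - (1 - x\<^sup>2) * A3"
      unfolding A3(1) ch by (simp add: field_simps)
    \<comment> \<open>The factor \<open>cnj z\<close> is odd in z, which reverses the sign of the
      expansion taken at -z.\<close>
    have "Re (exp (- z) * cnj z) = - Re (exp (- z) * cnj (- z))" by simp
    then show "Re (exp (- z) * cnj z) = ((1 + x) * F - (1 - x) * E) / 2 + (1 - x\<^sup>2) * B3"
      unfolding B3(1) ch by (simp add: field_simps)
  qed (fact A4(1))
qed

text \<open>Real coordinates tied by polynomial relations only, so that identities mixing exp z and
  exp (-z) become accessible to Groebner bases.\<close>

lemma exp_circle_identities:
  fixes z :: complex
  assumes "norm z = 1"
  obtains X Z cy sy :: real where "exp z = Complex (X * cy) (X * sy)" "exp (- z) = Complex (Z * cy) (- Z * sy)"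
    "X * Z = 1" "cy^2 + sy^2 = 1" "exp (2 * Re z) = X^2" "exp (- 2 * Re z) = Z^2" "cos (2 * Im z) = cy^2 - sy^2"
proof (rule that[of "exp (Re z)" "cos (Im z)" "sin (Im z)" "exp (- Re z)"])
  show "exp (2 * Re z) = (exp (Re z))\<^sup>2" "exp (- 2 * Re z) = (exp (- Re z))\<^sup>2"
    by (simp_all flip: exp_double)
qed (simp_all add: complex_eq_iff Re_exp Im_exp cos_double flip: exp_add)

text \<open>At an exit point with m = 1, h - t equals exp z / (exp z + c) times \<open>p t\<close>,
  so the position of h relative to a disc is governed by \<open>p a * cnj (p b)\<close>. Besides x
  and the parameters, the right side contains only the seven functions whose expansions are
  known.\<close>

lemma Re_mult_cnj_affine:
  fixes z :: complex and a b c :: real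
  assumes z: "norm z = 1"
  defines "p \<equiv> \<lambda>t. exp z + z + of_real c - of_real t * (1 + of_real c * exp (- z))"
  shows "Re (p a * cnj (p b)) =
    exp (2 * Re z) + 1 + c^2 + 2 * Re (exp z * cnj z) + 2 * c * Re (exp z) + 2 * c * Re z
    - (a + b) * (Re (exp z) + Re z + c + c * cos (2 * Im z) + c^2 * Re (exp (- z)) + c * Re (exp (- z) * cnj z))
    + a * b * (1 + 2 * c * Re (exp (- z)) + c^2 * exp (- 2 * Re z))"
proof -
  obtain X Z cy sy where *: "exp z = Complex (X * cy) (X * sy)" "exp (- z) = Complex (Z * cy) (- Z * sy)"
    "X * Z = 1" "cy^2 + sy^2 = 1" "exp (2 * Re z) = X^2" "exp (- 2 * Re z) = Z^2" "cos (2 * Im z) = cy^2 - sy^2"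
    using exp_circle_identities[OF z] .
  have xy: "(Re z)\<^sup>2 + (Im z)\<^sup>2 = 1" using unit_square[OF z] by simp
  define u where "u = exp z + z + of_real c"
  define v where "v = 1 + of_real c * exp (- z)"
  have uu: "Re (u * cnj u) = X^2 + 1 + c^2 + 2 * Re (exp z * cnj z) + 2 * c * Re (exp z) + 2 * c * Re z"
    unfolding u_def *(1) using *(4) xy by (simp, algebra)
  have uv: "Re (u * cnj v) = Re (exp z) + Re z + c + c * (cy^2 - sy^2) + c^2 * Re (exp (- z)) + c * Re (exp (- z) * cnj z)"
    unfolding u_def v_def *(1,2) using *(3) by (simp, algebra)
  have vv: "Re (v * cnj v) = 1 + 2 * c * Re (exp (- z)) + c^2 * Z^2"
    unfolding v_def *(2) using *(4) by (simp, algebra)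
  have "Re (p a * cnj (p b)) = Re (u * cnj u) - (a + b) * Re (u * cnj v) + a * b * Re (v * cnj v)"
    unfolding p_def u_def[symmetric] v_def[symmetric] by (simp add: algebra_simps)
  then show ?thesis unfolding uu uv vv *(5-7) .
qed

text \<open>The left side is the power of the point v with respect to the circle on the diameter
  [a, b], which for a \<le> b is negative exactly inside. In the product form a common factor of the
  two differences contributes only its squared modulus.\<close>

lemma outside_disc_iff:
  "(Re v - a) * (Re v - b) + (Im v)\<^sup>2 = Re ((v - of_real a) * cnj (v - of_real b))"
  by (simp add: power2_eq_square)

lemma outside_disc_mono:
  fixes r t :: real
  assumes "a' \<le> a" "a \<le> b" "b \<le> b'" "0 \<le> (r - a') * (r - b') + t\<^sup>2"
  shows "0 \<le> (r - a) * (r - b) + t\<^sup>2"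
proof (cases "a \<le> r \<and> r \<le> b")
  case True
  then have "(r - a) * (b - r) \<le> (r - a') * (b' - r)" using assms by (intro mult_mono) auto
  then show ?thesis using assms(4) by (simp add: algebra_simps)
next
  case False
  then have "0 \<le> (r - a) * (r - b)" using assms(2) by (auto simp: zero_le_mult_iff)
  then show ?thesis by simp
qed

text \<open>Here k = m / \<gamma>, and the two ends are the values of \<open>v\<close> at z = -1 and
  z = 1. Dividing by |exp z|^2 leaves functions of exp (-z); hence the expansions are taken at
  \<open>w = - z\<close>, and the quotient is 1 - x^2 times a quadratic in k with nonnegative
  coefficients.\<close>

lemma boundary_R:
  fixes z :: complex and k :: real
  assumes z: "norm z = 1" and k: "0 \<le> k"
  defines "v \<equiv> exp z * (1 + of_real k * z)"
  shows "0 \<le> (Re v - (1 - k) * exp (- 1)) * (Re v - exp 1 * (1 + k)) + (Im v)\<^sup>2"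
proof -
  define E F where "E = exp (1::real)" and "F = exp (- 1::real)"
  define w where "w = - z"
  have w: "norm w = 1" using z by (simp add: w_def)
  obtain A1 A2 A3 A4 B1 B2 B3 where "circle_coeffs (Re w) A1 A2 A3 A4 B1 B2 B3 E F"
    and A: "exp (2 * Re w) = ((1 + Re w) * E^2 + (1 - Re w) * F^2) / 2 - (1 - (Re w)\<^sup>2) * A1"
    "Re (exp w) = ((1 + Re w) * E + (1 - Re w) * F) / 2 - (1 - (Re w)\<^sup>2) * A2"
    "Re (exp w * cnj w) = ((1 + Re w) * E - (1 - Re w) * F) / 2 - (1 - (Re w)\<^sup>2) * A3"
    using circle_coeffs_exist[OF w] unfolding E_def F_def by metis
  then interpret circle_coeffs "Re w" A1 A2 A3 A4 B1 B2 B3 E F by simp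
  define x where "x = Re z"
  have A': "exp (- 2 * x) = ((1 - x) * E^2 + (1 + x) * F^2) / 2 - (1 - x\<^sup>2) * A1"
    "Re (exp (- z)) = ((1 - x) * E + (1 + x) * F) / 2 - (1 - x\<^sup>2) * A2"
    "Re (exp (- z) * cnj z) = - (((1 - x) * E - (1 + x) * F) / 2 - (1 - x\<^sup>2) * A3)"
    using A by (simp_all add: x_def w_def)
  have xs: "0 \<le> 1 - x\<^sup>2" using x_sq by (simp add: x_def w_def)
  obtain X Z cy sy where *: "exp z = Complex (X * cy) (X * sy)" "exp (- z) = Complex (Z * cy) (- Z * sy)"
    "X * Z = 1" "cy^2 + sy^2 = 1" "exp (2 * Re z) = X^2" "exp (- 2 * Re z) = Z^2" "cos (2 * Im z) = cy^2 - sy^2"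
    using exp_circle_identities[OF z] .
  have xy: "(Re z)\<^sup>2 + (Im z)\<^sup>2 = 1" using unit_square[OF z] by simp
  have v: "(Re v - a) * (Re v - b) + (Im v)\<^sup>2 = X^2 * (1 + 2 * k * x + k^2
      - (a + b) * (Re (exp (- z)) + k * Re (exp (- z) * cnj z)) + a * b * exp (- 2 * x))" for a b
    unfolding v_def x_def *(6) unfolding *(1,2) using *(3,4) xy by (simp, algebra)
  have "1 + 2 * k * x + k^2 - ((1 - k) * F + E * (1 + k)) * (Re (exp (- z)) + k * Re (exp (- z) * cnj z))
      + (1 - k) * F * (E * (1 + k)) * exp (- 2 * x)
    = (1 - x\<^sup>2) * ((-1 * A1 + (F + E) * A2) + k * ((- F + E) * A2 + (- F - E) * A3) + k^2 * (1 * A1 + (F - E) * A3))"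
    unfolding A' using EF by algebra
  then have "(Re v - (1 - k) * F) * (Re v - E * (1 + k)) + (Im v)\<^sup>2
    = X^2 * ((1 - x\<^sup>2) * ((-1 * A1 + (F + E) * A2) + k * ((- F + E) * A2 + (- F - E) * A3) + k^2 * (1 * A1 + (F - E) * A3)))"
    unfolding v by simp
  also have "0 \<le> \<dots>"
    by (rule mult_nonneg_nonneg[OF zero_le_power2 mult_nonneg_nonneg[OF xs
      add_nonneg_nonneg[OF add_nonneg_nonneg[OF two_cosh_A2_minus_A1
        mult_nonneg_nonneg[OF k sinh_A2_minus_cosh_A3]]
        mult_nonneg_nonneg[OF zero_le_power2 A1_minus_two_sinh_A3]]]])
  finally show ?thesis unfolding E_def F_def .
qed

text \<open>The first two terms interpolate linearly in x between the products at z = 1 and z = -1,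
  where \<open>p t\<close> is real. Each vanishes as soon as a or b is the value of h at that
  point.\<close>

lemma affine_expansion:
  fixes z :: complex and c :: real
  assumes z: "norm z = 1"
  defines "x \<equiv> Re z" and "E \<equiv> exp (1::real)" and "F \<equiv> exp (- 1::real)"
    and "p \<equiv> \<lambda>t. exp z + z + of_real c - of_real t * (1 + of_real c * exp (- z))"
  obtains A1 A2 A3 A4 B1 B2 B3 where "circle_coeffs x A1 A2 A3 A4 B1 B2 B3 E F"
    "\<And>a b. Re (p a * cnj (p b))
      = (1 + x) / 2 * (E + 1 + c - a * (1 + c * F)) * (E + 1 + c - b * (1 + c * F))
      + (1 - x) / 2 * (F - 1 + c - a * (1 + c * E)) * (F - 1 + c - b * (1 + c * E))
      + (1 - x\<^sup>2) * (- (A1 + 2 * A3 + 2 * c * A2) + (a + b) * (A2 + c * A4 + c^2 * B2 - c * B3)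
        - a * b * (2 * c * B2 + c^2 * B1))"
    "Re (exp z) = ((1 + x) * E + (1 - x) * F) / 2 - (1 - x\<^sup>2) * A2"
    "Re (exp z * cnj z) = ((1 + x) * E - (1 - x) * F) / 2 - (1 - x\<^sup>2) * A3"
    "Re (exp (- z) * cnj z) = ((1 + x) * F - (1 - x) * E) / 2 + (1 - x\<^sup>2) * B3"
proof -
  obtain A1 A2 A3 A4 B1 B2 B3 where C: "circle_coeffs x A1 A2 A3 A4 B1 B2 B3 E F" and
    e: "exp (2 * x) = ((1 + x) * E^2 + (1 - x) * F^2) / 2 - (1 - x\<^sup>2) * A1"
    "exp (- 2 * x) = ((1 - x) * E^2 + (1 + x) * F^2) / 2 - (1 - x\<^sup>2) * B1"
    "Re (exp z) = ((1 + x) * E + (1 - x) * F) / 2 - (1 - x\<^sup>2) * A2"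
    "Re (exp (- z)) = ((1 - x) * E + (1 + x) * F) / 2 - (1 - x\<^sup>2) * B2"
    "Re (exp z * cnj z) = ((1 + x) * E - (1 - x) * F) / 2 - (1 - x\<^sup>2) * A3"
    "Re (exp (- z) * cnj z) = ((1 + x) * F - (1 - x) * E) / 2 + (1 - x\<^sup>2) * B3"
    "cos (2 * Im z) = 1 - (1 - x\<^sup>2) * A4"
    unfolding x_def E_def F_def by (rule circle_coeffs_exist[OF z])
  interpret circle_coeffs x A1 A2 A3 A4 B1 B2 B3 E F by fact
  have "Re (p a * cnj (p b))
      = (1 + x) / 2 * (E + 1 + c - a * (1 + c * F)) * (E + 1 + c - b * (1 + c * F))
      + (1 - x) / 2 * (F - 1 + c - a * (1 + c * E)) * (F - 1 + c - b * (1 + c * E))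
      + (1 - x\<^sup>2) * (- (A1 + 2 * A3 + 2 * c * A2) + (a + b) * (A2 + c * A4 + c^2 * B2 - c * B3)
        - a * b * (2 * c * B2 + c^2 * B1))" for a b
  proof -
    \<comment> \<open>With the interpolation weights as separate variables the claim becomes a
      polynomial identity modulo E F = 1 and \<epsilon> + \<delta> = 1.\<close>
    define \<epsilon> \<delta> where "\<epsilon> = (1 + x) / 2" and "\<delta> = (1 - x) / 2"
    have x: "x = \<epsilon> - \<delta>" "\<epsilon> + \<delta> = 1" by (simp_all add: \<epsilon>_def \<delta>_def field_simps)
    have e': "exp (2 * x) = \<epsilon> * E^2 + \<delta> * F^2 - (1 - x\<^sup>2) * A1"
      "exp (- 2 * x) = \<delta> * E^2 + \<epsilon> * F^2 - (1 - x\<^sup>2) * B1"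
      "Re (exp z) = \<epsilon> * E + \<delta> * F - (1 - x\<^sup>2) * A2"
      "Re (exp (- z)) = \<delta> * E + \<epsilon> * F - (1 - x\<^sup>2) * B2"
      "Re (exp z * cnj z) = \<epsilon> * E - \<delta> * F - (1 - x\<^sup>2) * A3"
      "Re (exp (- z) * cnj z) = \<epsilon> * F - \<delta> * E + (1 - x\<^sup>2) * B3"
      unfolding e by (simp_all add: \<epsilon>_def \<delta>_def field_simps)
    show ?thesis
      unfolding p_def Re_mult_cnj_affine[OF z, folded x_def] e' e(7) \<epsilon>_def[symmetric] \<delta>_def[symmetric]
      using EF x by algebra
  qed
  then show ?thesis by (intro that[OF C _ e(3) e(5) e(6)])
qed

lemma linear_nonneg:
  fixes p q s :: real
  assumes "0 \<le> p - s0 * q" "0 \<le> p - s1 * q" "s0 \<le> s" "s \<le> s1"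
  shows "0 \<le> p - s * q"
proof (cases "0 \<le> q")
  case True
  then have "s * q \<le> s1 * q" using assms by (intro mult_right_mono)
  then show ?thesis using assms by simp
next
  case False
  then have "s * q \<le> s0 * q" using assms by (intro mult_right_mono_neg) auto
  then show ?thesis using assms by simp
qed

lemma exp_neg_1: "exp (- 1 :: real) = 1 / exp 1"
  by (simp add: exp_minus field_simps)

text \<open>\<open>b\<close> is the value of h at z = 1 for m = 1, so \<open>p b\<close> vanishes
  there; for c \<ge> 1/5 the same is true of \<open>a\<close> at z = -1. The passage to general m
  adds a nonnegative multiple of m - 1 and (m - 1)^2.\<close>

lemma boundary_affine:
  fixes z :: complex and a b c m :: real
  assumes z: "norm z = 1" and m: "1 \<le> m" and c: "- 1/2 \<le> c" and Rez: "0 \<le> Re (exp z) + c"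
  defines "E \<equiv> exp (1::real)"
  assumes b: "b = E + E / (E + c)" and a: "a = (if c \<ge> 1/5 then 1 / E - 1 / (1 + c * E) else 0)"
  defines "p \<equiv> \<lambda>t. exp z + of_real m * z + of_real c - of_real t * (1 + of_real c * exp (- z))"
  shows "0 \<le> Re (p a * cnj (p b))"
proof -
  define x where "x = Re z"
  define F where "F = exp (- 1::real)"
  define p1 where "p1 = (\<lambda>t. exp z + z + of_real c - of_real t * (1 + of_real c * exp (- z)))"
  obtain A1 A2 A3 A4 B1 B2 B3 where "circle_coeffs x A1 A2 A3 A4 B1 B2 B3 E F"
    and V: "\<And>a b. Re (p1 a * cnj (p1 b))
      = (1 + x) / 2 * (E + 1 + c - a * (1 + c * F)) * (E + 1 + c - b * (1 + c * F))
      + (1 - x) / 2 * (F - 1 + c - a * (1 + c * E)) * (F - 1 + c - b * (1 + c * E))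
      + (1 - x\<^sup>2) * (- (A1 + 2 * A3 + 2 * c * A2) + (a + b) * (A2 + c * A4 + c^2 * B2 - c * B3)
        - a * b * (2 * c * B2 + c^2 * B1))"
    and e: "Re (exp z) = ((1 + x) * E + (1 - x) * F) / 2 - (1 - x\<^sup>2) * A2"
    "Re (exp z * cnj z) = ((1 + x) * E - (1 - x) * F) / 2 - (1 - x\<^sup>2) * A3"
    "Re (exp (- z) * cnj z) = ((1 + x) * F - (1 - x) * E) / 2 + (1 - x\<^sup>2) * B3"
    using affine_expansion[OF z, of c] unfolding x_def E_def F_def p1_def by metis
  then interpret circle_coeffs x A1 A2 A3 A4 B1 B2 B3 E F by simp
  have F1: "F = 1 / E" by (simp add: E_def F_def exp_neg_1)
  have Ec: "0 < E + c" using E c by simp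
  have bE: "b * (E + c) = E * (E + c + 1)" using Ec by (simp add: b field_simps)
  have "(E + 1 + c - b * (1 + c * F)) * (E + c) = 0" using bE EF by algebra
  then have q1: "E + 1 + c - b * (1 + c * F) = 0" using Ec by simp
  have V1: "0 \<le> Re (p1 a * cnj (p1 b))"
  proof (cases "c \<ge> 1/5")
    case True
    have cE: "0 < 1 + c * E" using E True by (simp add: add_pos_nonneg)
    have aE: "a * (1 + c * E) = F * (1 + c * E) - 1" using True cE by (simp add: a F1 left_diff_distrib)
    then have p2: "F - 1 + c - a * (1 + c * E) = 0" using EF by algebra
    define D where "D = E * (1 + c * E) * (E + c)"
    have D: "0 < D" using E cE Ec by (simp add: D_def)
    define W where "W = - (A1 + 2 * A3 + 2 * c * A2) + (a + b) * (A2 + c * A4 + c^2 * B2 - c * B3)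
        - a * b * (2 * c * B2 + c^2 * B1)"
    have aE': "E * (a * (1 + c * E)) = 1 + c * E - E" using aE EF by algebra
    have "D * W = - (E * (1 + c * E) * (E + c)) * (A1 + 2 * A3 + 2 * c * A2)
      + ((1 + c * E - E) * (E + c) + E^2 * (E + c + 1) * (1 + c * E)) * (A2 + c * A4 + c^2 * B2 - c * B3)
      - E * (1 + c * E - E) * (E + c + 1) * (2 * c * B2 + c^2 * B1)"
    proof -
      have "D * (a + b) = (1 + c * E - E) * (E + c) + E^2 * (E + c + 1) * (1 + c * E)"
        unfolding D_def using aE' bE by algebra
      moreover have "D * (a * b) = E * (1 + c * E - E) * (E + c + 1)"
        unfolding D_def using aE' bE by algebra
      ultimately show ?thesis unfolding W_def D_def[symmetric] by algebra
    qed
    also have "0 \<le> \<dots>" using True by (rule remainder_nonneg_large)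
    finally have "0 \<le> W" using D by (simp add: zero_le_mult_iff)
    then show ?thesis unfolding V q1 p2 W_def[symmetric] using x_sq by simp
  next
    case False
    then have a0: "a = 0" by (simp add: a)
    define W where "W = - (E + c) * (A1 + 2 * A3 + 2 * c * A2) + E * (E + c + 1) * (A2 + c * A4 + c^2 * B2 - c * B3)"
    define l where "l = (F - 1 + c) * ((E + c) * (F - 1 + c) - E * (E + c + 1) * (1 + c * E)) / 2"
    then have l2: "l = 1/2 * ((F - 1 + c) * ((E + c) * (F - 1 + c) - E * (E + c + 1) * (1 + c * E)))" by simp
    have "0 \<le> l + (1 + x) * W + 2 * (1 - x)^2 * (1 + x) * A2 - (1 - x) * ((1 + x) * E + (1 - x) * F + 2 * c)"
      using remainder_nonneg_small[of c] c False unfolding W_def l2 by simp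
    moreover have "2 * (1 - x) * (Re (exp z) + c)
        = (1 - x) * ((1 + x) * E + (1 - x) * F + 2 * c) - 2 * (1 - x)^2 * (1 + x) * A2"
      unfolding e by (simp add: field_simps power2_eq_square)
    moreover have "0 \<le> 2 * (1 - x) * (Re (exp z) + c)"
      using Rez x_bounds by (intro mult_nonneg_nonneg) auto
    ultimately have lW: "0 \<le> l + (1 + x) * W" by linarith
    have "(E + c) * Re (p1 a * cnj (p1 b)) = (1 - x) * (l + (1 + x) * W)"
    proof -
      have "(E + c) * (F - 1 + c - b * (1 + c * E)) = (E + c) * (F - 1 + c) - E * (E + c + 1) * (1 + c * E)"
        using bE by algebra
      then have 1: "(E + c) * ((1 - x) / 2 * (F - 1 + c) * (F - 1 + c - b * (1 + c * E))) = (1 - x) * l"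
        unfolding l_def by (simp add: field_simps)
      have 2: "(E + c) * (- (A1 + 2 * A3 + 2 * c * A2) + b * (A2 + c * A4 + c^2 * B2 - c * B3)) = W"
        unfolding W_def using bE by algebra
      have "(E + c) * Re (p1 a * cnj (p1 b))
          = (E + c) * ((1 - x) / 2 * (F - 1 + c) * (F - 1 + c - b * (1 + c * E)))
            + (1 - x\<^sup>2) * ((E + c) * (- (A1 + 2 * A3 + 2 * c * A2) + b * (A2 + c * A4 + c^2 * B2 - c * B3)))"
        unfolding V q1 a0 by (simp add: algebra_simps)
      then show ?thesis unfolding 1 2 by (simp add: algebra_simps power2_eq_square)
    qed
    also have "0 \<le> \<dots>" using lW x_bounds by (intro mult_nonneg_nonneg) auto
    finally show ?thesis using Ec by (simp add: zero_le_mult_iff)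
  qed
  define s where "s = (a + b) / 2"
  \<comment> \<open>For c \<ge> 1/5, s = (e + 1/e + d) / 2 with d in [0, 1]; for smaller c, s = (e +
    e / (e + c)) / 2, whose second summand before halving lies in [9/10, 5/4].\<close>
  have s: "3/2 \<le> s \<and> s \<le> 41/20"
  proof (cases "c \<ge> 1/5")
    case True
    have cE: "0 < 1 + c * E" using E True by (simp add: add_pos_nonneg)
    have "E / (E + c) - 1 / (1 + c * E) = c * (E\<^sup>2 - 1) / ((E + c) * (1 + c * E))"
      using Ec cE by (simp add: field_simps power2_eq_square)
    moreover have "0 \<le> c * (E\<^sup>2 - 1) / ((E + c) * (1 + c * E))"
      using True E_power_bounds(1) Ec cE by (intro divide_nonneg_pos mult_nonneg_nonneg mult_pos_pos) auto
    ultimately have 1: "1 / (1 + c * E) \<le> E / (E + c)" by simp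
    have 2: "E / (E + c) \<le> 1" "0 \<le> 1 / (1 + c * E)" using Ec True cE by (auto simp: field_simps)
    define d where "d = E / (E + c) - 1 / (1 + c * E)"
    have "0 \<le> d" using 1 by (simp add: d_def)
    moreover have "d \<le> 1" using diff_mono[OF 2] by (simp only: d_def diff_0_right)
    moreover have "s = (E + F + d) / 2" using True by (simp add: s_def a b F1 d_def)
    ultimately show ?thesis using E F_bounds(1,2) by simp
  next
    case False
    then have s2: "s = (E + E / (E + c)) / 2" by (simp add: s_def a b)
    have "9/10 \<le> E / (E + c)" "E / (E + c) \<le> 5/4"
      using Ec False c E by (auto simp: field_simps)
    then show ?thesis using E unfolding s2 by simp
  qed
  have "0 \<le> Re (cnj z * (p1 a + p1 b))"
  proof -
    define \<phi> \<psi> where "\<phi> = ((1 + x) * E - (1 - x) * F) / 2 - (1 - x\<^sup>2) * A3"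
      and "\<psi> = ((1 + x) * F - (1 - x) * E) / 2 + (1 - x\<^sup>2) * B3"
    have "0 \<le> x - s * \<psi>"
      using slope_nonneg_lower slope_nonneg_upper conjunct1[OF s] conjunct2[OF s]
      unfolding \<psi>_def[symmetric] by (rule linear_nonneg)
    then have "0 \<le> (c + 1/2) * (x - s * \<psi>)" using c by (intro mult_nonneg_nonneg) auto
    moreover have "0 \<le> (1 + \<phi> - x / 2) - s * (x - \<psi> / 2)"
      using intercept_nonneg_lower intercept_nonneg_upper conjunct1[OF s] conjunct2[OF s]
      unfolding \<psi>_def[symmetric] \<phi>_def[symmetric] by (rule linear_nonneg)
    moreover have "Re (cnj z * (p1 a + p1 b)) = 2 * ((c + 1/2) * (x - s * \<psi>) + ((1 + \<phi> - x / 2) - s * (x - \<psi> / 2)))"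
    proof -
      have "Re (cnj z * (p1 a + p1 b))
          = 2 * (Re (exp z * cnj z) + Re (z * cnj z) + c * x) - (a + b) * (x + c * Re (exp (- z) * cnj z))"
        by (simp add: p1_def x_def algebra_simps)
      moreover have "Re (z * cnj z) = 1" using z complex_norm_square[of z] by simp
      ultimately show ?thesis
        unfolding e \<phi>_def[symmetric] \<psi>_def[symmetric] s_def by (simp add: field_simps)
    qed
    ultimately show ?thesis by simp
  qed
  then have "0 \<le> (m - 1) * Re (cnj z * (p1 a + p1 b))" using m by simp
  moreover have "Re (p a * cnj (p b)) = Re (p1 a * cnj (p1 b)) + (m - 1) * Re (cnj z * (p1 a + p1 b)) + (m - 1)^2"
  proof -
    have p: "p t = p1 t + of_real (m - 1) * z" for t by (simp add: p_def p1_def algebra_simps)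
    have "Re ((u + of_real n * z) * cnj (v + of_real n * z))
        = Re (u * cnj v) + n * Re (cnj z * (u + v)) + n^2 * (Re z * Re z + Im z * Im z)" for u v and n :: real
      by (simp add: algebra_simps power2_eq_square)
    moreover have "Re z * Re z + Im z * Im z = 1" using unit_square[OF z] by (simp add: power2_eq_square)
    ultimately show ?thesis unfolding p by simp
  qed
  ultimately show ?thesis using V1 by simp
qed

text \<open>
  The hypothesis \<open>0 \<le> Re (exp z) + c\<close> cannot be dropped: with \<open>c = -0.4715\<close>, \<open>a = 0\<close>, \<open>m = 1\<close> and \<open>b\<close> the
  smaller one of the two values of \<open>h\<close> at \<open>z = 1\<close>, \<open>z = -1\<close>, the conclusion fails for \<open>z\<close> near \<open>-1\<close>.
\<close>

lemma boundary_starlike: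
  fixes z h :: complex and a b c m :: real
  assumes z: "norm z = 1" and m: "1 \<le> m" and c: "- 1/2 \<le> c" and Rez: "0 \<le> Re (exp z) + c"
    and nz: "exp z + of_real c \<noteq> 0" and ab: "0 \<le> a" "a \<le> b" "b \<le> exp 1 + exp 1 / (exp 1 + c)"
    and a: "- exp (- 1) < c \<Longrightarrow> 1 / exp 1 - 1 / (1 + c * exp 1) \<le> a"
    and h: "h = exp z + of_real m * z * exp z / (exp z + of_real c)"
  shows "0 \<le> (Re h - a) * (Re h - b) + (Im h)\<^sup>2"
proof -
  define a' b' :: real where "a' = (if c \<ge> 1/5 then 1 / exp 1 - 1 / (1 + c * exp 1) else 0)"
    and "b' = exp 1 + exp 1 / (exp 1 + c)"
  define p where "p = (\<lambda>t. exp z + of_real m * z + of_real c - of_real t * (1 + of_real c * exp (- z)))"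
  \<comment> \<open>The common factor of all differences h - t, which enters the final sign only
    through its squared modulus.\<close>
  define g where "g = exp z / (exp z + of_real c)"
  have h': "h - of_real t = g * p t" for t
    using nz unfolding h g_def p_def by (simp add: field_simps flip: exp_add)
  have "Re ((h - of_real a') * cnj (h - of_real b')) = Re (g * cnj g * (p a' * cnj (p b')))"
    unfolding h' by (simp add: mult_ac)
  also have "\<dots> = (cmod g)\<^sup>2 * Re (p a' * cnj (p b'))"
    unfolding complex_norm_square[symmetric] by simp
  also have "0 \<le> \<dots>"
    using boundary_affine[OF z m c Rez b'_def a'_def] unfolding p_def by simp
  finally have "0 \<le> (Re h - a') * (Re h - b') + (Im h)\<^sup>2" unfolding outside_disc_iff .
  moreover have "a' \<le> a"
    using ab a less_trans[of "- exp (- 1)" 0 c] by (auto simp: a'_def)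
  ultimately show ?thesis
    using ab unfolding b'_def by (intro outside_disc_mono[of a' a b])
qed

section \<open>First exit points\<close>

lemma norm_one_plus_le: "norm (1 + of_real d * v :: complex) \<le> 1 + d * Re v + d\<^sup>2 * (norm v)\<^sup>2 / 2"
proof -
  have "(norm (1 + of_real d * v))\<^sup>2 = 1 + 2 * (d * Re v) + d\<^sup>2 * (norm v)\<^sup>2"
    unfolding cmod_power2 by (simp add: power2_eq_square algebra_simps)
  moreover have "2 * norm (1 + of_real d * v) \<le> 1 + (norm (1 + of_real d * v))\<^sup>2"
    using zero_le_power2[of "norm (1 + of_real d * v) - 1"] by (simp add: power2_eq_square algebra_simps)
  ultimately show ?thesis by simp
qed

text \<open>For Re v < 0 the point 1 + d v lies in the disc for small d > 0, and Re g(1 + d v) \<le>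
  |1 + d v| \<le> 1 + d Re v + O(d^2) gives Re (D v) \<le> Re v. The direction v = -1 yields Re D
  \<ge> 1.\<close>

lemma derivative_at_boundary_fixpoint:
  assumes D: "(g has_field_derivative D) (at 1)" and g1: "g 1 = 1"
    and le: "\<And>z. norm z < 1 \<Longrightarrow> norm (g z) \<le> norm z"
  shows "Im D = 0" "1 \<le> Re D"
proof -
  have main: "Re (D * v) \<le> Re v" if v: "Re v < 0" for v
  proof -
    have "((\<lambda>d. 1 + of_real d * v) has_vector_derivative v) (at 0)"
      by (auto intro!: derivative_eq_intros)
    moreover have "(g has_field_derivative D) (at (1 + of_real 0 * v))" using D by simp
    ultimately have "((g \<circ> (\<lambda>d. 1 + of_real d * v)) has_vector_derivative v * D) (at 0)"
      by (rule field_vector_diff_chain_at)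
    then have "((\<lambda>d. Re (g (1 + of_real d * v))) has_real_derivative Re (v * D)) (at 0)"
      unfolding o_def has_real_derivative_iff_has_vector_derivative
      by (rule bounded_linear.has_vector_derivative[OF bounded_linear_Re])
    then have 1: "((\<lambda>d. (Re (g (1 + of_real d * v)) - 1) / d) \<longlongrightarrow> Re (v * D)) (at_right 0)"
      unfolding has_field_derivative_iff using g1 by (auto intro: filterlim_mono[OF _ _ at_le])
    have 2: "((\<lambda>d. Re v + d * (norm v)\<^sup>2 / 2) \<longlongrightarrow> Re v + 0 * (norm v)\<^sup>2 / 2) (at_right 0)"
      by (intro tendsto_intros) simp
    have v0: "v \<noteq> 0" using v by auto
    then have pos: "0 < - 2 * Re v / (norm v)\<^sup>2" using v by (intro divide_pos_pos) auto
    have "eventually (\<lambda>d. 0 < d \<and> d < - 2 * Re v / (norm v)\<^sup>2) (at_right 0)"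
      using eventually_at_right_real[OF pos] by (rule eventually_mono) auto
    then have "eventually (\<lambda>d. (Re (g (1 + of_real d * v)) - 1) / d \<le> Re v + d * (norm v)\<^sup>2 / 2) (at_right 0)"
    proof eventually_elim
      case (elim d)
      have "d * (norm v)\<^sup>2 < - 2 * Re v" using elim v0 by (simp add: field_simps)
      then have "d * Re v + d\<^sup>2 * (norm v)\<^sup>2 / 2 < 0"
        using mult_strict_left_mono[of "d * (norm v)\<^sup>2" "- 2 * Re v" d] elim by (simp add: power2_eq_square)
      then have "norm (1 + of_real d * v) < 1" using norm_one_plus_le[of d v] by linarith
      then have "Re (g (1 + of_real d * v)) \<le> norm (1 + of_real d * v)"
        using le complex_Re_le_cmod order_trans by blast
      also have "\<dots> \<le> 1 + d * Re v + d\<^sup>2 * (norm v)\<^sup>2 / 2" by (rule norm_one_plus_le)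
      finally show ?case using elim by (simp add: field_simps power2_eq_square)
    qed
    then show ?thesis using tendsto_le[OF _ 2 1] by (simp add: mult.commute)
  qed
  show 1: "1 \<le> Re D" using main[of "- 1"] by simp
  show "Im D = 0"
  proof (rule ccontr)
    assume "Im D \<noteq> 0"
    \<comment> \<open>In this direction Re (D v) = 0 while Re v = -1.\<close>
    then show False using main[of "Complex (- 1) (- Re D / Im D)"] by simp
  qed
qed

text \<open>Rescaling by z0 and rotating by w(z0) produces a self-map g of the unit disc with g 0 =
  0 and g 1 = 1. The Schwarz lemma supplies |g z| \<le> |z|, and \<open>m\<close> is the derivative
  of g at 1.\<close>

lemma jack:
  assumes w: "w holomorphic_on ball 0 r" "w 0 = 0" "w ` ball 0 r \<subseteq> ball 0 1"
    and z0: "norm z0 = r" "0 < r" and w': "(w has_field_derivative w') (at z0)" and wz0: "norm (w z0) = 1"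
  obtains m where "1 \<le> m" "z0 * w' = of_real m * w z0"
proof -
  define g where "g = (\<lambda>z. w (z0 * z) * cnj (w z0))"
  have ww: "w z0 * cnj (w z0) = 1" using wz0 complex_norm_square[of "w z0"] by simp
  have in_ball: "z0 * z \<in> ball 0 r" if "norm z < 1" for z
    using that z0 by (simp add: norm_mult)
  have "(\<lambda>z. z0 * z) ` ball 0 1 \<subseteq> ball 0 r" using in_ball by auto
  then have "(\<lambda>z. w (z0 * z)) holomorphic_on ball 0 1"
    using holomorphic_on_compose_gen[of "\<lambda>z. z0 * z" "ball 0 1" w "ball 0 r"] w(1)
    by (simp add: o_def holomorphic_intros)
  then have "g holomorphic_on ball 0 1" unfolding g_def by (intro holomorphic_intros)
  moreover have "norm (g z) < 1" if "norm z < 1" for z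
  proof -
    have "w (z0 * z) \<in> ball 0 1" using w(3) in_ball[OF that] by blast
    then show ?thesis by (simp add: g_def norm_mult wz0)
  qed
  ultimately have le: "norm (g z) \<le> norm z" if "norm z < 1" for z
    using Schwarz_Lemma(1)[of g z] w(2) that by (simp add: g_def)
  have "(w has_field_derivative w') (at (z0 * 1))" using w' by simp
  then have "((\<lambda>z. w (z0 * z)) has_field_derivative w' * z0) (at 1)"
    by (rule DERIV_chain2) (auto intro!: derivative_eq_intros)
  then have D: "(g has_field_derivative (w' * z0) * cnj (w z0)) (at 1)"
    unfolding g_def by (rule DERIV_cmult_right)
  define D where "D = (w' * z0) * cnj (w z0)"
  have "Im D = 0" "1 \<le> Re D"
    using derivative_at_boundary_fixpoint[OF D[folded D_def] _ le] ww by (simp_all add: g_def)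
  moreover have "D * w z0 = z0 * w'"
    using ww by (simp add: D_def mult_ac)
  moreover have "D = of_real (Re D)" using \<open>Im D = 0\<close> by (simp add: complex_eq_iff)
  ultimately show ?thesis using that by metis
qed

lemma Ln_exp_cball:
  assumes "norm \<zeta> \<le> 1"
  shows "Ln (exp \<zeta>) = \<zeta>" "exp \<zeta> \<notin> \<real>\<^sub>\<le>\<^sub>0"
proof -
  have im: "\<bar>Im \<zeta>\<bar> < pi" using abs_Im_le_cmod[of \<zeta>] assms pi_gt3 by linarith
  then show Ln: "Ln (exp \<zeta>) = \<zeta>" by (intro Ln_exp) auto
  show "exp \<zeta> \<notin> \<real>\<^sub>\<le>\<^sub>0"
  proof
    assume "exp \<zeta> \<in> \<real>\<^sub>\<le>\<^sub>0"
    then have "Re (exp \<zeta>) < 0" "Im (exp \<zeta>) = 0"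
      using exp_not_eq_zero[of \<zeta>] by (auto simp: complex_nonpos_Reals_iff complex_eq_iff less_le)
    then have "Im (Ln (exp \<zeta>)) = pi" by (simp add: Im_Ln_eq_pi)
    then show False using Ln im by simp
  qed
qed

lemma exp_disk_Ln:
  assumes "v \<in> exp ` ball (0 :: complex) 1"
  shows "v \<notin> \<real>\<^sub>\<le>\<^sub>0" "norm (Ln v) < 1" "exp (Ln v) = v" "v \<noteq> 0"
  using assms Ln_exp_cball by (auto simp: less_imp_le)

lemma open_exp_disk: "open (exp ` ball (0 :: complex) 1)"
proof (rule open_mapping_thm3)
  have "inj_on exp (ball (0 :: complex) 1)"
    by (rule inj_on_inverseI[of _ Ln]) (simp add: Ln_exp_cball)
  then show "inj_on exp (ball (0 :: complex) 1)" .
qed (auto intro: holomorphic_intros)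

text \<open>As a limit of values in exp of the open disc, \<open>p z0\<close> lies in exp of the
  closed disc; not being in the open image, it has a logarithm of modulus 1. Jack's lemma is applied
  to \<open>Ln (p z)\<close>, which is holomorphic because |Im \<zeta>| \<le> 1 < pi keeps exp of
  the disc away from the branch cut.\<close>

lemma exp_disk_exit:
  assumes p: "p holomorphic_on ball 0 r" "p 0 = 1" "p ` ball 0 r \<subseteq> exp ` ball 0 1"
    and z0: "norm z0 = r" "0 < r" and p': "(p has_field_derivative p') (at z0)" and pz0: "p z0 \<notin> exp ` ball 0 1"
  obtains m \<zeta> where "norm \<zeta> = 1" "1 \<le> m" "p z0 = exp \<zeta>" "z0 * p' = of_real m * \<zeta> * exp \<zeta>"
proof -
  have "(p \<longlongrightarrow> p z0) (at z0 within ball 0 r)"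
    using DERIV_isCont[OF p'] continuous_within continuous_at_imp_continuous_at_within by blast
  moreover have "at z0 within ball 0 r \<noteq> bot"
    using z0 by (simp add: trivial_limit_within islimpt_ball)
  moreover have "closed (exp ` cball (0 :: complex) 1)"
    by (intro compact_imp_closed compact_continuous_image continuous_intros) auto
  moreover have "\<forall>\<^sub>F z in at z0 within ball 0 r. p z \<in> exp ` cball 0 1"
    unfolding eventually_at_filter using p(3) by (intro always_eventually) force
  ultimately have "p z0 \<in> exp ` cball 0 1" by (metis Lim_in_closed_set)
  then obtain \<zeta> where \<zeta>: "p z0 = exp \<zeta>" "norm \<zeta> \<le> 1" by auto
  then have \<zeta>1: "norm \<zeta> = 1" using pz0 by (force simp: less_le)
  have Ln: "Ln (p z0) = \<zeta>" "p z0 \<notin> \<real>\<^sub>\<le>\<^sub>0"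
    unfolding \<zeta>(1) using Ln_exp_cball \<zeta>(2) by auto
  then have w': "((\<lambda>z. Ln (p z)) has_field_derivative p' / p z0) (at z0)"
    using p' by (auto intro!: derivative_eq_intros simp: divide_inverse mult.commute)
  have "(\<lambda>z. Ln (p z)) holomorphic_on ball 0 r"
    by (intro holomorphic_intros p(1)) (use p(3) exp_disk_Ln(1) in blast)
  moreover have "(\<lambda>z. Ln (p z)) ` ball 0 r \<subseteq> ball 0 1"
    using p(3) exp_disk_Ln(2) by auto
  ultimately obtain m where "1 \<le> m" "z0 * (p' / p z0) = of_real m * Ln (p z0)"
    using jack[OF _ _ _ z0 w'] p(2) Ln \<zeta>1 by auto
  then show ?thesis using that[OF \<zeta>1, of m] \<zeta>(1) Ln by (simp add: field_simps)
qed

text \<open>\<open>w\<close> is the Cayley map of the half plane Re > \<kappa> onto the disc that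
  sends \<open>u0\<close> to 0; \<kappa> - d is the mirror image of \<open>u0\<close> in the
  boundary line. Jack's lemma for w makes \<open>z0 * u'\<close> equal to -m (d^2 + (Im (u z0))^2) /
  (2 d).\<close>

lemma half_plane_exit:
  fixes \<kappa> u0 :: real
  assumes u: "u holomorphic_on ball 0 r" "u 0 = of_real u0" "\<And>z. z \<in> ball 0 r \<Longrightarrow> \<kappa> < Re (u z)"
    and z0: "norm z0 = r" "0 < r" and u': "(u has_field_derivative u') (at z0)" and uz0: "Re (u z0) = \<kappa>"
  obtains n where "((u0 - \<kappa>)\<^sup>2 + (Im (u z0))\<^sup>2) / (2 * (u0 - \<kappa>)) \<le> n" "z0 * u' = - of_real n"
proof -
  define d where "d = u0 - \<kappa>"
  have d: "0 < d" using u(3)[of 0] z0 by (simp add: u(2) d_def)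
  define w where "w = (\<lambda>z. (u z - of_real u0) / (u z + of_real (d - \<kappa>)))"
  have den: "u z + of_real (d - \<kappa>) \<noteq> 0" if "\<kappa> \<le> Re (u z)" for z
    using that d by (auto simp: complex_eq_iff)
  have hol: "w holomorphic_on ball 0 r"
    unfolding w_def using u(1,3) den by (intro holomorphic_intros) (auto simp: less_imp_le)
  have lt: "norm (w z) < 1" if "z \<in> ball 0 r" for z
  proof -
    have "\<kappa> < Re (u z)" using u(3) that .
    then have "(Re (u z) - u0)\<^sup>2 < (Re (u z) + (d - \<kappa>))\<^sup>2"
      using mult_pos_pos[of "Re (u z) - \<kappa>" d] d by (simp add: d_def power2_eq_square algebra_simps)
    then have "(norm (u z - of_real u0))\<^sup>2 < (norm (u z + of_real (d - \<kappa>)))\<^sup>2"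
      by (simp add: cmod_power2)
    then have "norm (u z - of_real u0) < norm (u z + of_real (d - \<kappa>))"
      by (rule power_less_imp_less_base) simp
    then show ?thesis by (auto simp: w_def norm_divide divide_less_eq)
  qed
  have w1: "norm (w z0) = 1"
  proof -
    have "u z0 - of_real u0 = - cnj (u z0 + of_real (d - \<kappa>))"
      using uz0 by (simp add: complex_eq_iff d_def)
    then have "norm (u z0 - of_real u0) = norm (u z0 + of_real (d - \<kappa>))"
      by (metis complex_mod_cnj norm_minus_cancel)
    then show ?thesis using den[of z0] uz0 by (simp add: w_def norm_divide)
  qed
  define N where "N = u z0 + of_real (d - \<kappa>)"
  have N0: "N \<noteq> 0" using den[of z0] uz0 by (simp add: N_def)
  have w': "(w has_field_derivative (u' * of_real (2 * d)) / N\<^sup>2) (at z0)"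
    unfolding w_def using u' N0
    by (auto intro!: derivative_eq_intros simp: N_def d_def power2_eq_square field_simps)
  have "w 0 = 0" "w ` ball 0 r \<subseteq> ball 0 1" using u(2) lt by (auto simp: w_def)
  then obtain m where m: "1 \<le> m" "z0 * ((u' * of_real (2 * d)) / N\<^sup>2) = of_real m * w z0"
    using jack[OF hol _ _ z0 w' w1] by blast
  have "u z0 - of_real u0 = - cnj N" using uz0 by (simp add: N_def complex_eq_iff d_def)
  then have wN: "w z0 = - cnj N / N" by (simp add: w_def N_def)
  have "z0 * u' * of_real (2 * d) = of_real m * w z0 * N\<^sup>2" using m(2) N0 by (simp add: field_simps)
  also have "\<dots> = - of_real m * (N * cnj N)" unfolding wN using N0 by (simp add: power2_eq_square)
  also have "N * cnj N = of_real (d\<^sup>2 + (Im (u z0))\<^sup>2)"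
  proof -
    have "Re N = d" "Im N = Im (u z0)" using uz0 by (simp_all add: N_def)
    then show ?thesis by (simp only: complex_mult_cnj)
  qed
  finally have "z0 * u' = - of_real (m * (d\<^sup>2 + (Im (u z0))\<^sup>2) / (2 * d))"
    using d by (simp add: field_simps)
  moreover have "(d\<^sup>2 + (Im (u z0))\<^sup>2) / (2 * d) \<le> m * (d\<^sup>2 + (Im (u z0))\<^sup>2) / (2 * d)"
    using mult_right_mono[OF m(1), of "d\<^sup>2 + (Im (u z0))\<^sup>2"] d by (intro divide_right_mono) auto
  ultimately show ?thesis using that d_def by metis
qed

text \<open>The points of failure in the closed disc of radius |z1| form a compact set, and
  \<open>z0\<close> is one nearest to the origin.\<close>

lemma first_exit:
  fixes P :: "complex \<Rightarrow> bool"
  assumes "open {z \<in> ball 0 1. P z}" "P 0" "z1 \<in> ball 0 1" "\<not> P z1"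
  obtains z0 where "norm z0 < 1" "z0 \<noteq> 0" "\<not> P z0" "\<And>z :: complex. norm z < norm z0 \<Longrightarrow> P z"
proof -
  let ?K = "cball 0 (norm z1) - {z \<in> ball 0 1. P z}"
  have "compact ?K" using assms(1) by (intro compact_diff) auto
  moreover have "z1 \<in> ?K" using assms by auto
  ultimately obtain z0 where z0: "z0 \<in> ?K" "\<And>z. z \<in> ?K \<Longrightarrow> norm z0 \<le> norm z"
    using continuous_attains_inf[of ?K norm] continuous_on_norm_id by blast
  show ?thesis
  proof (rule that)
    show "norm z0 < 1" using z0(1) assms(3) by auto
    then show "\<not> P z0" using z0(1) by auto
    then show "z0 \<noteq> 0" using assms(2) by metis
    fix z :: complex assume "norm z < norm z0"
    show "P z"
    proof (rule ccontr)
      assume "\<not> P z"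
      then have "z \<in> ?K" using z0(1) \<open>norm z < norm z0\<close> by auto
      then show False using z0(2)[of z] \<open>norm z < norm z0\<close> by simp
    qed
  qed
qed

section \<open>Subordination, the Janowski disc and the differential equation\<close>

lemma exp_disk_subordinate:
  assumes p: "p holomorphic_on unit_disk" "p 0 = 1" "p ` unit_disk \<subseteq> exp ` ball 0 1"
  shows "p \<prec>\<^sub>D exp"
  unfolding subordinate_def
proof (intro conjI exI)
  show "(\<lambda>z. Ln (p z)) holomorphic_on unit_disk"
    by (intro holomorphic_intros p(1)) (use p(3) exp_disk_Ln(1) in blast)
  have "norm (Ln (p z)) < 1 \<and> exp (Ln (p z)) = p z" if "z \<in> unit_disk" for z
  proof -
    have "p z \<in> exp ` ball 0 1" using p(3) that by blast
    then show ?thesis using exp_disk_Ln(2,3) by blast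
  qed
  then show "(\<lambda>z. Ln (p z)) ` unit_disk \<subseteq> unit_disk" "\<forall>z\<in>unit_disk. p z = exp (Ln (p z))"
    by auto
  show "Ln (p 0) = 0" by (simp add: p(2))
qed (use p(1) in \<open>auto intro: holomorphic_intros\<close>)

text \<open>The differences from the two ends share the factor (A - B) / (1 + B \<omega>), and the
  product of what is left has real part (|\<omega>|^2 - 1) / (1 - B^2). For B > -1 the image is a
  disc and not a half plane.\<close>

lemma janowski_inside_disc:
  assumes B: "- 1 < B" "B < A" "A \<le> 1" and \<omega>: "norm \<omega> < 1" and v: "v = janowski A B \<omega>"
  shows "(Re v - (1 - A) / (1 - B)) * (Re v - (1 + A) / (1 + B)) + (Im v)\<^sup>2 < 0"
proof -
  have B1: "B < 1" using B by simp
  have "norm (of_real B * \<omega>) < 1"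
    using B B1 \<omega> mult_strict_mono'[of "\<bar>B\<bar>" 1 "norm \<omega>" 1] by (simp add: norm_mult abs_if)
  then have N: "1 + of_real B * \<omega> \<noteq> 0"
    by (metis add_eq_0_iff norm_minus_cancel norm_one order_less_irrefl)
  have nz: "(1 - of_real B :: complex) \<noteq> 0" "(1 + of_real B :: complex) \<noteq> 0"
    using B B1 by (auto simp: complex_eq_iff)
  define r where "r = of_real (A - B) / (1 + of_real B * \<omega>)"
  have 1: "v - of_real ((1 - A) / (1 - B)) = r * ((1 + \<omega>) / (1 - of_real B))"
    using N nz unfolding v janowski_def r_def by (simp add: divide_simps) (simp add: algebra_simps)
  have 2: "v - of_real ((1 + A) / (1 + B)) = r * ((\<omega> - 1) / (1 + of_real B))"
    using N nz unfolding v janowski_def r_def by (simp add: divide_simps) (simp add: algebra_simps)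
  have "Re ((v - of_real ((1 - A) / (1 - B))) * cnj (v - of_real ((1 + A) / (1 + B))))
      = Re (r * cnj r * ((1 + \<omega>) * cnj (\<omega> - 1)) / of_real ((1 - B) * (1 + B)))"
    unfolding 1 2 by (simp add: field_simps)
  also have "\<dots> = (norm r)\<^sup>2 * Re ((1 + \<omega>) * cnj (\<omega> - 1)) / ((1 - B) * (1 + B))"
    unfolding complex_norm_square[symmetric] Re_divide_of_real by simp
  also have "Re ((1 + \<omega>) * cnj (\<omega> - 1)) = (norm \<omega>)\<^sup>2 - 1"
    unfolding cmod_power2 by (simp add: power2_eq_square algebra_simps)
  also have "(norm r)\<^sup>2 * ((norm \<omega>)\<^sup>2 - 1) / ((1 - B) * (1 + B)) < 0"
  proof (intro divide_neg_pos mult_pos_neg mult_pos_pos)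
    show "0 < (norm r)\<^sup>2" using B N by (simp add: r_def)
    show "(norm \<omega>)\<^sup>2 - 1 < 0" using \<omega> by (simp add: power_less_one_iff abs_square_less_1)
  qed (use B B1 in auto)
  finally show ?thesis by (simp add: power2_eq_square)
qed

text \<open>Two constraints are followed at once: Re u > \<kappa>, which keeps q = 1/u - c
  holomorphic, and q in exp of the disc. The hypotheses \<open>half_plane\<close> and
  \<open>exp_disk\<close> say that neither can be the one that fails first, since the value of h
  that the equation would then force is not attained.\<close>

lemma briot_bouquet_exit:
  fixes c \<kappa> :: real and u h :: "complex \<Rightarrow> complex"
  assumes u: "u holomorphic_on unit_disk" "u 0 = 1 / of_real (1 + c)"
    and ode: "\<And>z. z \<in> unit_disk \<Longrightarrow> u z * (of_real c + h z) + z * deriv u z = 1"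
    and \<kappa>: "0 \<le> \<kappa>" "\<kappa> < 1 / (1 + c)"
    and half_plane: "\<And>n v. Re v = \<kappa> \<Longrightarrow> v \<noteq> 0 \<Longrightarrow>
      ((1 / (1 + c) - \<kappa>)\<^sup>2 + (Im v)\<^sup>2) / (2 * (1 / (1 + c) - \<kappa>)) \<le> n \<Longrightarrow>
      of_real (1 + n) / v - of_real c \<notin> h ` unit_disk"
    and exp_disk: "\<And>m \<zeta>. norm \<zeta> = 1 \<Longrightarrow> 1 \<le> m \<Longrightarrow> \<kappa> < Re (1 / (exp \<zeta> + of_real c)) \<Longrightarrow>
      exp \<zeta> + of_real m * \<zeta> * exp \<zeta> / (exp \<zeta> + of_real c) \<notin> h ` unit_disk"
    and z: "z \<in> unit_disk"
  shows "u z \<noteq> 0 \<and> 1 / u z - of_real c \<in> exp ` ball 0 1"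
proof -
  define q where "q = (\<lambda>z. 1 / u z - of_real c)"
  define P where "P = (\<lambda>z. \<kappa> < Re (u z) \<and> q z \<in> exp ` ball 0 1)"
  have nz: "u z \<noteq> 0" if "\<kappa> < Re (u z)" for z using that \<kappa>(1) by auto
  have "P z"
  proof (rule ccontr)
    assume notP: "\<not> P z"
    have cu: "continuous_on unit_disk u" by (rule holomorphic_on_imp_continuous_on[OF u(1)])
    define G where "G = {z \<in> unit_disk. \<kappa> < Re (u z)}"
    have "open (unit_disk \<inter> u -` {v. \<kappa> < Re v})"
      by (rule continuous_open_preimage[OF cu]) (auto intro: open_halfspace_Re_gt)
    then have G: "open G" by (simp add: G_def vimage_def Int_def)
    have "continuous_on G q"
      unfolding q_def using nz by (intro continuous_intros continuous_on_subset[OF cu]) (auto simp: G_def)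
    then have "open (G \<inter> q -` (exp ` ball 0 1))"
      by (rule continuous_open_preimage[OF _ G open_exp_disk])
    moreover have "G \<inter> q -` (exp ` ball 0 1) = {z \<in> unit_disk. P z}"
      by (auto simp: G_def P_def)
    ultimately have op: "open {z \<in> unit_disk. P z}" by simp
    have u0: "u 0 = of_real (1 / (1 + c))" using u(2) by simp
    have "1 \<in> exp ` ball (0 :: complex) 1" by (rule image_eqI[of _ _ 0]) auto
    then have "P 0" using \<kappa> by (simp add: P_def q_def u0)
    then obtain z0 where z0: "norm z0 < 1" "z0 \<noteq> 0" "\<not> P z0" "\<And>z. norm z < norm z0 \<Longrightarrow> P z"
      using first_exit[OF op _ z notP] by blast
    define r where "r = norm z0"
    have r: "norm z0 = r" "0 < r" "r < 1" using z0 by (auto simp: r_def)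
    have sub: "ball 0 r \<subseteq> unit_disk" using r by auto
    have hol: "u holomorphic_on ball 0 r" using u(1) sub by (rule holomorphic_on_subset)
    have P: "P z" if "z \<in> ball 0 r" for z using that z0(4) by (simp add: r_def)
    have z0D: "z0 \<in> unit_disk" using z0(1) by simp
    have u': "(u has_field_derivative deriv u z0) (at z0)"
      using u(1) z0D holomorphic_derivI by blast
    have lim: "(u \<longlongrightarrow> u z0) (at z0 within ball 0 r)"
      using DERIV_isCont[OF u'] continuous_within continuous_at_imp_continuous_at_within by blast
    have nb: "at z0 within ball 0 r \<noteq> bot"
      using r by (simp add: trivial_limit_within islimpt_ball)
    have ev: "\<forall>\<^sub>F z in at z0 within ball 0 r. z \<in> ball 0 r"
      by (simp add: eventually_at_filter)
    have "\<kappa> \<le> Re (u z0)"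
      by (rule tendsto_lowerbound[OF tendsto_Re[OF lim] _ nb])
        (use ev in eventually_elim, use P in \<open>auto simp: P_def intro: less_imp_le\<close>)
    \<comment> \<open>Before the exit 1/u = exp \<zeta> + c is bounded by e + |c|, so u cannot
      vanish at the exit point; for \<kappa> = 0 the inequality Re u \<ge> \<kappa> alone would
      allow it.\<close>
    have "1 / (exp 1 + \<bar>c\<bar>) \<le> norm (u z0)"
    proof (rule tendsto_lowerbound[OF tendsto_norm[OF lim] _ nb], use ev in eventually_elim)
      case (elim z)
      obtain \<zeta> where \<zeta>: "q z = exp \<zeta>" "norm \<zeta> < 1" "u z \<noteq> 0" using P[OF elim] nz by (auto simp: P_def)
      have "norm (1 / u z) = norm (exp \<zeta> + of_real c)" by (simp add: \<zeta>(1)[symmetric] q_def)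
      also have "\<dots> \<le> exp 1 + \<bar>c\<bar>"
        using norm_triangle_ineq[of "exp \<zeta>" "of_real c"] norm_exp[of \<zeta>] \<zeta>(2)
        by (smt (verit) exp_le_cancel_iff norm_of_real)
      finally have "1 \<le> norm (u z) * (exp 1 + \<bar>c\<bar>)"
        using \<zeta>(3) by (simp add: norm_divide divide_le_eq mult.commute)
      moreover have "0 < exp 1 + \<bar>c\<bar>" by (simp add: add_pos_nonneg)
      ultimately show ?case by (simp add: pos_divide_le_eq)
    qed
    moreover have "0 < 1 / (exp 1 + \<bar>c\<bar>)" by (simp add: add_pos_nonneg)
    ultimately have uz0: "u z0 \<noteq> 0" by auto
    \<comment> \<open>With \<open>z0 * deriv u z0\<close> = -n this is the point (1 + n) / u - c
      that \<open>half_plane\<close> excludes.\<close>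
    have h: "h z0 = (1 - z0 * deriv u z0) / u z0 - of_real c"
      using ode[OF z0D] uz0 by (simp add: field_simps)
    have hin: "h z0 \<in> h ` unit_disk" using z0D by blast
    show False
    proof (cases "Re (u z0) = \<kappa>")
      case True
      obtain n where "((1 / (1 + c) - \<kappa>)\<^sup>2 + (Im (u z0))\<^sup>2) / (2 * (1 / (1 + c) - \<kappa>)) \<le> n"
        "z0 * deriv u z0 = - of_real n"
        using half_plane_exit[OF hol u0 _ r(1,2) u' True] P unfolding P_def by blast
      then show False using half_plane[OF True uz0] hin h by simp
    next
      case False
      with \<open>\<kappa> \<le> Re (u z0)\<close> have Re: "\<kappa> < Re (u z0)" by simp
      then have "q z0 \<notin> exp ` ball 0 1" using z0(3) by (simp add: P_def)
      moreover have "q holomorphic_on ball 0 r"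
        unfolding q_def using P nz by (intro holomorphic_intros hol) (auto simp: P_def)
      moreover have "q 0 = 1" by (simp add: q_def u0)
      moreover have "q ` ball 0 r \<subseteq> exp ` ball 0 1" using P by (auto simp: P_def)
      moreover have "(q has_field_derivative - (deriv u z0 / (u z0)\<^sup>2)) (at z0)"
        unfolding q_def using uz0 u'
        by (auto intro!: derivative_eq_intros simp: power2_eq_square divide_inverse)
      ultimately obtain m \<zeta> where \<zeta>: "norm \<zeta> = 1" "1 \<le> m" "q z0 = exp \<zeta>"
        "z0 * - (deriv u z0 / (u z0)\<^sup>2) = of_real m * \<zeta> * exp \<zeta>"
        using exp_disk_exit[of q r z0] r(1,2) by blast
      have ue: "exp \<zeta> + of_real c = 1 / u z0" by (simp add: \<zeta>(3)[symmetric] q_def)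
      have "h z0 = exp \<zeta> + of_real m * \<zeta> * exp \<zeta> / (exp \<zeta> + of_real c)"
        unfolding \<zeta>(4)[symmetric] ue unfolding h \<zeta>(3)[symmetric] q_def using uz0
        by (simp add: field_simps power2_eq_square)
      moreover have "\<kappa> < Re (1 / (exp \<zeta> + of_real c))" using Re by (simp add: ue)
      ultimately show False using exp_disk[OF \<zeta>(1,2)] hin by simp
    qed
  qed
  then show ?thesis using nz by (auto simp: P_def q_def)
qed

lemma exp_disk_admissible:
  assumes p: "p holomorphic_on unit_disk" "p 0 = 1"
    and admissible: "\<And>m \<zeta> z. norm \<zeta> = 1 \<Longrightarrow> 1 \<le> m \<Longrightarrow> z \<in> unit_disk \<Longrightarrow> p z = exp \<zeta> \<Longrightarrow>
      z * deriv p z \<noteq> of_real m * \<zeta> * exp \<zeta>"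
    and z: "z \<in> unit_disk"
  shows "p z \<in> exp ` ball 0 1"
proof (rule ccontr)
  assume np: "p z \<notin> exp ` ball 0 1"
  have "open (unit_disk \<inter> p -` (exp ` ball 0 1))"
    by (rule continuous_open_preimage[OF holomorphic_on_imp_continuous_on[OF p(1)] _ open_exp_disk]) simp
  then have op: "open {z \<in> unit_disk. p z \<in> exp ` ball 0 1}"
    by (simp add: vimage_def Int_def)
  have "1 \<in> exp ` ball (0 :: complex) 1" by (rule image_eqI[of _ _ 0]) auto
  then obtain z0 where z0: "norm z0 < 1" "z0 \<noteq> 0" "p z0 \<notin> exp ` ball 0 1"
    "\<And>z. norm z < norm z0 \<Longrightarrow> p z \<in> exp ` ball 0 1"
    using first_exit[OF op _ z np] p(2) by metis
  have z0D: "z0 \<in> unit_disk" using z0(1) by simp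
  have "p holomorphic_on ball 0 (norm z0)" by (rule holomorphic_on_subset[OF p(1)]) (use z0 in auto)
  moreover have "p ` ball 0 (norm z0) \<subseteq> exp ` ball 0 1" using z0(4) by auto
  moreover have "(p has_field_derivative deriv p z0) (at z0)"
    using p(1) z0D holomorphic_derivI by blast
  ultimately obtain m \<zeta> where "norm \<zeta> = 1" "1 \<le> m" "p z0 = exp \<zeta>" "z0 * deriv p z0 = of_real m * \<zeta> * exp \<zeta>"
    using exp_disk_exit[OF _ p(2) _ refl _ _ z0(3)] z0(2) by (metis zero_less_norm_iff)
  then show False using admissible[OF _ _ z0D] by blast
qed

section \<open>Bernardi's operator\<close>

text \<open>Comparing coefficients forces b_n = (c + 1) a_n / (c + n). For c > -1 and n \<ge> 1
  these are dominated by |a_n|, so the series converges in the disc. The term n = 0 is set to 0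
  separately to avoid dividing by c, which may vanish.\<close>

lemma bernardi_ode_solution:
  fixes c :: real
  assumes f: "f \<in> class_A" and c: "-1 < c"
  obtains F where "F holomorphic_on unit_disk" "F 0 = 0" "deriv F 0 = 1"
    "\<And>z. z \<in> unit_disk \<Longrightarrow> of_real c * F z + z * deriv F z = of_real (c + 1) * f z"
proof -
  have fh: "f holomorphic_on ball 0 1" and f0: "f 0 = 0" and f1: "deriv f 0 = 1"
    using f by (auto simp: class_A_def)
  define a where "a = (\<lambda>n. (deriv ^^ n) f 0 / fact n)"
  have a: "(\<lambda>n. a n * z ^ n) sums f z" if "norm z < 1" for z
    using holomorphic_power_series[OF fh, of z] that by (simp add: a_def)
  define b where "b n = (if n = 0 then 0 else of_real ((c + 1) / (c + real n)) * a n)" for n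
  have ba: "norm (b n) \<le> norm (a n)" for n
  proof (cases "n = 0")
    case False
    then have "1 \<le> real n" by simp
    then have "0 < c + real n" "c + 1 \<le> c + real n" using c by linarith+
    then have "\<bar>(c + 1) / (c + real n)\<bar> \<le> 1" using c by simp
    then have "norm (of_real ((c + 1) / (c + real n)) * a n) \<le> 1 * norm (a n)"
      unfolding norm_mult norm_of_real by (intro mult_right_mono) auto
    then show ?thesis using False by (simp add: b_def del: of_real_divide)
  qed (simp add: b_def)
  have sb: "summable (\<lambda>n. b n * z ^ n)" if z: "norm z < 1" for z
  proof -
    obtain r where r: "norm z < r" "r < 1" using z dense by blast
    have "summable (\<lambda>n. a n * of_real r ^ n)"
      using a[of "of_real r"] r z norm_ge_zero[of z] by (simp add: sums_iff)
    then have "summable (\<lambda>n. norm (a n * z ^ n))"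
      by (rule powser_insidea) (use r in simp)
    then show ?thesis
      by (rule summable_comparison_test'[of _ 0]) (simp add: norm_mult mult_right_mono ba)
  qed
  define F where "F = (\<lambda>z. \<Sum>n. b n * z ^ n)"
  have dF: "(F has_field_derivative (\<Sum>n. diffs b n * z ^ n)) (at z)" if "norm z < 1" for z
    unfolding F_def by (rule termdiffs_strong'[OF sb that])
  show ?thesis
  proof (rule that)
    show "F holomorphic_on unit_disk"
      unfolding holomorphic_on_open[OF open_ball] using dF by (metis mem_ball_0)
    show "F 0 = 0" by (simp add: F_def powser_zero b_def)
    have "deriv F 0 = (\<Sum>n. diffs b n * 0 ^ n)" using dF[of 0] by (intro DERIV_imp_deriv) simp
    also have "\<dots> = b 1" by (simp add: powser_zero diffs_def)
    also have "\<dots> = of_real ((c + 1) / (c + 1))" using f1 by (simp add: b_def a_def del: of_real_divide)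
    also have "\<dots> = 1" using c by simp
    finally show "deriv F 0 = 1" .
    fix z :: complex assume "z \<in> unit_disk"
    then have z: "norm z < 1" by simp
    have "summable (\<lambda>n. diffs b n * z ^ n)" by (rule termdiff_converges[OF z sb])
    then have "(\<lambda>n. of_nat n * b n * z ^ (n - Suc 0)) sums deriv F z"
      using diffs_equiv DERIV_imp_deriv[OF dF[OF z]] by metis
    then have "(\<lambda>n. z * (of_nat n * b n * z ^ (n - Suc 0))) sums (z * deriv F z)"
      by (rule sums_mult)
    moreover have "(\<lambda>n. of_real c * (b n * z ^ n)) sums (of_real c * F z)"
      unfolding F_def by (intro sums_mult summable_sums sb z)
    ultimately have "(\<lambda>n. of_real c * (b n * z ^ n) + z * (of_nat n * b n * z ^ (n - Suc 0)))
        sums (of_real c * F z + z * deriv F z)" by (intro sums_add)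
    moreover have "of_real c * (b n * z ^ n) + z * (of_nat n * b n * z ^ (n - Suc 0)) = of_real (c + 1) * (a n * z ^ n)" for n
    proof (cases n)
      case (Suc k)
      have "c + real n \<noteq> 0" using c Suc by simp
      then have "(c + real n) * ((c + 1) / (c + real n)) = c + 1" by simp
      then have "of_real (c + real n) * b n = of_real (c + 1) * a n"
        using Suc by (metis b_def mult.assoc nat.distinct(1) of_real_mult)
      then have "(of_real c + of_nat n) * b n = of_real (c + 1) * a n" by simp
      then have "((of_real c + of_nat n) * b n) * z ^ n = (of_real (c + 1) * a n) * z ^ n" by simp
      then show ?thesis using Suc by (simp add: algebra_simps)
    qed (simp add: b_def a_def f0)
    ultimately have "(\<lambda>n. of_real (c + 1) * (a n * z ^ n)) sums (of_real c * F z + z * deriv F z)" by simp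
    then show "of_real c * F z + z * deriv F z = of_real (c + 1) * f z"
      using sums_mult[OF a[OF z]] sums_unique2 by blast
  qed
qed

lemma factor_zero_at_origin:
  assumes "F holomorphic_on unit_disk" "F 0 = 0"
  obtains F1 where "F1 holomorphic_on unit_disk" "F1 0 = deriv F 0" "\<And>z. F z = z * F1 z"
proof
  show "(\<lambda>z. if z = 0 then deriv F 0 else (F z - F 0) / (z - 0)) holomorphic_on unit_disk"
    by (rule pole_lemma[OF assms(1)]) simp
qed (use assms in auto)

lemma bernardi_eq:
  fixes c :: real
  assumes F: "F holomorphic_on unit_disk" "F 0 = 0" and c: "-1 < c"
    and ode: "\<And>z. z \<in> unit_disk \<Longrightarrow> of_real c * F z + z * deriv F z = of_real (c + 1) * f z"
    and z: "z \<in> unit_disk"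
  shows "bernardi c f z = F z"
proof -
  obtain F1 where F1: "F1 holomorphic_on unit_disk" "\<And>z. F z = z * F1 z"
    using factor_zero_at_origin[OF F] by metis
  \<comment> \<open>For s > 0 this is s^c F(s z). In the factored form the exponent c + 1 is
    positive, so G is continuous with value 0 at s = 0, although s^c may be unbounded there.\<close>
  define G where "G = (\<lambda>s. of_real (s powr (c + 1)) * (z * F1 (of_real s * z)))"
  have sz: "of_real s * z \<in> unit_disk" if "0 \<le> s" "s \<le> 1" for s
  proof -
    have "s * norm z \<le> norm z" using that by (simp add: mult_left_le_one_le)
    then show ?thesis using z that by (simp add: norm_mult)
  qed
  have "continuous_on ((\<lambda>s. of_real s * z) ` {0..1}) F1"
    by (rule continuous_on_subset[OF holomorphic_on_imp_continuous_on[OF F1(1)]]) (use sz in auto)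
  then have "continuous_on {0..1} (\<lambda>s. F1 (of_real s * z))"
    by (rule continuous_on_compose2) (auto intro!: continuous_intros)
  moreover have "continuous_on {0..1} (\<lambda>s. s powr (c + 1))"
    using c by (intro continuous_on_powr') (auto intro!: continuous_intros)
  ultimately have cont: "continuous_on {0..1} G"
    unfolding G_def by (intro continuous_on_mult continuous_on_of_real continuous_on_const)
  have der: "(G has_vector_derivative of_real (c + 1) * (of_real (s powr (c - 1)) * f (of_real s * z))) (at s)"
    if s: "s \<in> {0<..<1}" for s
  proof -
    have "(F has_field_derivative deriv F (of_real s * z)) (at (of_real s * z))"
      using F(1) sz[of s] s holomorphic_derivI by force
    moreover have "((\<lambda>s. of_real s * z) has_vector_derivative z) (at s)"
      by (auto intro!: derivative_eq_intros)
    ultimately have 1: "((\<lambda>s. F (of_real s * z)) has_vector_derivative z * deriv F (of_real s * z)) (at s)"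
      using field_vector_diff_chain_at unfolding o_def by blast
    have "((\<lambda>s. s powr c) has_real_derivative c * s powr (c - 1)) (at s)"
      using s by (auto intro!: derivative_eq_intros)
    then have 2: "((\<lambda>s. of_real (s powr c)) has_vector_derivative (of_real (c * s powr (c - 1)) :: complex)) (at s)"
      by (rule has_vector_derivative_of_real[unfolded has_real_derivative_iff_has_vector_derivative[symmetric]])
    have "((\<lambda>s. of_real (s powr c) * F (of_real s * z)) has_vector_derivative
        of_real (s powr c) * (z * deriv F (of_real s * z)) + of_real (c * s powr (c - 1)) * F (of_real s * z)) (at s)"
      by (rule has_vector_derivative_mult[OF 2 1])
    also have "of_real (s powr c) * (z * deriv F (of_real s * z)) + of_real (c * s powr (c - 1)) * F (of_real s * z)
        = of_real (s powr (c - 1)) * (of_real c * F (of_real s * z) + (of_real s * z) * deriv F (of_real s * z))"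
    proof -
      have "s powr c = s powr (c - 1) * s" using s powr_add[of s "c - 1" 1] by simp
      then show ?thesis by (simp add: algebra_simps)
    qed
    also have "\<dots> = of_real (c + 1) * (of_real (s powr (c - 1)) * f (of_real s * z))"
      using ode[OF sz[of s]] s by simp
    finally show ?thesis
    proof (rule has_vector_derivative_transform_within_open[where S = "{0<..<1}"])
      fix s :: real assume s: "s \<in> {0<..<1}"
      then have "s powr (c + 1) = s powr c * s" using powr_add[of s c 1] by simp
      then show "of_real (s powr c) * F (of_real s * z) = G s"
        by (simp add: G_def F1(2))
    qed (use s in auto)
  qed
  have "((\<lambda>s. of_real (c + 1) * (of_real (s powr (c - 1)) * f (of_real s * z))) has_integral (G 1 - G 0)) {0..1}"
    by (rule fundamental_theorem_of_calculus_interior[OF _ cont der]) auto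
  moreover have "G 1 - G 0 = F z" using F1(2)[of z] by (simp add: G_def)
  ultimately have "integral {0..1} (\<lambda>s. of_real (c + 1) * (of_real (s powr (c - 1)) * f (of_real s * z))) = F z"
    by (metis integral_unique)
  then show ?thesis unfolding bernardi_def by (subst integral_mult_right[symmetric])
qed

lemma bernardi_properties:
  assumes f: "f \<in> class_A" and c: "-1 < c"
  shows "bernardi c f \<in> class_A"
    and "\<And>z. z \<in> unit_disk \<Longrightarrow>
      of_real c * bernardi c f z + z * deriv (bernardi c f) z = of_real (c + 1) * f z"
proof -
  obtain F where F: "F holomorphic_on unit_disk" "F 0 = 0" "deriv F 0 = 1"
    "\<And>z. z \<in> unit_disk \<Longrightarrow> of_real c * F z + z * deriv F z = of_real (c + 1) * f z"
    using bernardi_ode_solution[OF f c] by blast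
  have eq: "bernardi c f z = F z" if "z \<in> unit_disk" for z
    by (rule bernardi_eq[OF F(1,2) c F(4) that])
  have d: "deriv (bernardi c f) z = deriv F z" if "z \<in> unit_disk" for z
  proof (rule deriv_cong_ev)
    show "\<forall>\<^sub>F w in nhds z. bernardi c f w = F w"
      unfolding eventually_nhds using eq that by (intro exI[of _ unit_disk]) auto
  qed simp
  have "bernardi c f holomorphic_on unit_disk"
    using holomorphic_transform[OF F(1)] eq by metis
  then show "bernardi c f \<in> class_A"
    using eq[of 0] d[of 0] F(2,3) by (simp add: class_A_def)
  show "of_real c * bernardi c f z + z * deriv (bernardi c f) z = of_real (c + 1) * f z" if "z \<in> unit_disk" for z
    using F(4)[OF that] eq[OF that] d[OF that] by simp
qed

text \<open>At a zero z \<noteq> 0 of order n the quotient would behave like n z / (w - z).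
  Multiplied by (w - z) g(w), its equation extends to w = z and reads n z g(z) = 0, which is
  impossible.\<close>

lemma starlike_quot_holomorphic_imp_nonzero:
  assumes f: "f \<in> class_A" and h: "starlike_quot f holomorphic_on unit_disk"
    and z: "z \<in> unit_disk" "z \<noteq> 0"
  shows "f z \<noteq> 0"
proof
  assume fz: "f z = 0"
  have fh: "f holomorphic_on unit_disk" and f0: "f 0 = 0" and f1: "deriv f 0 = 1"
    using f by (auto simp: class_A_def)
  have "\<not> f constant_on unit_disk"
  proof
    assume "f constant_on unit_disk"
    then obtain k where "\<And>w. w \<in> unit_disk \<Longrightarrow> f w = k" by (auto simp: constant_on_def)
    then have "deriv f 0 = deriv (\<lambda>_. k) 0"
      by (intro deriv_cong_ev) (auto simp: eventually_nhds intro!: exI[of _ unit_disk])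
    then show False using f1 by simp
  qed
  then obtain g r n where g: "0 < n" "0 < r" "ball z r \<subseteq> unit_disk" "g holomorphic_on ball z r"
    "\<And>w. w \<in> ball z r \<Longrightarrow> f w = (w - z) ^ n * g w" "\<And>w. w \<in> ball z r \<Longrightarrow> g w \<noteq> 0"
    using holomorphic_factor_zero_nonconstant[OF fh _ _ z(1) fz] by (metis open_ball connected_ball)
  define q where "q = starlike_quot f"
  have key: "w * (of_nat n * g w + (w - z) * deriv g w) = q w * ((w - z) * g w)"
    if w: "w \<in> ball z r" "w \<noteq> z" "w \<noteq> 0" for w
  proof -
    have "(g has_field_derivative deriv g w) (at w)"
      using g(4) w(1) holomorphic_derivI by blast
    then have "((\<lambda>w. (w - z) ^ n * g w) has_field_derivative
        of_nat n * (w - z) ^ (n - 1) * g w + (w - z) ^ n * deriv g w) (at w)"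
      by (auto intro!: derivative_eq_intros)
    then have "(f has_field_derivative of_nat n * (w - z) ^ (n - 1) * g w + (w - z) ^ n * deriv g w) (at w)"
      by (rule has_field_derivative_transform_within_open[OF _ _ w(1)]) (use g(5) in auto)
    then have d: "deriv f w = of_nat n * (w - z) ^ (n - 1) * g w + (w - z) ^ n * deriv g w"
      by (rule DERIV_imp_deriv)
    have pw: "(w - z) ^ n = (w - z) ^ (n - 1) * (w - z)" using g(1) by (simp add: power_eq_if)
    have "q w * f w = w * deriv f w"
      using w g(5,6) by (simp add: q_def starlike_quot_def)
    then have "(w - z) ^ (n - 1) * (q w * ((w - z) * g w)) = (w - z) ^ (n - 1) * (w * (of_nat n * g w + (w - z) * deriv g w))"
      unfolding d g(5)[OF w(1)] pw by (simp add: algebra_simps)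
    then show ?thesis using w(2) by simp
  qed
  have zb: "z \<in> ball z r" using g(2) by simp
  have cont: "isCont g z" "isCont (deriv g) z" "isCont q z"
    using holomorphic_on_imp_continuous_on[OF g(4)] holomorphic_on_imp_continuous_on[OF holomorphic_deriv[OF g(4)]]
      holomorphic_on_imp_continuous_on[OF h] zb z(1)
    by (auto simp: continuous_on_eq_continuous_at q_def)
  have t1: "((\<lambda>w. w * (of_nat n * g w + (w - z) * deriv g w)) \<longlongrightarrow> z * (of_nat n * g z + (z - z) * deriv g z)) (at z)"
    using cont by (intro tendsto_intros) (auto simp: isCont_def)
  have t2: "((\<lambda>w. q w * ((w - z) * g w)) \<longlongrightarrow> q z * ((z - z) * g z)) (at z)"
    using cont by (intro tendsto_intros) (auto simp: isCont_def)
  have ev: "\<forall>\<^sub>F w in at z. w * (of_nat n * g w + (w - z) * deriv g w) = q w * ((w - z) * g w)"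
  proof -
    have "\<forall>\<^sub>F w in at z. w \<in> ball z r - {0}"
      by (rule eventually_at_in_open') (use zb z in auto)
    then show ?thesis using key by (auto simp: eventually_at_filter elim: eventually_mono)
  qed
  have "z * (of_nat n * g z + (z - z) * deriv g z) = q z * ((z - z) * g z)"
    by (rule tendsto_unique[OF at_neq_bot Lim_transform_eventually[OF t1 ev] t2])
  then show False using z(2) g(1,6) zb by simp
qed

section \<open>The main result\<close>

lemma zero_le_mult_pos_left: "0 < p \<Longrightarrow> 0 \<le> p * q \<Longrightarrow> 0 \<le> (q :: real)"
  by (simp add: zero_le_mult_iff)

lemma both_nonpos:
  fixes p q s t :: real
  assumes "0 \<le> p * q" "s * p + t * q \<le> 0" "0 < s" "0 < t"
  shows "p \<le> 0 \<and> q \<le> 0"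
proof (rule ccontr)
  assume "\<not> (p \<le> 0 \<and> q \<le> 0)"
  then have "0 < p \<and> 0 \<le> q \<or> 0 \<le> p \<and> 0 < q" using assms(1) by (auto simp: zero_le_mult_iff)
  then have "0 < s * p + t * q"
    using assms(3,4) by (auto intro: add_pos_nonneg add_nonneg_pos)
  then show False using assms(2) by simp
qed

text \<open>The first factor in (C2) is positive, and the second compares the right end of the disc
  with e + e / (e + c), the value of h at \<zeta> = 1. (C4) is \<open>Q1 * Q2\<close> and (C3) is
  -((1 + B) Q1 + (1 - B) Q2) / 2, so \<open>Q1\<close> and \<open>Q2\<close> are both nonpositive.
  They compare the ends with 1/e - 1/K, the value at \<zeta> = -1; the sign of \<open>K\<close>
  decides on which side of it the disc lies.\<close>

lemma conds_C_starlike: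
  assumes AB: "-1 \<le> B" "B < A" "A \<le> 1" and c: "- 1 < c" and C: "conds_C A B 1 c"
  shows "- 1 < B" "(1 + A) / (1 + B) \<le> exp 1 + exp 1 / (exp 1 + c)"
    and "- exp (- 1) < c \<Longrightarrow> 1 / exp 1 - 1 / (1 + c * exp 1) \<le> (1 - A) / (1 - B)"
    and "c < - exp (- 1) \<Longrightarrow> (1 + A) / (1 + B) \<le> 1 / exp 1 - 1 / (1 + c * exp 1)"
proof -
  define e :: real where "e = exp 1"
  define K where "K = 1 + c * e"
  have e: "2 < e" "0 < e" using exp_1_bounds by (simp_all add: e_def)
  have ec: "0 < e + c" using e c by simp
  have B1: "B < 1" using AB by simp
  \<comment> \<open>The sum equals e (e + c) - c, arranged so that every summand is
    positive.\<close>
  have "0 < (1 + c) * (e - 1) + (e - 2) * e + (e + 1)"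
    by (rule add_pos_pos[OF add_pos_pos[OF mult_pos_pos mult_pos_pos]]) (use c e in simp_all)
  then have "0 < e * (e + c) - c" using e by (simp add: algebra_simps)
  then have "0 < (1 - B) * (e * (e + c) - c)" using B1 by simp
  moreover have "(e + c) * B < (e + c) * A" using AB ec by simp
  moreover have P1: "e * ((A + e - 1) * 1 - (e * 1 + 1) * B + 1) + c * (A + e * (1 - B) - 1)
      = ((e + c) * A - (e + c) * B) + (1 - B) * (e * (e + c) - c)"
    by (simp add: algebra_simps)
  ultimately have "0 < e * ((A + e - 1) * 1 - (e * 1 + 1) * B + 1) + c * (A + e * (1 - B) - 1)"
    by linarith
  moreover have "0 \<le> (e * ((A + e - 1) * 1 - (e * 1 + 1) * B + 1) + c * (A + e * (1 - B) - 1)) *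
     (e * (- (A - e + 1) * 1 + B * (e * 1 + 1) + 1) + c * (- A + e * (B + 1) - 1))"
    using C by (simp only: conds_C_def cond_C2_def Let_def e_def)
  ultimately have "0 \<le> e * (- (A - e + 1) * 1 + B * (e * 1 + 1) + 1) + c * (- A + e * (B + 1) - 1)"
    by (rule zero_le_mult_pos_left)
  then have P2: "(1 + A) * (e + c) \<le> (1 + B) * (e * (e + c) + e)" by (simp add: algebra_simps)
  \<comment> \<open>At B = -1 the right side of \<open>P2\<close> vanishes while the left side is
    positive: the conditions exclude the half plane.\<close>
  show B: "- 1 < B"
  proof (rule ccontr)
    assume "\<not> - 1 < B"
    then have "B = - 1" using AB by simp
    moreover from this have "0 < (1 + A) * (e + c)" using ec AB by (intro mult_pos_pos) auto
    ultimately show False using P2 by simp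
  qed
  show "(1 + A) / (1 + B) \<le> exp 1 + exp 1 / (exp 1 + c)"
    using P2 B ec unfolding e_def[symmetric] by (simp add: field_simps)
  define Q1 Q2 where "Q1 = (1 - B) * (K - e) - (1 - A) * (e * K)" and "Q2 = (1 + B) * (K - e) - (1 + A) * (e * K)"
  have "0 \<le> (e * ((A - 1) * 1 + (1 - B) * (c - 1)) + e\<^sup>2 * (A - 1) * c + 1 * (1 - B)) *
     (- e * ((A + 1) * 1 + (B + 1) * (1 - c)) - e\<^sup>2 * (A + 1) * c + 1 * (B + 1))"
    using C by (simp only: conds_C_def cond_C4_def Let_def e_def)
  also have "\<dots> = Q1 * Q2"
    by (simp add: Q1_def Q2_def K_def algebra_simps power2_eq_square)
  finally have Q: "0 \<le> Q1 * Q2" .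
  have "0 \<le> e * (1 * (1 - A * B) + B\<^sup>2 * (c - 1) - c + 1) + e\<^sup>2 * c * (1 - A * B) + 1 * (B\<^sup>2 - 1)"
    using C by (simp only: conds_C_def cond_C3_def Let_def e_def)
  also have "2 * \<dots> = - ((1 + B) * Q1 + (1 - B) * Q2)"
    by (simp add: Q1_def Q2_def K_def algebra_simps power2_eq_square)
  finally have S: "(1 + B) * Q1 + (1 - B) * Q2 \<le> 0" by simp
  have Qneg: "Q1 \<le> 0 \<and> Q2 \<le> 0"
    using B B1 Q S by (intro both_nonpos) auto
  have eK: "c < - exp (- 1) \<longleftrightarrow> K < 0" "- exp (- 1) < c \<longleftrightarrow> 0 < K"
    using e by (auto simp: K_def exp_neg_1 e_def[symmetric] field_simps)
  show "1 / exp 1 - 1 / (1 + c * exp 1) \<le> (1 - A) / (1 - B)" if "- exp (- 1) < c"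
  proof -
    have K: "0 < K" using that eK by simp
    then have "1 / e - 1 / K = (K - e) / (e * K)" using e by (simp add: field_simps)
    also have "\<dots> \<le> (1 - A) / (1 - B)"
      using conjunct1[OF Qneg] K e B1 by (simp add: Q1_def divide_le_eq pos_le_divide_eq mult.commute)
    finally show ?thesis by (simp add: K_def e_def)
  qed
  show "(1 + A) / (1 + B) \<le> 1 / exp 1 - 1 / (1 + c * exp 1)" if "c < - exp (- 1)"
  proof -
    have K: "K < 0" using that eK by simp
    have eK0: "e * K < 0" using K e by (simp add: mult_pos_neg)
    have "(1 + A) / (1 + B) \<le> (K - e) / (e * K)"
      using conjunct2[OF Qneg] eK0 B by (simp add: Q2_def divide_le_eq neg_le_divide_eq mult.commute)
    also have "\<dots> = 1 / e - 1 / K" using K e by (simp add: field_simps)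
    finally show ?thesis by (simp add: K_def e_def)
  qed
qed

text \<open>The same reading for \<beta> = 0, where q + z q' / \<gamma> takes the values e (1 +
  1/\<gamma>) and (1 - 1/\<gamma>) / e at \<zeta> = 1 and \<zeta> = -1 for m = 1; (C3) and (C4) now
  carry extra factors e and e^2.\<close>

lemma conds_C_R:
  assumes AB: "-1 \<le> B" "B < A" "A \<le> 1" and g: "0 < g" and C: "conds_C A B 0 g"
  shows "- 1 < B" "(1 + A) / (1 + B) \<le> exp 1 * (1 + 1 / g)"
    and "(1 - 1 / g) * exp (- 1) \<le> (1 - A) / (1 - B)"
proof -
  define e :: real where "e = exp 1"
  have e: "1 < e" "0 < e" using exp_1_bounds by (simp_all add: e_def)
  have B1: "B < 1" using AB by simp
  have "0 < e * (1 - B) + (e - 1) * (1 - B) * g + (A - B) * g"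
    using e B1 AB g by (intro add_pos_pos mult_pos_pos) auto
  then have "0 < e * ((A + e - 1) * 0 - (e * 0 + 1) * B + 1) + g * (A + e * (1 - B) - 1)"
    by (simp add: algebra_simps)
  moreover have "0 \<le> (e * ((A + e - 1) * 0 - (e * 0 + 1) * B + 1) + g * (A + e * (1 - B) - 1)) *
     (e * (- (A - e + 1) * 0 + B * (e * 0 + 1) + 1) + g * (- A + e * (B + 1) - 1))"
    using C by (simp only: conds_C_def cond_C2_def Let_def e_def)
  ultimately have "0 \<le> e * (- (A - e + 1) * 0 + B * (e * 0 + 1) + 1) + g * (- A + e * (B + 1) - 1)"
    by (rule zero_le_mult_pos_left)
  then have P2: "(1 + A) * g \<le> (1 + B) * (e * (g + 1))" by (simp add: algebra_simps)
  show B: "- 1 < B"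
  proof (rule ccontr)
    assume "\<not> - 1 < B"
    then have "B = - 1" using AB by simp
    moreover from this have "0 < (1 + A) * g" using g AB by (intro mult_pos_pos) auto
    ultimately show False using P2 by simp
  qed
  show "(1 + A) / (1 + B) \<le> exp 1 * (1 + 1 / g)"
    using P2 B g unfolding e_def[symmetric] by (simp add: field_simps)
  define Q1 Q2 where "Q1 = (1 - B) * (g - 1) - (1 - A) * (e * g)" and "Q2 = (1 + B) * (g - 1) - (1 + A) * (e * g)"
  have "0 \<le> (e * ((A - 1) * 0 + (1 - B) * (g - 1)) + e\<^sup>2 * (A - 1) * g + 0 * (1 - B)) *
     (- e * ((A + 1) * 0 + (B + 1) * (1 - g)) - e\<^sup>2 * (A + 1) * g + 0 * (B + 1))"
    using C by (simp only: conds_C_def cond_C4_def Let_def e_def)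
  also have "\<dots> = e\<^sup>2 * (Q1 * Q2)"
    by (simp add: Q1_def Q2_def algebra_simps power2_eq_square)
  finally have Q: "0 \<le> Q1 * Q2" using e by (simp add: zero_le_mult_iff)
  have "0 \<le> e * (0 * (1 - A * B) + B\<^sup>2 * (g - 1) - g + 1) + e\<^sup>2 * g * (1 - A * B) + 0 * (B\<^sup>2 - 1)"
    using C by (simp only: conds_C_def cond_C3_def Let_def e_def)
  also have "2 * \<dots> = - (e * ((1 + B) * Q1 + (1 - B) * Q2))"
    by (simp add: Q1_def Q2_def algebra_simps power2_eq_square)
  finally have S: "(1 + B) * Q1 + (1 - B) * Q2 \<le> 0" using e by (simp add: mult_le_0_iff)
  have "Q1 \<le> 0" using B B1 both_nonpos[OF Q S] by auto
  then have "(1 - B) * (g - 1) \<le> (1 - A) * (e * g)" by (simp add: Q1_def)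
  then have "(g - 1) / (e * g) \<le> (1 - A) / (1 - B)"
    using e g B1 by (simp add: divide_le_eq pos_le_divide_eq mult.commute)
  moreover have "(g - 1) / (e * g) = (1 - 1 / g) * exp (- 1)"
    using g e by (simp add: exp_neg_1 e_def[symmetric] field_simps)
  ultimately show "(1 - 1 / g) * exp (- 1) \<le> (1 - A) / (1 - B)" by simp
qed

section \<open>The half plane constraint in part (i)\<close>

lemma half_plane_estimate:
  fixes t n :: real
  assumes t: "0 \<le> t" and k: "k \<le> 1" and D: "D \<le> D0" and \<kappa>: "0 \<le> \<kappa>2" "D0 * \<kappa>2 \<le> r"
    and n: "p + q * t \<le> n" "0 < p" "0 < q"
    and disc: "(q + 2 * p * q - D0)\<^sup>2 \<le> 4 * q\<^sup>2 * (p + p\<^sup>2 - r)"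
  shows "D * (\<kappa>2 + t) \<le> (1 + n) * (1 + n - k)"
proof -
  have pq: "0 \<le> p + q * t" using n t by simp
  define g where "g = q + 2 * p * q - D0"
  \<comment> \<open>Completing the square: \<open>disc\<close> says that the discriminant of q^2 t^2
    + g t + (p + p^2 - r) is at most 0. This handles all t \<ge> 0 with four numbers
    \<open>D0\<close>, \<open>r\<close>, \<open>p\<close>, \<open>q\<close>.\<close>
  have "0 \<le> (2 * q\<^sup>2 * t + g)\<^sup>2 + (4 * q\<^sup>2 * (p + p\<^sup>2 - r) - g\<^sup>2)"
    using disc by (simp add: g_def)
  also have "\<dots> = 4 * q\<^sup>2 * (q\<^sup>2 * t\<^sup>2 + g * t + (p + p\<^sup>2 - r))"
    by (simp add: power2_eq_square algebra_simps)
  finally have "0 \<le> q\<^sup>2 * t\<^sup>2 + g * t + (p + p\<^sup>2 - r)"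
    using n(3) by (simp add: zero_le_mult_iff)
  also have "\<dots> = (1 + (p + q * t)) * (p + q * t) - (D0 * t + r)"
    by (simp add: g_def power2_eq_square algebra_simps)
  finally have "D0 * t + r \<le> (1 + (p + q * t)) * (p + q * t)" by simp
  also have "\<dots> \<le> (1 + n) * (1 + n - k)"
    using pq n k by (intro mult_mono) auto
  finally have "D0 * (\<kappa>2 + t) \<le> (1 + n) * (1 + n - k)" using \<kappa> by (simp add: algebra_simps)
  moreover have "D * (\<kappa>2 + t) \<le> D0 * (\<kappa>2 + t)" using D \<kappa> t by (intro mult_right_mono) auto
  ultimately show ?thesis by simp
qed

text \<open>With d = -c and t = (Im v)^2 this says that (1 + n) / v - c, for Re v = \<kappa>, lies
  outside the disc on [0, b]; \<delta> is the distance of u(0) from the boundary line. For d \<ge>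
  56/100 the factor d (b - d) is at most 1 and t \<le> n^2 is enough. Closer to 1/2 it can exceed 1,
  and the discriminant is used on two shorter ranges.\<close>

lemma half_plane_algebra:
  fixes d b n t :: real
  defines "e \<equiv> exp (1::real)"
  defines "\<kappa> \<equiv> 1 / (e - d)"
  defines "\<delta> \<equiv> 1 / (1 - d) - \<kappa>"
  assumes d: "1/2 \<le> d" "d < 1" and b: "b \<le> 1 / e + 1 / (d * e - 1)" and t: "0 \<le> t"
    and n: "(\<delta>\<^sup>2 + t) / (2 * \<delta>) \<le> n"
  shows "d * (b - d) * (\<kappa>\<^sup>2 + t) \<le> (1 + n) * (1 + n - (b - 2 * d) * \<kappa>)"
proof -
  have e: "271828/100000 \<le> e" "e \<le> 271829/100000" using exp_1_bounds by (simp_all add: e_def)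
  \<comment> \<open>\<open>Q\<close> majorises d / (d e - 1) = 1 / (e - 1/d) for d \<ge>
    \<open>lo\<close>. With \<open>hi\<close> = 1 there is no upper bound for \<delta>, which grows
    without limit as d tends to 1.\<close>
  have bound: "d * (b - d) \<le> d * (368/1000) + Q - d\<^sup>2 \<and> d * (b - d) \<le> hi * (368/1000) + Q - lo\<^sup>2 \<and> b - 2 * d \<le> 368/1000 + Q / lo - 2 * lo
      \<and> \<kappa> \<le> 1 / (2718/1000 - hi) \<and> 1 / (2719/1000 - lo) \<le> \<kappa>
      \<and> 1 / (1 - lo) - 1 / (2718/1000 - hi) \<le> \<delta> \<and> (hi < 1 \<longrightarrow> \<delta> \<le> 1 / (1 - hi) - 1 / (2719/1000 - lo))"
    if "lo \<le> d" "d \<le> hi" "1/2 \<le> lo" "hi \<le> 1" "1 \<le> Q * (271828/100000 - 1 / lo)" "0 \<le> Q" for lo hi Q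
  proof -
    have de: "0 < d * e - 1"
    proof -
      have "1/2 * (271828/100000) \<le> d * e" using d e by (intro mult_mono) auto
      then show ?thesis by simp
    qed
    have "1 / d \<le> 1 / lo" using that by (intro divide_left_mono) auto
    then have "Q * (271828/100000 - 1 / lo) \<le> Q * (e - 1 / d)"
      using that e by (intro mult_left_mono) auto
    then have "1 \<le> Q * (e - 1 / d)" using that by linarith
    then have "d \<le> Q * (d * e - 1)"
      using d mult_left_mono[of 1 "Q * (e - 1 / d)" d] by (simp add: field_simps)
    then have Q: "d * (1 / (d * e - 1)) \<le> Q" using de by (simp add: divide_le_eq)
    have e1: "1 / e \<le> 368/1000" using e by (simp add: field_simps)
    have db: "d * b \<le> d * (1 / e) + d * (1 / (d * e - 1))"
      using mult_left_mono[OF b, of d] d by (simp add: distrib_left)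
    have "d * (1 / e) \<le> d * (368/1000)" using d e1 by (intro mult_left_mono) auto
    then have "d * b \<le> d * (368/1000) + Q" using db Q by linarith
    then have 1: "d * (b - d) \<le> d * (368/1000) + Q - d\<^sup>2"
      by (simp add: power2_eq_square right_diff_distrib)
    have "lo\<^sup>2 \<le> d\<^sup>2" using that by (intro power_mono) auto
    then have 1: "d * (b - d) \<le> d * (368/1000) + Q - d\<^sup>2 \<and> d * (b - d) \<le> hi * (368/1000) + Q - lo\<^sup>2"
      using 1 that by linarith
    have "1 / (d * e - 1) \<le> Q / d" using Q d by (simp add: field_simps)
    also have "\<dots> \<le> Q / lo" using that d by (intro divide_left_mono) auto
    finally have 2: "b - 2 * d \<le> 368/1000 + Q / lo - 2 * lo" using b e1 that by linarith
    have 3: "\<kappa> \<le> 1 / (2718/1000 - hi)" "1 / (2719/1000 - lo) \<le> \<kappa>"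
      unfolding \<kappa>_def using that d e by (intro divide_left_mono mult_pos_pos; simp)+
    have "1 / (1 - lo) \<le> 1 / (1 - d)" using that d by (intro divide_left_mono mult_pos_pos) auto
    then have 4: "1 / (1 - lo) - 1 / (2718/1000 - hi) \<le> \<delta>" using 3 by (simp add: \<delta>_def)
    have 5: "\<delta> \<le> 1 / (1 - hi) - 1 / (2719/1000 - lo)" if "hi < 1"
    proof -
      have "1 / (1 - d) \<le> 1 / (1 - hi)"
        using that \<open>d \<le> hi\<close> d by (intro divide_left_mono mult_pos_pos) auto
      then show ?thesis using 3 by (simp add: \<delta>_def)
    qed
    show ?thesis using 1 2 3 4 5 by blast
  qed
  have \<kappa>0: "0 < \<kappa>" unfolding \<kappa>_def using d e by simp
  have split: "(\<delta>\<^sup>2 + t) / (2 * \<delta>) = \<delta> / 2 + t / (2 * \<delta>)" if "0 < \<delta>"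
    using that by (simp add: field_simps power2_eq_square)
  have kbound: "(b - 2 * d) * \<kappa> \<le> 1" if "b - 2 * d \<le> B" "\<kappa> \<le> K" "0 \<le> B" "B * K \<le> 1" for B K
  proof -
    have "(b - 2 * d) * \<kappa> \<le> B * K" using that \<kappa>0 by (intro mult_mono) auto
    then show ?thesis using that by linarith
  qed
  consider "d \<le> 53/100" | "53/100 \<le> d" "d \<le> 56/100" | "56/100 \<le> d" by linarith
  then show ?thesis
  proof cases
    case 1
    note bd = bound[of "1/2" "53/100" "13925/10000"]
    have D: "d * (b - d) \<le> 1338/1000" and bb: "b - 2 * d \<le> 2153/1000" and K: "\<kappa> \<le> 4571/10000"
      and \<delta>: "1542/1000 \<le> \<delta>" "\<delta> \<le> 1678/1000"
      using bd d 1 by (simp_all add: power2_eq_square)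
    have "\<kappa>\<^sup>2 \<le> (4571/10000)\<^sup>2" using K \<kappa>0 by (intro power_mono) auto
    then have K2: "1338/1000 * \<kappa>\<^sup>2 \<le> 28/100" by (simp add: power2_eq_square)
    have "771/1000 + 2979/10000 * t \<le> \<delta> / 2 + t / (2 * \<delta>)"
    proof (rule add_mono)
      have "2979/10000 * t * (2 * \<delta>) \<le> t" using mult_left_mono[OF \<delta>(2), of "t * 5958/10000"] t by simp
      then show "2979/10000 * t \<le> t / (2 * \<delta>)" using \<delta> by (simp add: le_divide_eq)
    qed (use \<delta> in simp)
    then have n': "771/1000 + 2979/10000 * t \<le> n" using n split \<delta>(1) by simp
    show ?thesis
      by (rule half_plane_estimate[OF t kbound[OF bb K] D _ K2 n']) (simp_all add: power2_eq_square)
  next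
    case 2
    note bd = bound[of "53/100" "56/100" "1203/1000"]
    have D: "d * (b - d) \<le> 1129/1000" and bb: "b - 2 * d \<le> 158/100" and K: "\<kappa> \<le> 4635/10000"
      and \<delta>: "1663/1000 \<le> \<delta>" "\<delta> \<le> 1817/1000"
      using bd d 2 by (simp_all add: power2_eq_square)
    have "\<kappa>\<^sup>2 \<le> (4635/10000)\<^sup>2" using K \<kappa>0 by (intro power_mono) auto
    then have K2: "1129/1000 * \<kappa>\<^sup>2 \<le> 28/100" by (simp add: power2_eq_square)
    have "831/1000 + 275/1000 * t \<le> \<delta> / 2 + t / (2 * \<delta>)"
    proof (rule add_mono)
      have "275/1000 * t * (2 * \<delta>) \<le> t" using mult_left_mono[OF \<delta>(2), of "t * 550/1000"] t by simp
      then show "275/1000 * t \<le> t / (2 * \<delta>)" using \<delta> by (simp add: le_divide_eq)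
    qed (use \<delta> in simp)
    then have n': "831/1000 + 275/1000 * t \<le> n" using n split \<delta>(1) by simp
    show ?thesis
      by (rule half_plane_estimate[OF t kbound[OF bb K] D _ K2 n']) (simp_all add: power2_eq_square)
  next
    case 3
    note bd = bound[of "56/100" 1 "1073/1000"]
    have bb: "b - 2 * d \<le> 117/100" and K: "\<kappa> \<le> 583/1000" and \<delta>: "169/100 \<le> \<delta>"
      using bd d 3 by (simp_all add: power2_eq_square)
    have "56/100 * (192/1000) \<le> d * (d - 368/1000)" using 3 by (intro mult_mono) auto
    moreover have "d * (b - d) \<le> d * (368/1000) + 1073/1000 - d\<^sup>2" using bd d 3 by simp
    ultimately have D: "d * (b - d) \<le> 1" by (simp add: power2_eq_square right_diff_distrib)
    have "\<kappa>\<^sup>2 \<le> (583/1000)\<^sup>2" using K \<kappa>0 by (intro power_mono) auto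
    then have K2: "\<kappa>\<^sup>2 \<le> 8/10" by (simp add: power2_eq_square)
    have nn: "\<delta> / 2 + t / (2 * \<delta>) \<le> n" using n split \<delta> by simp
    moreover have "0 \<le> t / (2 * \<delta>)" using t \<delta> by simp
    ultimately have n1: "8/10 \<le> n" using \<delta> by linarith
    have "t \<le> (\<delta> / 2 + t / (2 * \<delta>))\<^sup>2"
    proof -
      have "(\<delta> / 2 + t / (2 * \<delta>))\<^sup>2 = t + (\<delta> / 2 - t / (2 * \<delta>))\<^sup>2"
        using \<delta> by (simp add: field_simps power2_eq_square)
      then show ?thesis by simp
    qed
    also have "\<dots> \<le> n\<^sup>2" using nn \<delta> t by (intro power_mono add_nonneg_nonneg) auto
    finally have tn: "t \<le> n\<^sup>2" .
    have "d * (b - d) * (\<kappa>\<^sup>2 + t) \<le> 1 * (\<kappa>\<^sup>2 + t)" using D t by (intro mult_right_mono) auto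
    also have "\<dots> \<le> n + n\<^sup>2" using K2 n1 tn by simp
    also have "\<dots> = (1 + n) * n" by (simp add: power2_eq_square algebra_simps)
    also have "\<dots> \<le> (1 + n) * (1 + n - (b - 2 * d) * \<kappa>)"
      using kbound[OF bb K] n1 by (intro mult_left_mono) auto
    finally show ?thesis .
  qed
qed

text \<open>The point \<open>x\<close> lies on the line Re = -c. For c \<ge> 0 this line does not
  meet the open disc on [0, b]; for c < 0 the imaginary part is large enough, since (Im x)^2 \<ge> 3
  + 2 c and b \<le> 4.\<close>

lemma half_plane_avoids_disc:
  fixes v :: complex and a b c n :: real
  assumes v: "Re v = 0" "v \<noteq> 0" and c: "- 1/2 < c" and ab: "0 \<le> a" "a \<le> b" "b \<le> exp 1 + exp 1 / (exp 1 + c)"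
    and n: "((1 / (1 + c))\<^sup>2 + (Im v)\<^sup>2) / (2 * (1 / (1 + c))) \<le> n"
    and x: "x = of_real (1 + n) / v - of_real c"
  shows "0 \<le> (Re x - a) * (Re x - b) + (Im x)\<^sup>2"
proof -
  define t where "t = Im v"
  have t: "t \<noteq> 0" using v by (auto simp: t_def complex_eq_iff)
  have vt: "v = Complex 0 t" using v by (simp add: complex_eq_iff t_def)
  have x': "Re x = - c" "Im x = - ((1 + n) / t)"
    unfolding x vt using t by (simp_all add: Re_divide Im_divide power2_eq_square)
  have "0 \<le> (- c - 0) * (- c - b) + ((1 + n) / t)\<^sup>2"
  proof (cases "0 \<le> c")
    case True
    then have "0 \<le> (c - 0) * (c + b)" using ab by (intro mult_nonneg_nonneg) auto
    moreover have "(- c - 0) * (- c - b) = (c - 0) * (c + b)" by (simp add: algebra_simps)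
    ultimately show ?thesis by simp
  next
    case False
    define s where "s = 1 + c"
    have s: "1/2 < s" "s < 1" using c False by (simp_all add: s_def)
    have "((1 / s)\<^sup>2 + t\<^sup>2) / (2 * (1 / s)) = 1 / (2 * s) + s * t\<^sup>2 / 2"
      using s by (simp add: field_simps power2_eq_square)
    then have "1 + 1 / (2 * s) + s * t\<^sup>2 / 2 \<le> 1 + n"
      using n unfolding s_def[symmetric] t_def[symmetric] by linarith
    moreover have "0 \<le> 1 + 1 / (2 * s) + s * t\<^sup>2 / 2" using s by (intro add_nonneg_nonneg) auto
    ultimately have "(1 + 1 / (2 * s) + s * t\<^sup>2 / 2)\<^sup>2 \<le> (1 + n)\<^sup>2" by (intro power_mono)
    \<comment> \<open>This is (1 + \<alpha> + \<tau>)^2 = 4 (1 + \<alpha>) \<tau> + (1 + \<alpha> -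
      \<tau>)^2 with \<alpha> = 1 / (2 s) and \<tau> = s t^2 / 2.\<close>
    moreover have "(1 + 1 / (2 * s) + s * t\<^sup>2 / 2)\<^sup>2
        = (2 * s + 1) * t\<^sup>2 + (1 + 1 / (2 * s) - s * t\<^sup>2 / 2)\<^sup>2"
      using s by (simp add: field_simps power2_eq_square)
    ultimately have "(2 * s + 1) * t\<^sup>2 \<le> (1 + n)\<^sup>2"
      using zero_le_power2[of "1 + 1 / (2 * s) - s * t\<^sup>2 / 2"] by linarith
    then have 1: "3 + 2 * c \<le> ((1 + n) / t)\<^sup>2"
      using t by (simp add: s_def power_divide le_divide_eq)
    have "exp 1 / (exp 1 + c) \<le> 5/4"
      using exp_1_bounds c by (simp add: divide_le_eq)
    then have "b \<le> 4" using ab exp_1_bounds by simp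
    then have "c * 4 \<le> c * b" using False by (intro mult_left_mono_neg) auto
    moreover have "0 \<le> (2 * c + 1) * (2 * c + 11)" using c by (intro mult_nonneg_nonneg) auto
    ultimately have "0 \<le> c * (c + b) + (3 + 2 * c)" by (simp add: algebra_simps)
    then show ?thesis using 1 by (simp add: algebra_simps)
  qed
  then have "0 \<le> (Re x - 0) * (Re x - b) + (Im x)\<^sup>2" by (simp add: x' power2_eq_square)
  then show ?thesis using ab by (intro outside_disc_mono[of 0 a b b]) auto
qed

lemma half_plane_avoids_disc':
  fixes v :: complex and a b c n :: real
  defines "\<kappa> \<equiv> 1 / (exp 1 + c)"
  assumes v: "Re v = \<kappa>" and c: "- 1 < c" "c \<le> - 1/2"
    and ab: "0 \<le> a" "a \<le> b" "b \<le> 1 / exp 1 - 1 / (1 + c * exp 1)"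
    and n: "((1 / (1 + c) - \<kappa>)\<^sup>2 + (Im v)\<^sup>2) / (2 * (1 / (1 + c) - \<kappa>)) \<le> n"
    and x: "x = of_real (1 + n) / v - of_real c"
  shows "0 \<le> (Re x - a) * (Re x - b) + (Im x)\<^sup>2"
proof -
  define d where "d = - c"
  define N where "N = \<kappa>\<^sup>2 + (Im v)\<^sup>2"
  have \<kappa>: "0 < \<kappa>" unfolding \<kappa>_def using exp_1_bounds c by simp
  then have N: "0 < N" by (simp add: N_def add_pos_nonneg)
  have "1 / exp 1 - 1 / (1 + c * exp 1) = 1 / exp 1 + 1 / (d * exp 1 - 1 :: real)"
    using minus_divide_right[of 1 "1 + c * exp 1"] by (simp add: d_def)
  then have "d * (b - d) * N \<le> (1 + n) * (1 + n - (b - 2 * d) * \<kappa>)"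
    using half_plane_algebra[of d b "(Im v)\<^sup>2" n] c ab n by (simp add: d_def \<kappa>_def N_def)
  then have "0 \<le> ((1 + n) * (1 + n - (b - 2 * d) * \<kappa>) - d * (b - d) * N) / N"
    using N by simp
  also have "\<dots> = (Re x - 0) * (Re x - b) + (Im x)\<^sup>2"
  proof -
    have x': "Re x = d + (1 + n) * \<kappa> / N" "Im x = - ((1 + n) * Im v / N)"
      unfolding x using v by (simp_all add: Re_divide Im_divide N_def d_def)
    have "(Re x - 0) * (Re x - b) + (Im x)\<^sup>2
        = d * (d - b) + (2 * d - b) * ((1 + n) * \<kappa> / N) + (1 + n)\<^sup>2 * (\<kappa>\<^sup>2 + (Im v)\<^sup>2) / N\<^sup>2"
      unfolding x' by (simp add: power2_eq_square algebra_simps add_divide_distrib)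
    also have "\<dots> = d * (d - b) + (2 * d - b) * ((1 + n) * \<kappa> / N) + (1 + n)\<^sup>2 / N"
      unfolding N_def[symmetric] using N by (simp add: power2_eq_square)
    also have "\<dots> = ((1 + n) * (1 + n - (b - 2 * d) * \<kappa>) - d * (b - d) * N) / N"
      using N by (simp add: field_simps power2_eq_square)
    finally show ?thesis by simp
  qed
  finally show ?thesis using ab by (intro outside_disc_mono[of 0 a b b]) auto
qed

text \<open>Re (1 / (v - d)) > 1 / (e - d) means that v is in the open disc on [d, e]. By the
  boundary inequality with k = 0, exp of the unit circle avoids the larger disc on [1/e, e]; here d
  \<ge> 1/2 > 1/e. So for c \<le> -1/2 no exit through exp of the circle can occur inside the half
  plane.\<close>

lemma exp_circle_outside_disc:
  fixes \<zeta> :: complex and d :: real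
  assumes \<zeta>: "norm \<zeta> = 1" and d: "1/2 \<le> d" "d < 1"
  shows "\<not> 1 / (exp 1 - d) < Re (1 / (exp \<zeta> - of_real d))"
proof
  define v where "v = exp \<zeta>"
  assume *: "1 / (exp 1 - d) < Re (1 / (exp \<zeta> - of_real d))"
  have ed: "0 < exp 1 - d" using exp_1_bounds d by simp
  define N where "N = (Re v - d)\<^sup>2 + (Im v)\<^sup>2"
  have Re: "Re (1 / (exp \<zeta> - of_real d)) = (Re v - d) / N"
    by (simp add: Re_divide v_def N_def)
  have "0 < 1 / (exp 1 - d)" using ed by simp
  then have "0 < (Re v - d) / N" using * unfolding Re by linarith
  then have "N \<noteq> 0" by auto
  moreover have "0 \<le> N" by (simp add: N_def)
  ultimately have N: "0 < N" by simp
  then have "N < (exp 1 - d) * (Re v - d)"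
    using * ed unfolding Re by (simp add: field_simps)
  then have 1: "(Re v - d) * (Re v - exp 1) + (Im v)\<^sup>2 < 0"
    by (simp add: N_def power2_eq_square algebra_simps)
  have "0 \<le> (Re v - (1 - 0) * exp (- 1)) * (Re v - exp 1 * (1 + 0)) + (Im v)\<^sup>2"
    using boundary_R[OF \<zeta>, of 0] by (simp add: v_def)
  moreover have "exp (- 1 :: real) \<le> 1/2"
    using exp_1_bounds by (simp add: exp_neg_1 divide_le_eq)
  then have "(1 - 0) * exp (- 1) \<le> d" using d by simp
  ultimately have "0 \<le> (Re v - d) * (Re v - exp 1) + (Im v)\<^sup>2"
    using ed by (intro outside_disc_mono[of "(1 - 0) * exp (- 1)" d "exp 1" "exp 1 * (1 + 0)"]) auto
  then show False using 1 by simp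
qed

section \<open>Assembly of the two statements\<close>

lemma janowski_real_bounds:
  assumes "- 1 < B" "B < A" "A \<le> (1::real)"
  shows "0 \<le> (1 - A) / (1 - B)" "(1 - A) / (1 - B) \<le> (1 + A) / (1 + B)"
  using assms by (simp_all add: divide_simps algebra_simps)

lemma bernardi_exp_starlike:
  fixes A B c :: real and f :: "complex \<Rightarrow> complex"
  assumes AB: "-1 \<le> B" "B < A" "A \<le> 1" and c: "c > -1"
    and f: "f \<in> janowski_starlike A B" and C: "conds_C A B 1 c"
  shows "bernardi c f \<in> exp_starlike"
proof -
  define h where "h = starlike_quot f"
  define F where "F = bernardi c f"
  define a b where "a = (1 - A) / (1 - B)" and "b = (1 + A) / (1 + B)"
  have fA: "f \<in> class_A" and fh: "f holomorphic_on unit_disk" and f0: "f 0 = 0" "deriv f 0 = 1"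
    using f by (auto simp: janowski_starlike_def class_A_def)
  have hsub: "h \<prec>\<^sub>D janowski A B" using f by (simp add: janowski_starlike_def h_def)
  have FA: "F \<in> class_A" and Fh: "F holomorphic_on unit_disk" and F0: "F 0 = 0" "deriv F 0 = 1"
    using bernardi_properties(1)[OF fA c] by (auto simp: F_def class_A_def)
  have ode: "of_real c * F z + z * deriv F z = of_real (c + 1) * f z" if "z \<in> unit_disk" for z
    unfolding F_def by (rule bernardi_properties(2)[OF fA c that])
  have h_hol: "h holomorphic_on unit_disk" using hsub by (simp add: subordinate_def)
  have fnz: "f z \<noteq> 0" if "z \<in> unit_disk" "z \<noteq> 0" for z
    using starlike_quot_holomorphic_imp_nonzero[OF fA h_hol[unfolded h_def] that] .
  obtain f1 where f1: "f1 holomorphic_on unit_disk" "f1 0 = deriv f 0" "\<And>z. f z = z * f1 z"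
    using factor_zero_at_origin[OF fh f0(1)] by metis
  obtain F1 where F1: "F1 holomorphic_on unit_disk" "F1 0 = deriv F 0" "\<And>z. F z = z * F1 z"
    using factor_zero_at_origin[OF Fh F0(1)] by metis
  have f1nz: "f1 z \<noteq> 0" if "z \<in> unit_disk" for z
    using fnz[OF that] f1(2,3) f0 by (cases "z = 0") auto
  have c1: "(of_real (c + 1) :: complex) \<noteq> 0" using c by (simp del: of_real_add)
  \<comment> \<open>\<open>F1\<close> and \<open>f1\<close> are F/z and f/z, so u is holomorphic at
    the origin too; \<open>f1\<close> has no zeros because h is holomorphic.\<close>
  define u where "u = (\<lambda>z. F1 z / (of_real (c + 1) * f1 z))"
  have u_hol: "u holomorphic_on unit_disk"
    unfolding u_def using f1nz c1 by (intro holomorphic_intros F1(1) f1(1)) (auto simp del: of_real_add)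
  have u0: "u 0 = 1 / of_real (1 + c)"
    using f1(2) F1(2) f0 F0 by (simp add: u_def add.commute)
  have Fu: "F z = of_real (c + 1) * (f z * u z)" if "z \<in> unit_disk" for z
    using f1nz[OF that] c1 by (simp add: F1(3) f1(3) u_def del: of_real_add)
  have u_ode: "u z * (of_real c + h z) + z * deriv u z = 1" if z: "z \<in> unit_disk" for z
  proof (cases "z = 0")
    case True
    have "(of_real (1 + c) :: complex) \<noteq> 0" using c by (simp del: of_real_add)
    then show ?thesis using True by (simp add: u0 h_def starlike_quot_def add.commute)
  next
    case False
    have "((\<lambda>z. of_real (c + 1) * (f z * u z)) has_field_derivative
        of_real (c + 1) * (f z * deriv u z + deriv f z * u z)) (at z)"
      using holomorphic_derivI[OF fh _ z] holomorphic_derivI[OF u_hol _ z]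
      by (auto intro!: derivative_eq_intros)
    then have "(F has_field_derivative of_real (c + 1) * (f z * deriv u z + deriv f z * u z)) (at z)"
      by (rule has_field_derivative_transform_within_open[OF _ open_ball z]) (simp add: Fu)
    then have "deriv F z = of_real (c + 1) * (f z * deriv u z + deriv f z * u z)"
      by (rule DERIV_imp_deriv)
    with ode[OF z] have "of_real (c + 1) * (of_real c * (f z * u z) + z * (f z * deriv u z + deriv f z * u z))
        = of_real (c + 1) * f z"
      unfolding Fu[OF z] by (simp add: algebra_simps)
    then have "of_real c * (f z * u z) + z * (f z * deriv u z + deriv f z * u z) = f z"
      using c1 mult_left_cancel by blast
    moreover have "h z * f z = z * deriv f z"
      using fnz[OF z False] False by (simp add: h_def starlike_quot_def)
    moreover have "f z * (u z * (of_real c + h z) + z * deriv u z)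
        = of_real c * (f z * u z) + (h z * f z) * u z + z * (f z * deriv u z)"
      by (simp add: algebra_simps)
    ultimately have "f z * (u z * (of_real c + h z) + z * deriv u z) = f z * 1"
      by (simp add: algebra_simps)
    then show ?thesis using fnz[OF z False] mult_left_cancel by blast
  qed
  note C' = conds_C_starlike[OF AB c C]
  have B: "- 1 < B" by (rule C'(1))
  have ab: "0 \<le> a" "a \<le> b" using janowski_real_bounds[OF B AB(2,3)] by (simp_all add: a_def b_def)
  have b: "b \<le> exp 1 + exp 1 / (exp 1 + c)" using C'(2) by (simp add: b_def)
  have inside: "(Re v - a) * (Re v - b) + (Im v)\<^sup>2 < 0" if v: "v \<in> h ` unit_disk" for v
  proof -
    obtain w where w: "w ` unit_disk \<subseteq> unit_disk" "\<forall>z\<in>unit_disk. h z = janowski A B (w z)"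
      using hsub unfolding subordinate_def by blast
    obtain z where z: "z \<in> unit_disk" "v = h z" using v by blast
    then have "w z \<in> unit_disk" using w(1) by blast
    then show ?thesis
      using janowski_inside_disc[OF B AB(2,3), of "w z" v] w(2) z by (simp add: a_def b_def)
  qed
  have outside: "v \<notin> h ` unit_disk" if "0 \<le> (Re v - a) * (Re v - b) + (Im v)\<^sup>2" for v
    using inside[of v] that by linarith
  have q: "u z \<noteq> 0 \<and> 1 / u z - of_real c \<in> exp ` ball 0 1" if z: "z \<in> unit_disk" for z
  \<comment> \<open>Above -1/2 the half plane Re u > 0 serves. Otherwise Re u > 1 / (e + c), that
    is, q in the disc on [-c, e], is a constraint strong enough to decide everything by
    itself.\<close>
  proof (cases "- 1/2 < c")
    case True
    show ?thesis
    proof (rule briot_bouquet_exit[OF u_hol u0 u_ode, where \<kappa> = 0])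
      fix n :: real and v :: complex
      assume "Re v = 0" "v \<noteq> 0" "((1 / (1 + c) - 0)\<^sup>2 + (Im v)\<^sup>2) / (2 * (1 / (1 + c) - 0)) \<le> n"
      then show "of_real (1 + n) / v - of_real c \<notin> h ` unit_disk"
        by (intro outside half_plane_avoids_disc[OF _ _ True ab b _ refl]) auto
    next
      fix m :: real and \<zeta> :: complex
      assume \<zeta>: "norm \<zeta> = 1" "1 \<le> m" "0 < Re (1 / (exp \<zeta> + of_real c))"
      then have nz: "exp \<zeta> + of_real c \<noteq> 0" by auto
      have "0 \<le> Re (exp \<zeta>) + c"
      proof (rule ccontr)
        assume "\<not> 0 \<le> Re (exp \<zeta>) + c"
        then have "Re (1 / (exp \<zeta> + of_real c)) \<le> 0"
          by (simp add: Re_divide divide_nonpos_nonneg)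
        then show False using \<zeta>(3) by simp
      qed
      moreover have "1 / exp 1 - 1 / (1 + c * exp 1) \<le> a" if "- exp (- 1) < c"
        using C'(3)[OF that] by (simp add: a_def)
      ultimately show "exp \<zeta> + of_real m * \<zeta> * exp \<zeta> / (exp \<zeta> + of_real c) \<notin> h ` unit_disk"
        using True by (intro outside boundary_starlike[OF \<zeta>(1,2) _ _ nz ab b _ refl]) auto
    qed (use c z in auto)
  next
    case False
    then have c': "c \<le> - 1/2" by simp
    \<comment> \<open>Hence 1 + c e < 0, and the disc lies to the left of the value of h at \<zeta>
      = -1.\<close>
    have "c < - exp (- 1)"
    proof -
      have "exp (- 1 :: real) < 1/2" using exp_1_bounds by (simp add: exp_neg_1 divide_less_eq)
      then show ?thesis using c' by simp
    qed
    then have b': "b \<le> 1 / exp 1 - 1 / (1 + c * exp 1)" using C'(4) by (simp add: b_def)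
    show ?thesis
    proof (rule briot_bouquet_exit[OF u_hol u0 u_ode, where \<kappa> = "1 / (exp 1 + c)"])
      fix n :: real and v :: complex
      assume "Re v = 1 / (exp 1 + c)" "v \<noteq> 0"
        "((1 / (1 + c) - 1 / (exp 1 + c))\<^sup>2 + (Im v)\<^sup>2) / (2 * (1 / (1 + c) - 1 / (exp 1 + c))) \<le> n"
      then show "of_real (1 + n) / v - of_real c \<notin> h ` unit_disk"
        by (intro outside half_plane_avoids_disc'[OF _ c c' ab b' _ refl])
    next
      fix m :: real and \<zeta> :: complex
      assume "norm \<zeta> = 1" "1 / (exp 1 + c) < Re (1 / (exp \<zeta> + of_real c))"
      then have False using exp_circle_outside_disc[of \<zeta> "- c"] c c' by simp
      then show "exp \<zeta> + of_real m * \<zeta> * exp \<zeta> / (exp \<zeta> + of_real c) \<notin> h ` unit_disk" ..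
    next
      show "1 / (exp 1 + c) < 1 / (1 + c)"
        using c exp_1_bounds by (intro divide_strict_left_mono mult_pos_pos) auto
    qed (use c exp_1_bounds z in auto)
  qed
  have quot: "starlike_quot F z = 1 / u z - of_real c" if z: "z \<in> unit_disk" for z
  proof (cases "z = 0")
    case True
    then show ?thesis by (simp add: starlike_quot_def u0)
  next
    case False
    have "F z \<noteq> 0" using q[OF z] Fu[OF z] fnz[OF z False] c1 by (simp del: of_real_add)
    have "z * deriv F z = of_real (c + 1) * f z - of_real c * F z" using ode[OF z] by (simp add: algebra_simps)
    then have "z * deriv F z / F z = of_real (c + 1) * f z / F z - of_real c"
      using \<open>F z \<noteq> 0\<close> by (simp add: diff_divide_distrib)
    also have "of_real (c + 1) * f z / F z = 1 / u z"
      using Fu[OF z] fnz[OF z False] c1 by (simp del: of_real_add)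
    finally show ?thesis using False by (simp add: starlike_quot_def)
  qed
  have "starlike_quot F \<prec>\<^sub>D exp"
  proof (rule exp_disk_subordinate)
    have "(\<lambda>z. 1 / u z - of_real c) holomorphic_on unit_disk"
      using q by (intro holomorphic_intros u_hol) auto
    then show "starlike_quot F holomorphic_on unit_disk"
      by (rule holomorphic_transform) (simp add: quot)
    show "starlike_quot F 0 = 1" by (simp add: starlike_quot_def)
    show "starlike_quot F ` unit_disk \<subseteq> exp ` ball 0 1"
    proof (rule image_subsetI)
      fix z assume "z \<in> unit_disk"
      then show "starlike_quot F z \<in> exp ` ball 0 1" using q quot by presburger
    qed
  qed
  then show ?thesis using FA by (simp add: exp_starlike_def F_def)
qed

text \<open>Differentiating c F + z F' = (c + 1) f gives F' + z F'' / (c + 1) = f', an equation for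
  q = F' without a denominator that could vanish; one constraint, q in exp of the disc, is therefore
  enough.\<close>

lemma deriv_bernardi_subordinate_exp:
  fixes A B c :: real and f :: "complex \<Rightarrow> complex"
  assumes AB: "-1 \<le> B" "B < A" "A \<le> 1" and c: "c > -1"
    and f: "f \<in> janowski_R A B" and C: "conds_C A B 0 (c + 1)"
  shows "deriv (bernardi c f) \<prec>\<^sub>D exp"
proof -
  define F where "F = bernardi c f"
  define a b where "a = (1 - A) / (1 - B)" and "b = (1 + A) / (1 + B)"
  have fA: "f \<in> class_A" and fh: "f holomorphic_on unit_disk"
    using f by (auto simp: janowski_R_def class_A_def)
  have Fh: "F holomorphic_on unit_disk" and F0: "deriv F 0 = 1"
    using bernardi_properties(1)[OF fA c] by (auto simp: F_def class_A_def)
  have g: "0 < c + 1" using c by simp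
  note C' = conds_C_R[OF AB g C]
  have ab: "a \<le> b" using janowski_real_bounds[OF C'(1) AB(2,3)] by (simp add: a_def b_def)
  have pF: "deriv F holomorphic_on unit_disk" using Fh by (rule holomorphic_deriv) simp
  have ode: "of_real (c + 1) * deriv F z + z * deriv (deriv F) z = of_real (c + 1) * deriv f z"
    if z: "z \<in> unit_disk" for z
  proof -
    have "((\<lambda>z. of_real c * F z + z * deriv F z) has_field_derivative
        of_real c * deriv F z + (z * deriv (deriv F) z + deriv F z)) (at z)"
      using holomorphic_derivI[OF Fh _ z] holomorphic_derivI[OF pF _ z]
      by (auto intro!: derivative_eq_intros)
    then have D1: "((\<lambda>z. of_real (c + 1) * f z) has_field_derivative
        of_real c * deriv F z + (z * deriv (deriv F) z + deriv F z)) (at z)"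
      by (rule has_field_derivative_transform_within_open[OF _ open_ball z])
        (use bernardi_properties(2)[OF fA c] in \<open>simp add: F_def\<close>)
    have "((\<lambda>z. of_real (c + 1) * f z) has_field_derivative of_real (c + 1) * deriv f z) (at z)"
      by (intro DERIV_cmult holomorphic_derivI[OF fh _ z]) simp
    from DERIV_unique[OF D1 this] show ?thesis by (simp add: algebra_simps)
  qed
  obtain w where w: "w ` unit_disk \<subseteq> unit_disk" "\<forall>z\<in>unit_disk. deriv f z = janowski A B (w z)"
    using f unfolding janowski_R_def subordinate_def by blast
  have "deriv F z \<in> exp ` ball 0 1" if z: "z \<in> unit_disk" for z
  proof (rule exp_disk_admissible[OF pF F0 _ z])
    fix m :: real and \<zeta> z :: complex
    assume \<zeta>: "norm \<zeta> = 1" "1 \<le> m" and z: "z \<in> unit_disk" "deriv F z = exp \<zeta>"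
    show "z * deriv (deriv F) z \<noteq> of_real m * \<zeta> * exp \<zeta>"
    proof
      assume *: "z * deriv (deriv F) z = of_real m * \<zeta> * exp \<zeta>"
      \<comment> \<open>The ends (1 - k)/e and e (1 + k) move outwards as k grows, so the excluded
        disc contains the one for k = 1 / (c + 1), which by the conditions contains the Janowski
        disc.\<close>
      define k where "k = m / (c + 1)"
      have k: "1 / (c + 1) \<le> k" "0 \<le> k" using \<zeta>(2) g by (simp_all add: k_def divide_right_mono)
      have c1: "(of_real (c + 1) :: complex) \<noteq> 0" using g by (simp del: of_real_add)
      have "of_real (c + 1) * deriv f z = of_real (c + 1) * (exp \<zeta> * (1 + of_real k * \<zeta>))"
        unfolding ode[OF z(1), symmetric] z(2) * using c1
        by (simp add: k_def algebra_simps del: of_real_add)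
      then have df: "deriv f z = exp \<zeta> * (1 + of_real k * \<zeta>)" using c1 mult_left_cancel by blast
      have V: "0 \<le> (Re (deriv f z) - (1 - k) * exp (- 1)) * (Re (deriv f z) - exp 1 * (1 + k)) + (Im (deriv f z))\<^sup>2"
        unfolding df by (rule boundary_R[OF \<zeta>(1) k(2)])
      have "(1 - k) * exp (- 1) \<le> (1 - 1 / (c + 1)) * exp (- 1)"
        using k(1) by (intro mult_right_mono) auto
      then have a: "(1 - k) * exp (- 1) \<le> a" using C'(3) unfolding a_def by (rule order_trans)
      have "exp 1 * (1 + 1 / (c + 1)) \<le> exp 1 * (1 + k)"
        using k(1) by (intro mult_left_mono) auto
      with C'(2) have b: "b \<le> exp 1 * (1 + k)" unfolding b_def by (rule order_trans)
      have "0 \<le> (Re (deriv f z) - a) * (Re (deriv f z) - b) + (Im (deriv f z))\<^sup>2"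
        by (rule outside_disc_mono[OF a ab b V])
      moreover have "w z \<in> unit_disk" using w(1) z(1) by blast
      then have "(Re (deriv f z) - a) * (Re (deriv f z) - b) + (Im (deriv f z))\<^sup>2 < 0"
        using janowski_inside_disc[OF C'(1) AB(2,3), of "w z" "deriv f z"] w(2) z(1) by (simp add: a_def b_def)
      ultimately show False by simp
    qed
  qed
  then have "deriv F ` unit_disk \<subseteq> exp ` ball 0 1" by blast
  then show ?thesis
    using exp_disk_subordinate[OF pF F0] by (simp only: F_def)
qed

theorem corollary2p14:
  fixes A B c :: real and f :: "complex \<Rightarrow> complex"
  assumes "-1 \<le> B" and "B < A" and "A \<le> 1"
    and "c > -1"
    and "f \<in> class_A"
  shows "(f \<in> janowski_starlike A B \<and> conds_C A B 1 c \<longrightarrow> bernardi c f \<in> exp_starlike) \<and>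
         (f \<in> janowski_R A B \<and> conds_C A B 0 (c + 1) \<longrightarrow> deriv (bernardi c f) \<prec>\<^sub>D exp)"
  using bernardi_exp_starlike[OF assms(1-4)] deriv_bernardi_subordinate_exp[OF assms(1-4)] by blast

end
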